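(* Assume the Continuum Hypothesis ($\mathrm{CH}$). Let $u\in\omega^*$, let $\langle a_n\rangle_{n\in\omega}$ be a (strictly) increasing sequence, with respect to the preorder $\le_u$, of cut points of the continuum $\mathbb{I}_u$, and let $L$ be the supremum layer for this sequence. Then $L$ is homeomorphic to $[0,\infty)^*$.
   Context: For a Tychonoff space $Z$, $\beta Z$ is its Čech–Stone compactification and $Z^*=\beta Z\setminus Z$; $\omega^*$ is the space of nonprincipal ultrafilters on $\omega$. Let $\mathbb{I}=[0,1]$ and $\mathbb{M}=\omega\times\mathbb{I}$ (with $\omega$ discrete). The map $q:\mathbb{M}\to\omega$, $q(n,x)=n$, extends to $\beta q:\beta\mathbb{M}\to\beta\omega$, and for $u\in\omega^*$ one puts $\mathbb{I}_u=(\beta q)^{-1}(u)$, which is a continuum. Let $0_u=u\text{-}\lim\langle n,0\rangle$ and $1_u=u\text{-}\lim\langle n,1\rangle$ (limits along $u$ in $\beta\mathbb{M}$) be the bottom and top points of $\mathbb{I}_u$. Preorder $\mathbb{I}_u$ by: $x\le_u y$ if and only if every subcontinuum of $\mathbb{I}_u$ that contains $0_u$ and $y$ also contains $x$; write $x<_u y$ if $x\le_u y$ and not $y\le_u x$. The layer of a point $x$ is the set $\{y\in\mathbb{I}_u: y\le_u x \text{ and } x\le_u y\}$. The preorder $\le_u$ induces a linear order on the set of layers. A cut point of $\mathbb{I}_u$ is a point $x$ such that $\mathbb{I}_u\setminus\{x\}$ is disconnected. The sequence is increasing if $a_n<_u a_{n+1}$ for all $n$. Its supremum layer is the least layer that lies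 above all $a_n$, i.e. the layer consisting of those $x\in\mathbb{I}_u$ such that $a_n\le_u x$ for all $n$ and such that $x\le_u y$ whenever $a_n\le_u y$ for all $n$. *)

theory Defs
  imports "HOL-Analysis.Analysis"
begin

definition continuum_hypothesis :: bool where
  "continuum_hypothesis \<longleftrightarrow>
     (\<forall>A :: real set. countable A \<or> A \<approx> (UNIV :: real set))"

text \<open>
  \<open>\<beta>Z\<close> is the closure of the image of \<open>Z\<close> under the evaluation map into the cube indexed by all
  continuous functions from \<open>Z\<close> to the unit interval.  Functions are taken extensional on
  \<open>topspace Z\<close>, so that each of them occurs exactly once as an index.
\<close>

definition unit_functions :: "'a topology \<Rightarrow> ('a \<Rightarrow> real) set" where
  "unit_functions Z =
     {f \<in> extensional (topspace Z). continuous_map Z (top_of_set {0..1}) f}"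

definition stone_cech_embed :: "'a topology \<Rightarrow> 'a \<Rightarrow> ('a \<Rightarrow> real) \<Rightarrow> real" where
  "stone_cech_embed Z z = (\<lambda>f\<in>unit_functions Z. f z)"

abbreviation stone_cech_cube :: "'a topology \<Rightarrow> (('a \<Rightarrow> real) \<Rightarrow> real) topology" where
  "stone_cech_cube Z \<equiv> product_topology (\<lambda>f. top_of_set {0..1}) (unit_functions Z)"

definition stone_cech :: "'a topology \<Rightarrow> (('a \<Rightarrow> real) \<Rightarrow> real) topology" where
  "stone_cech Z =
     subtopology (stone_cech_cube Z)
       (stone_cech_cube Z closure_of (stone_cech_embed Z ` topspace Z))"

definition stone_cech_remainder :: "'a topology \<Rightarrow> (('a \<Rightarrow> real) \<Rightarrow> real) topology" where
  "stone_cech_remainder Z =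
     subtopology (stone_cech Z)
       (topspace (stone_cech Z) - stone_cech_embed Z ` topspace Z)"

text \<open>
  The extension \<open>\<beta>g\<close> of a continuous map \<open>g\<close>: since the \<open>f\<close>-coordinate of the image of \<open>y\<close> in \<open>\<beta>Y\<close>
  is \<open>f y\<close>, the \<open>f\<close>-coordinate of \<open>\<beta>g p\<close> has to be the \<open>(f \<circ> g)\<close>-coordinate of \<open>p\<close>.
\<close>

definition stone_cech_map ::
  "'a topology \<Rightarrow> 'b topology \<Rightarrow> ('a \<Rightarrow> 'b) \<Rightarrow> (('a \<Rightarrow> real) \<Rightarrow> real) \<Rightarrow> (('b \<Rightarrow> real) \<Rightarrow> real)"
where
  "stone_cech_map X Y g p =
     (\<lambda>f\<in>unit_functions Y. p (restrict (f \<circ> g) (topspace X)))"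

lemma unit_functions_eq:
  "unit_functions Z =
     mspace (submetric (cfunspace Z euclidean_metric) {f. f \<in> topspace Z \<rightarrow> {0..1}})"
proof -
  have "bounded (f ` topspace Z)" if "f \<in> topspace Z \<rightarrow> {0..1::real}" for f
    using that by (metis bounded_closed_interval bounded_subset image_subset_iff_funcset)
  then show ?thesis
    by (auto simp: unit_functions_def continuous_map_in_subtopology)
qed

lemma topspace_stone_cech:
  "topspace (stone_cech Z) = stone_cech_cube Z closure_of (stone_cech_embed Z ` topspace Z)"
  unfolding stone_cech_def by (rule topspace_subtopology_subset [OF closure_of_subset_topspace])

lemma stone_cech_embed_cube:
  "stone_cech_embed Z ` topspace Z \<subseteq> topspace (stone_cech_cube Z)"
proof (rule image_subsetI)
  fix z assume z: "z \<in> topspace Z"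
  have "f z \<in> {0..1}" if "f \<in> unit_functions Z" for f
    using that z by (auto simp: unit_functions_def continuous_map_in_subtopology)
  then show "stone_cech_embed Z z \<in> topspace (stone_cech_cube Z)"
    unfolding stone_cech_embed_def topspace_product_topology by (intro restrict_PiE_iff [THEN iffD2]) simp
qed

lemma stone_cech_embed_subset:
  "stone_cech_embed Z ` topspace Z \<subseteq> topspace (stone_cech Z)"
  unfolding topspace_stone_cech by (rule closure_of_subset [OF stone_cech_embed_cube])

lemma compact_space_stone_cech: "compact_space (stone_cech Z)"
proof -
  have "compact_space (top_of_set {0..1::real})"
    by (simp add: compact_space_subtopology)
  then have "compact_space (stone_cech_cube Z)"
    by (simp add: compact_space_product_topology)
  then show ?thesis
    unfolding stone_cech_def
    by (rule compact_space_subtopology [OF closedin_compact_space]) (rule closedin_closure_of)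
qed

lemma Hausdorff_space_stone_cech: "Hausdorff_space (stone_cech Z)"
proof -
  have "Hausdorff_space (top_of_set {0..1::real})"
    by (rule Hausdorff_space_subtopology [OF Hausdorff_space_euclidean])
  then have "Hausdorff_space (stone_cech_cube Z)"
    by (simp add: Hausdorff_space_product_topology)
  then show ?thesis
    unfolding stone_cech_def by (rule Hausdorff_space_subtopology)
qed

lemma stone_cech_embed_dense:
  "stone_cech Z closure_of (stone_cech_embed Z ` topspace Z) = topspace (stone_cech Z)"
proof -
  have "stone_cech_embed Z ` topspace Z
      \<subseteq> stone_cech_cube Z closure_of (stone_cech_embed Z ` topspace Z)"
    by (rule closure_of_subset [OF stone_cech_embed_cube])
  then show ?thesis
    unfolding topspace_stone_cech unfolding stone_cech_def closure_of_subtopology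
    by (metis Int_absorb1 order_refl)
qed

lemma embedding_map_stone_cech:
  assumes "completely_regular_space Z" "Hausdorff_space Z"
  shows "embedding_map Z (stone_cech Z) (stone_cech_embed Z)"
proof -
  have eq: "(\<lambda>x. \<lambda>f\<in>unit_functions Z. f x) = stone_cech_embed Z"
    by (rule ext) (rule stone_cech_embed_def [symmetric])
  have "embedding_map Z (stone_cech_cube Z) (stone_cech_embed Z)"
    by (rule completely_regular_space_cube_embedding_explicit
          [OF assms, folded unit_functions_eq, unfolded eq])
  moreover have "stone_cech_embed Z ` topspace Z
      \<subseteq> stone_cech_cube Z closure_of (stone_cech_embed Z ` topspace Z)"
    by (rule closure_of_subset [OF stone_cech_embed_cube])
  ultimately show ?thesis
    unfolding stone_cech_def embedding_map_in_subtopology by (rule conjI)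
qed

lemma stone_cech_coordinate:
  assumes "f \<in> unit_functions Z"
  shows "continuous_map (stone_cech Z) (top_of_set {0..1}) (\<lambda>p. p f)"
    and "z \<in> topspace Z \<Longrightarrow> stone_cech_embed Z z f = f z"
proof -
  show "continuous_map (stone_cech Z) (top_of_set {0..1}) (\<lambda>p. p f)"
    unfolding stone_cech_def
    by (intro continuous_map_from_subtopology continuous_map_product_projection assms)
qed (simp add: stone_cech_embed_def assms)

lemma unit_functions_compose:
  assumes g: "continuous_map X Y g" and f: "f \<in> unit_functions Y"
  shows "restrict (f \<circ> g) (topspace X) \<in> unit_functions X"
proof -
  have "continuous_map X (top_of_set {0..1}) (f \<circ> g)"
    using f by (intro continuous_map_compose [OF g]) (simp add: unit_functions_def)
  then have "continuous_map X (top_of_set {0..1}) (restrict (f \<circ> g) (topspace X))"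
    by (rule continuous_map_eq) simp
  then show ?thesis
    by (simp add: unit_functions_def)
qed

lemma stone_cech_map_embed:
  assumes "continuous_map X Y g" "x \<in> topspace X"
  shows "stone_cech_map X Y g (stone_cech_embed X x) = stone_cech_embed Y (g x)"
  unfolding stone_cech_map_def stone_cech_embed_def
  using assms(2) unit_functions_compose [OF assms(1)] by (intro restrict_ext) simp

lemma continuous_map_stone_cech_map:
  assumes "continuous_map X Y g"
  shows "continuous_map (stone_cech X) (stone_cech Y) (stone_cech_map X Y g)"
proof -
  note restr = unit_functions_compose [OF assms]
  have cont: "continuous_map (stone_cech X) (stone_cech_cube Y) (stone_cech_map X Y g)"
    unfolding continuous_map_componentwise
  proof (intro conjI ballI)
    show "stone_cech_map X Y g ` topspace (stone_cech X) \<subseteq> extensional (unit_functions Y)"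
      by (auto simp: stone_cech_map_def)
  next
    fix f assume f: "f \<in> unit_functions Y"
    show "continuous_map (stone_cech X) (top_of_set {0..1}) (\<lambda>p. stone_cech_map X Y g p f)"
      using stone_cech_coordinate(1) [OF restr [OF f]] f by (simp add: stone_cech_map_def)
  qed
  have "stone_cech_map X Y g ` topspace (stone_cech X)
      \<subseteq> stone_cech_cube Y closure_of
          (stone_cech_map X Y g ` (stone_cech_embed X ` topspace X))"
    using continuous_map_image_closure_subset [OF cont] stone_cech_embed_dense by metis
  also have "\<dots> \<subseteq> stone_cech_cube Y closure_of (stone_cech_embed Y ` topspace Y)"
    using assms
    by (intro closure_of_mono)
       (auto simp: image_image stone_cech_map_embed continuous_map_def)
  finally show ?thesis
    using cont by (auto simp: stone_cech_def continuous_map_in_subtopology)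
qed

definition nonprincipal_ultrafilter :: "nat filter \<Rightarrow> bool" where
  "nonprincipal_ultrafilter u \<longleftrightarrow>
     u \<noteq> bot \<and>
     (\<forall>P. eventually P u \<or> eventually (\<lambda>n. \<not> P n) u) \<and>
     (\<forall>m. \<not> eventually (\<lambda>n. n = m) u)"

definition ultrafilter_limit :: "'a topology \<Rightarrow> nat filter \<Rightarrow> (nat \<Rightarrow> 'a) \<Rightarrow> 'a" where
  "ultrafilter_limit X u s = (THE l. limitin X s l u)"

lemma ultrafilter_limit:
  assumes u: "nonprincipal_ultrafilter u"
    and X: "compact_space X" "Hausdorff_space X" and s: "\<And>n. s n \<in> topspace X"
  shows "limitin X s l u \<longleftrightarrow> l = ultrafilter_limit X u s"
proof -
  have nb: "u \<noteq> bot" and ult: "\<And>P. eventually P u \<or> eventually (\<lambda>n. \<not> P n) u"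
    using u by (auto simp: nonprincipal_ultrafilter_def)
  have "\<exists>l. limitin X s l u"
  proof (rule ccontr)
    assume "\<not> ?thesis"
    then have "\<forall>l\<in>topspace X. \<exists>U. openin X U \<and> l \<in> U \<and> \<not> eventually (\<lambda>n. s n \<in> U) u"
      by (auto simp: limitin_def)
    then obtain U where U: "\<And>l. l \<in> topspace X \<Longrightarrow>
        openin X (U l) \<and> l \<in> U l \<and> \<not> eventually (\<lambda>n. s n \<in> U l) u"
      by metis
    then have "\<exists>F. finite F \<and> F \<subseteq> U ` topspace X \<and> topspace X \<subseteq> \<Union>F"
      using X(1) unfolding compact_space_alt by (auto dest!: spec [of _ "U ` topspace X"])
    then obtain T where T: "finite T" "T \<subseteq> topspace X" "topspace X \<subseteq> (\<Union>l\<in>T. U l)"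
      by (metis finite_subset_image)
    have "eventually (\<lambda>n. \<forall>l\<in>T. s n \<notin> U l) u"
      using T U ult by (intro eventually_ball_finite) blast+
    then have "eventually (\<lambda>n. False) u"
      by (rule eventually_mono) (use T s in blast)
    with nb show False
      by (simp add: eventually_False)
  qed
  moreover have "l = l'" if "limitin X s l u" "limitin X s l' u" for l l'
    using limitin_Hausdorff_unique [OF that] nb X(2) by blast
  ultimately have "\<exists>!l. limitin X s l u"
    by blast
  then show ?thesis
    unfolding ultrafilter_limit_def by (metis (no_types, lifting) theI')
qed

abbreviation omega_space :: "nat topology" where
  "omega_space \<equiv> discrete_topology UNIV"

text \<open>The point of \<open>\<beta>\<omega>\<close> that corresponds to the ultrafilter \<open>u\<close>.\<close>

definition omega_point :: "nat filter \<Rightarrow> (nat \<Rightarrow> real) \<Rightarrow> real" where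
  "omega_point u = ultrafilter_limit (stone_cech omega_space) u (stone_cech_embed omega_space)"

lemma limitin_omega_point:
  assumes "nonprincipal_ultrafilter u"
  shows "limitin (stone_cech omega_space) (stone_cech_embed omega_space) l u \<longleftrightarrow> l = omega_point u"
  unfolding omega_point_def
  using stone_cech_embed_subset [of omega_space]
  by (intro ultrafilter_limit assms compact_space_stone_cech Hausdorff_space_stone_cech) auto

lemma indicator_unit_function: "(indicator A :: nat \<Rightarrow> real) \<in> unit_functions omega_space"
  by (auto simp: unit_functions_def indicator_def)

lemma omega_point_indicator:
  assumes u: "nonprincipal_ultrafilter u"
  shows "omega_point u (indicator A) = (if eventually (\<lambda>n. n \<in> A) u then 1 else 0)"
proof -
  have nb: "u \<noteq> bot" and ult: "\<And>P. eventually P u \<or> eventually (\<lambda>n. \<not> P n) u"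
    using u by (auto simp: nonprincipal_ultrafilter_def)
  have "limitin (top_of_set {0..1}) ((\<lambda>p. p (indicator A)) \<circ> stone_cech_embed omega_space)
          (omega_point u (indicator A)) u"
    using limitin_omega_point [OF u] stone_cech_coordinate(1) [OF indicator_unit_function]
    by (intro continuous_map_limit) auto
  then have lim: "((\<lambda>n. indicator A n) \<longlongrightarrow> omega_point u (indicator A)) u"
    by (simp add: limitin_subtopology o_def stone_cech_coordinate(2) [OF indicator_unit_function])
  show ?thesis
  proof (cases "eventually (\<lambda>n. n \<in> A) u")
    case True
    then have "((\<lambda>n. indicator A n :: real) \<longlongrightarrow> 1) u"
      by (intro tendsto_eventually) (auto elim: eventually_mono)
    with lim nb True show ?thesis
      using tendsto_unique by auto
  next
    case False
    with ult have "eventually (\<lambda>n. n \<notin> A) u"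
      by blast
    then have "((\<lambda>n. indicator A n :: real) \<longlongrightarrow> 0) u"
      by (intro tendsto_eventually) (auto elim: eventually_mono)
    with lim nb False show ?thesis
      using tendsto_unique by auto
  qed
qed

lemma bij_betw_omega_point:
  "bij_betw omega_point {u. nonprincipal_ultrafilter u}
     (topspace (stone_cech_remainder omega_space))"
proof -
  let ?e = "stone_cech_embed omega_space" and ?X = "stone_cech omega_space"
  have inj: "inj_on omega_point {u. nonprincipal_ultrafilter u}"
  proof (rule inj_onI, simp)
    fix u v assume uv: "nonprincipal_ultrafilter u" "nonprincipal_ultrafilter v"
      and eq: "omega_point u = omega_point v"
    show "u = v"
    proof (rule filter_eqI)
      fix P
      show "eventually P u = eventually P v"
        using omega_point_indicator [OF uv(1), of "Collect P"]
          omega_point_indicator [OF uv(2), of "Collect P"] eq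
        by (auto split: if_splits)
    qed
  qed
  have into: "omega_point u \<in> topspace (stone_cech_remainder omega_space)"
    if u: "nonprincipal_ultrafilter u" for u
  proof -
    have "omega_point u \<in> topspace ?X"
      using limitin_omega_point [OF u] limitin_topspace by metis
    moreover have "omega_point u \<noteq> ?e m" for m
    proof
      assume "omega_point u = ?e m"
      then have "omega_point u (indicator {m}) = 1"
        by (simp add: stone_cech_coordinate(2) [OF indicator_unit_function])
      with omega_point_indicator [OF u, of "{m}"] u show False
        by (simp add: nonprincipal_ultrafilter_def split: if_splits)
    qed
    ultimately show ?thesis
      by (auto simp: stone_cech_remainder_def)
  qed
  have onto: "\<exists>u. nonprincipal_ultrafilter u \<and> p = omega_point u"
    if "p \<in> topspace (stone_cech_remainder omega_space)" for p
  proof -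
    have p: "p \<in> topspace ?X" "\<And>m. p \<noteq> ?e m"
      using that by (auto simp: stone_cech_remainder_def)
    define u where "u = filtercomap ?e (nhdsin ?X p)"
    have ev: "eventually P u \<longleftrightarrow> (\<exists>U. openin ?X U \<and> p \<in> U \<and> (\<forall>n. ?e n \<in> U \<longrightarrow> P n))" for P
    proof
      assume "eventually P u"
      then show "\<exists>U. openin ?X U \<and> p \<in> U \<and> (\<forall>n. ?e n \<in> U \<longrightarrow> P n)"
        unfolding u_def eventually_filtercomap eventually_nhdsin using p(1) by blast
    next
      assume "\<exists>U. openin ?X U \<and> p \<in> U \<and> (\<forall>n. ?e n \<in> U \<longrightarrow> P n)"
      then obtain U where "openin ?X U" "p \<in> U" "\<forall>n. ?e n \<in> U \<longrightarrow> P n"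
        by blast
      then show "eventually P u"
        unfolding u_def eventually_filtercomap eventually_nhdsin
        by (intro exI [of _ "\<lambda>x. x \<in> U"]) auto
    qed
    have dense: "\<exists>n. ?e n \<in> U" if "openin ?X U" "p \<in> U" for U
      using stone_cech_embed_dense [of omega_space] p(1) that
      by (auto simp: closure_of_def)
    have nb: "u \<noteq> bot"
      using ev [of "\<lambda>n. False"] dense by (auto simp: trivial_limit_def)
    have ult: "eventually P u \<or> eventually (\<lambda>n. \<not> P n) u" for P
    proof -
      let ?f = "indicator (Collect P) :: nat \<Rightarrow> real"
      have pre: "openin ?X {q \<in> topspace ?X. q ?f \<in> S}" if "open S" for S
        using stone_cech_coordinate(1) [OF indicator_unit_function] that
        by (auto simp: continuous_map_in_subtopology intro!: openin_continuous_map_preimage)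
      have val: "?e n ?f = (if P n then 1 else 0)" for n
        by (simp add: stone_cech_coordinate(2) [OF indicator_unit_function] indicator_def)
      show ?thesis
      proof (cases "p ?f = 1")
        case True
        with p(1) pre [of "{0<..}"] val show ?thesis
          unfolding ev by (intro disjI1 exI [of _ "{q \<in> topspace ?X. q ?f \<in> {0<..}}"]) auto
      next
        case False
        with p(1) pre [of "- {1}"] val show ?thesis
          unfolding ev by (intro disjI2 exI [of _ "{q \<in> topspace ?X. q ?f \<in> - {1}}"]) auto
      qed
    qed
    have lim: "limitin ?X ?e p u"
      unfolding limitin_def ev using p(1) by blast
    have "\<not> eventually (\<lambda>n. n = m) u" for m
    proof
      assume "eventually (\<lambda>n. n = m) u"
      then have "eventually (\<lambda>n. ?e n = ?e m) u"
        by (rule eventually_mono) simp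
      moreover have "?e m \<in> topspace ?X"
        using stone_cech_embed_subset [of omega_space] by auto
      ultimately have "limitin ?X ?e (?e m) u"
        by (intro limitin_eventually)
      with lim nb p(2) show False
        using limitin_Hausdorff_unique Hausdorff_space_stone_cech by metis
    qed
    with nb ult have "nonprincipal_ultrafilter u"
      by (auto simp: nonprincipal_ultrafilter_def)
    with lim limitin_omega_point show ?thesis
      by blast
  qed
  show ?thesis
  proof (rule bij_betw_imageI [OF inj subset_antisym])
    show "omega_point ` {u. nonprincipal_ultrafilter u}
        \<subseteq> topspace (stone_cech_remainder omega_space)"
      using into by (intro image_subsetI) simp
  next
    show "topspace (stone_cech_remainder omega_space)
        \<subseteq> omega_point ` {u. nonprincipal_ultrafilter u}"
    proof
      fix p assume "p \<in> topspace (stone_cech_remainder omega_space)"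
      then obtain u where "nonprincipal_ultrafilter u" "p = omega_point u"
        using onto by metis
      then show "p \<in> omega_point ` {u. nonprincipal_ultrafilter u}"
        by simp
    qed
  qed
qed

abbreviation M_space :: "(nat \<times> real) topology" where
  "M_space \<equiv> prod_topology omega_space (top_of_set {0..1})"

definition I_space :: "nat filter \<Rightarrow> ((nat \<times> real \<Rightarrow> real) \<Rightarrow> real) topology" where
  "I_space u =
     subtopology (stone_cech M_space)
       {p \<in> topspace (stone_cech M_space).
          stone_cech_map M_space omega_space fst p = omega_point u}"

definition bottom_point :: "nat filter \<Rightarrow> (nat \<times> real \<Rightarrow> real) \<Rightarrow> real" where
  "bottom_point u =
     ultrafilter_limit (stone_cech M_space) u (\<lambda>n. stone_cech_embed M_space (n, 0))"

text \<open>
  Hausdorffness is not part of the definition, as it is inherited from the ambient space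
  \<open>I_space u\<close>.  Singletons count as continua.
\<close>

definition subcontinuum :: "'a topology \<Rightarrow> 'a set \<Rightarrow> bool" where
  "subcontinuum X K \<longleftrightarrow> K \<noteq> {} \<and> compactin X K \<and> connectedin X K"

definition cut_point :: "'a topology \<Rightarrow> 'a \<Rightarrow> bool" where
  "cut_point X x \<longleftrightarrow>
     x \<in> topspace X \<and> \<not> connected_space (subtopology X (topspace X - {x}))"

definition le_u ::
  "nat filter \<Rightarrow> ((nat \<times> real \<Rightarrow> real) \<Rightarrow> real) \<Rightarrow> ((nat \<times> real \<Rightarrow> real) \<Rightarrow> real) \<Rightarrow> bool"
where
  "le_u u x y \<longleftrightarrow>
     x \<in> topspace (I_space u) \<and> y \<in> topspace (I_space u) \<and>
     (\<forall>K. subcontinuum (I_space u) K \<and> bottom_point u \<in> K \<and> y \<in> K \<longrightarrow> x \<in> K)"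

definition less_u ::
  "nat filter \<Rightarrow> ((nat \<times> real \<Rightarrow> real) \<Rightarrow> real) \<Rightarrow> ((nat \<times> real \<Rightarrow> real) \<Rightarrow> real) \<Rightarrow> bool"
where
  "less_u u x y \<longleftrightarrow> le_u u x y \<and> \<not> le_u u y x"

definition layer ::
  "nat filter \<Rightarrow> ((nat \<times> real \<Rightarrow> real) \<Rightarrow> real) \<Rightarrow> ((nat \<times> real \<Rightarrow> real) \<Rightarrow> real) set"
where
  "layer u x = {y \<in> topspace (I_space u). le_u u y x \<and> le_u u x y}"

definition supremum_layer ::
  "nat filter \<Rightarrow> (nat \<Rightarrow> (nat \<times> real \<Rightarrow> real) \<Rightarrow> real) \<Rightarrow> ((nat \<times> real \<Rightarrow> real) \<Rightarrow> real) set"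
where
  "supremum_layer u a =
     {x \<in> topspace (I_space u).
        (\<forall>n. le_u u (a n) x) \<and>
        (\<forall>y \<in> topspace (I_space u). (\<forall>n. le_u u (a n) y) \<longrightarrow> le_u u x y)}"

lemma bottom_point_in_I_space:
  assumes u: "nonprincipal_ultrafilter u"
  shows "bottom_point u \<in> topspace (I_space u)"
proof -
  let ?s = "\<lambda>n. stone_cech_embed M_space (n, 0)"
  let ?b = "stone_cech_map M_space omega_space fst"
  have s: "?s n \<in> topspace (stone_cech M_space)" for n
    using stone_cech_embed_subset [of M_space] by auto
  have lim: "limitin (stone_cech M_space) ?s (bottom_point u) u"
    unfolding bottom_point_def
    using ultrafilter_limit [OF u compact_space_stone_cech Hausdorff_space_stone_cech, of ?s] s
    by blast
  have fst: "continuous_map M_space omega_space fst"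
    by (rule continuous_map_fst)
  have "limitin (stone_cech omega_space) (?b \<circ> ?s) (?b (bottom_point u)) u"
    by (intro continuous_map_limit [OF continuous_map_stone_cech_map [OF fst]] lim)
  moreover have "?b \<circ> ?s = stone_cech_embed omega_space"
    by (auto simp: fun_eq_iff stone_cech_map_embed [OF fst])
  ultimately have "?b (bottom_point u) = omega_point u"
    using limitin_omega_point [OF u] by simp
  with limitin_topspace [OF lim] show ?thesis
    by (simp add: I_space_def)
qed

lemma le_u_trans: "le_u u x y \<Longrightarrow> le_u u y z \<Longrightarrow> le_u u x z"
  by (auto simp: le_u_def)

lemma supremum_layer_eq_layer:
  assumes "x \<in> supremum_layer u a"
  shows "supremum_layer u a = layer u x"
proof (rule set_eqI)
  fix y
  have x: "x \<in> topspace (I_space u)" "\<And>n. le_u u (a n) x"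
    "\<And>z. z \<in> topspace (I_space u) \<Longrightarrow> (\<And>n. le_u u (a n) z) \<Longrightarrow> le_u u x z"
    using assms by (simp_all add: supremum_layer_def)
  show "y \<in> supremum_layer u a \<longleftrightarrow> y \<in> layer u x"
  proof
    assume "y \<in> supremum_layer u a"
    with x show "y \<in> layer u x"
      by (simp add: supremum_layer_def layer_def)
  next
    assume y: "y \<in> layer u x"
    have "le_u u (a n) y" for n
      using le_u_trans [OF x(2)] y by (simp add: layer_def)
    moreover have "le_u u y z" if "z \<in> topspace (I_space u)" "\<forall>n. le_u u (a n) z" for z
      using le_u_trans [of u y x z] x(3) [of z] y that by (simp add: layer_def)
    ultimately show "y \<in> supremum_layer u a"
      using y by (simp add: supremum_layer_def layer_def)
  qed
qed

end

(*
  The supremum layer L of an increasing sequence and the remainder of the half-line have the same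
  shape: in either case there are arcs c k n, where n is taken modulo an ultrafilter (u for L, a
  principal one for the half-line), the end of c k n is the beginning of c (k + 1) n, and the space
  consists of the points of the Stone-Cech compactification that lie in the closure of every set
  containing almost all c k n for almost all k.  A continuous function on such a space is a sequence
  of paths s k n in [0,1], up to asymptotic equality, with s k n 1 - s (k + 1) n 0 tending to 0, and
  the space is recovered from the knowledge of which finite sets of conditions "s k n y lies in a
  rational box" can be met at infinitely many stages k.

  Such sequences form a countably saturated reduced power, so under CH a transfinite back-and-forth
  construction matches the sequences on both sides, preserving all first-order formulas.  As stage
  k is always compared with stage k, the matching respects the gluing of consecutive arcs although
  the language does not mention the shift from k to k + 1.

  To see that L is of this form, one shows that x <=_u y iff every initial segment
  {p. p in the closure of {(n, t). t <= f n}} that contains y also contains x.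
*)
theory Submission
  imports Defs
begin

section \<open>Back and forth between sequences of structures\<close>

text \<open>A map between the function rings of the two spaces would have to respect asymptotic
  equality, while back and forth only produces a relation \<open>R\<close> between codes. So no such
  map is constructed. Both spaces are embedded into one cube whose coordinates are the compatible
  pairs of \<open>R\<close>, and the two images are the same set, since membership is a statement
  about boxes and \<open>R\<close> preserves these. Boxes are the only atomic statements, yet
  \<open>R\<close> has to preserve all formulas: to adjoin a new sequence, the existence of an
  element with prescribed properties must have the same truth value on both sides, and this must
  survive every later extension. Nothing has to be proved to start, because at each stage both sides
  are ultrapowers of one structure on sets of natural numbers; modulo a principal ultrafilter this
  is the structure itself. CH governs the length of the recursion: there are continuum many
  sequences, so they can be well-ordered with countably many before each one, and countable
  saturation suffices.\<close>

definition ultra :: "'a filter \<Rightarrow> bool" where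
  "ultra u \<longleftrightarrow> u \<noteq> bot \<and> (\<forall>P. eventually P u \<or> eventually (\<lambda>n. \<not> P n) u)"

lemma ultra_nonbot: "ultra u \<Longrightarrow> u \<noteq> bot"
  by (simp add: ultra_def)

lemma ultra_not:
  assumes "ultra u"
  shows "eventually (\<lambda>n. \<not> P n) u \<longleftrightarrow> \<not> eventually P u"
proof
  assume "eventually (\<lambda>n. \<not> P n) u"
  show "\<not> eventually P u"
  proof
    assume "eventually P u"
    with \<open>eventually (\<lambda>n. \<not> P n) u\<close> have "eventually (\<lambda>n. False) u"
      by eventually_elim simp
    with assms show False
      by (simp add: ultra_def eventually_False)
  qed
qed (use assms in \<open>auto simp: ultra_def\<close>)

text \<open>De Bruijn indices: \<open>Exi\<close> binds variable 0 and shifts the others. With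
  countably many symbols there are countably many formulas, so a type can be enumerated by
  \<open>from_nat\<close>.\<close>

datatype 'p fm = Atom 'p "nat list" | Neg "'p fm" | Conj "'p fm" "'p fm" | Exi "'p fm"

instance fm :: (countable) countable
  by countable_datatype

primrec sat :: "('p \<Rightarrow> 's list \<Rightarrow> bool) \<Rightarrow> 'p fm \<Rightarrow> (nat \<Rightarrow> 's) \<Rightarrow> bool" where
  "sat I (Atom p is) = (\<lambda>e. I p (map e is))"
| "sat I (Neg \<phi>) = (\<lambda>e. \<not> sat I \<phi> e)"
| "sat I (Conj \<phi> \<psi>) = (\<lambda>e. sat I \<phi> e \<and> sat I \<psi> e)"
| "sat I (Exi \<phi>) = (\<lambda>e. \<exists>y. sat I \<phi> (case_nat y e))"

text \<open>Turns a formula about some list of parameters into one about a fixed enumeration of all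
  parameters, in which those of the list may be permuted or repeated.\<close>

primrec rename :: "'p fm \<Rightarrow> (nat \<Rightarrow> nat) \<Rightarrow> 'p fm" where
  "rename (Atom p is) = (\<lambda>\<rho>. Atom p (map \<rho> is))"
| "rename (Neg \<phi>) = (\<lambda>\<rho>. Neg (rename \<phi> \<rho>))"
| "rename (Conj \<phi> \<psi>) = (\<lambda>\<rho>. Conj (rename \<phi> \<rho>) (rename \<psi> \<rho>))"
| "rename (Exi \<phi>) = (\<lambda>\<rho>. Exi (rename \<phi> (case_nat 0 (Suc \<circ> \<rho>))))"

lemma sat_rename: "sat I (rename \<phi> \<rho>) e \<longleftrightarrow> sat I \<phi> (e \<circ> \<rho>)"
proof (induction \<phi> arbitrary: \<rho> e)
  case (Exi \<phi>)
  have "case_nat y e \<circ> case_nat 0 (Suc \<circ> \<rho>) = case_nat y (e \<circ> \<rho>)" for y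
    by (auto simp: fun_eq_iff split: nat.split)
  then show ?case
    by (simp only: sat.simps rename.simps Exi.IH)
qed simp_all

text \<open>Makes being matched a property of finite sets of pairs, so that it passes to unions of
  chains.\<close>

lemma sat_finite_support: "\<exists>N. \<forall>e e'. (\<forall>i<N. e i = e' i) \<longrightarrow> sat I \<phi> e = sat I \<phi> e'"
proof (induction \<phi>)
  case (Atom p "is")
  show ?case
  proof (intro exI allI impI)
    fix e e' :: "nat \<Rightarrow> 'a"
    assume "\<forall>i < Suc (Max (set is)). e i = e' i"
    then have "map e is = map e' is"
      by (simp add: less_Suc_eq_le)
    then show "sat I (Atom p is) e = sat I (Atom p is) e'"
      by (simp only: sat.simps)
  qed
next
  case (Neg \<phi>)
  then show ?case by auto
next
  case (Conj \<phi> \<psi>)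
  then obtain N M where N: "\<And>e e'. (\<forall>i<N. e i = e' i) \<Longrightarrow> sat I \<phi> e = sat I \<phi> e'"
    and M: "\<And>e e'. (\<forall>i<M. e i = e' i) \<Longrightarrow> sat I \<psi> e = sat I \<psi> e'"
    by blast
  show ?case
  proof (intro exI allI impI)
    fix e e' :: "nat \<Rightarrow> 'a"
    assume "\<forall>i < max N M. e i = e' i"
    then show "sat I (Conj \<phi> \<psi>) e = sat I (Conj \<phi> \<psi>) e'"
      using N [of e e'] M [of e e'] by simp
  qed
next
  case (Exi \<phi>)
  then obtain N where N: "\<And>e e'. (\<forall>i<N. e i = e' i) \<Longrightarrow> sat I \<phi> e = sat I \<phi> e'"
    by blast
  show ?case
  proof (intro exI allI impI)
    fix e e' :: "nat \<Rightarrow> 'a"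
    assume "\<forall>i<N. e i = e' i"
    then have "sat I \<phi> (case_nat y e) = sat I \<phi> (case_nat y e')" for y
      by (intro N) (auto split: nat.split)
    then show "sat I (Exi \<phi>) e = sat I (Exi \<phi>) e'"
      by simp
  qed
qed

text \<open>By the theorem of Los, truth for \<open>u\<close>-almost all \<open>n\<close> is truth
  in the ultrapower by \<open>u\<close>. A formula must have the same truth value on both sides at
  almost every stage \<open>k\<close>, where the exceptional \<open>k\<close> may depend on the
  formula. No stage is compared with a different one.\<close>

definition matched ::
  "('p \<Rightarrow> 's list \<Rightarrow> bool) \<Rightarrow> 'i filter \<Rightarrow> 'j filter \<Rightarrow>
   ((nat \<Rightarrow> 'i \<Rightarrow> 's) \<times> (nat \<Rightarrow> 'j \<Rightarrow> 's)) set \<Rightarrow> bool"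
where
  "matched I u v R \<longleftrightarrow>
     (\<forall>p \<phi>. range p \<subseteq> R \<longrightarrow>
        (\<forall>\<^sub>F k in sequentially.
           (\<forall>\<^sub>F n in u. sat I \<phi> (\<lambda>i. fst (p i) k n)) =
           (\<forall>\<^sub>F n in v. sat I \<phi> (\<lambda>i. snd (p i) k n))))"

lemma matchedD:
  assumes "matched I u v R" "\<And>i. p i \<in> R"
  shows "\<forall>\<^sub>F k in sequentially.
           (\<forall>\<^sub>F n in u. sat I \<phi> (\<lambda>i. fst (p i) k n)) =
           (\<forall>\<^sub>F n in v. sat I \<phi> (\<lambda>i. snd (p i) k n))"
  using assms unfolding matched_def by blast

lemma matched_mono: "matched I u v R \<Longrightarrow> S \<subseteq> R \<Longrightarrow> matched I u v S"
  unfolding matched_def by (meson order_trans)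

lemma matched_converse:
  assumes "matched I u v R"
  shows "matched I v u (R\<inverse>)"
  unfolding matched_def
proof (intro allI impI)
  fix p :: "nat \<Rightarrow> _" and \<phi>
  assume "range p \<subseteq> R\<inverse>"
  have p: "(prod.swap \<circ> p) i \<in> R" for i
  proof -
    have "p i \<in> R\<inverse>"
      using \<open>range p \<subseteq> R\<inverse>\<close> by auto
    then show ?thesis
      by (cases "p i") simp
  qed
  show "\<forall>\<^sub>F k in sequentially.
          (\<forall>\<^sub>F n in v. sat I \<phi> (\<lambda>i. fst (p i) k n)) = (\<forall>\<^sub>F n in u. sat I \<phi> (\<lambda>i. snd (p i) k n))"
    using matchedD [OF assms p, of \<phi>] by (simp add: eq_commute)
qed

lemma matched_finite_subsets:
  assumes "\<And>X. finite X \<Longrightarrow> X \<subseteq> R \<Longrightarrow> matched I u v X"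
  shows "matched I u v R"
  unfolding matched_def
proof (intro allI impI)
  fix p :: "nat \<Rightarrow> _" and \<phi>
  assume p: "range p \<subseteq> R"
  obtain N where N: "\<And>e e'. (\<forall>i<N. e i = e' i) \<Longrightarrow> sat I \<phi> e = sat I \<phi> e'"
    using sat_finite_support [of I \<phi>] by blast
  \<comment> \<open>Freezing the enumeration from \<open>N\<close> on leaves finitely many pairs and
    changes no value that \<open>\<phi>\<close> reads.\<close>
  define q where "q i = p (min i N)" for i
  have "range q \<subseteq> p ` {..N}"
    by (auto simp: q_def)
  with assms [of "p ` {..N}"] p have "matched I u v (p ` {..N})" "\<And>i. q i \<in> p ` {..N}"
    by auto
  then have *: "\<forall>\<^sub>F k in sequentially.
      (\<forall>\<^sub>F n in u. sat I \<phi> (\<lambda>i. fst (q i) k n)) = (\<forall>\<^sub>F n in v. sat I \<phi> (\<lambda>i. snd (q i) k n))"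
    by (rule matchedD)
  have "sat I \<phi> (\<lambda>i. fst (p i) k n) = sat I \<phi> (\<lambda>i. fst (q i) k n)" for k n
    by (intro N) (simp add: q_def)
  moreover have "sat I \<phi> (\<lambda>i. snd (p i) k n) = sat I \<phi> (\<lambda>i. snd (q i) k n)" for k n
    by (intro N) (simp add: q_def)
  ultimately show "\<forall>\<^sub>F k in sequentially.
      (\<forall>\<^sub>F n in u. sat I \<phi> (\<lambda>i. fst (p i) k n)) = (\<forall>\<^sub>F n in v. sat I \<phi> (\<lambda>i. snd (p i) k n))"
    using * by simp
qed

text \<open>The start of the recursion: as both sides are powers of one structure, an element of it
  satisfies the same formulas on either side.\<close>

lemma matched_const:
  assumes "ultra u" "ultra v"
  shows "matched I u v {(\<lambda>k n. c, \<lambda>k n. c)}"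
  using assms by (auto simp: matched_def ultra_def image_subset_iff)

section \<open>Countable saturation\<close>

text \<open>A finite piece of the type that decides the formulas according to \<open>b\<close>.\<close>

primrec signed_conj :: "(nat \<Rightarrow> bool) \<Rightarrow> nat \<Rightarrow> 'p::countable fm" where
  "signed_conj b 0 = Neg (Conj (from_nat 0) (Neg (from_nat 0)))"
| "signed_conj b (Suc m) =
     Conj (signed_conj b m) (if b m then from_nat m else Neg (from_nat m))"

text \<open>Only the first \<open>m\<close> values of \<open>b\<close> enter, so finitely many
  formulas arise and one bound on \<open>k\<close> serves them all.\<close>

lemma finite_signed_conj: "finite (range (\<lambda>b. signed_conj b m :: 'p::countable fm))"
proof (induction m)
  case (Suc m)
  have "range (\<lambda>b. signed_conj b (Suc m))
      \<subseteq> (\<Union>\<psi> \<in> range (\<lambda>b. signed_conj b m). {Conj \<psi> (from_nat m), Conj \<psi> (Neg (from_nat m) :: 'p fm)})"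
    by auto
  then show ?case
    by (rule finite_subset) (intro finite_UN_I Suc finite.intros)
qed simp

lemma sat_signed_conj:
  "sat I (signed_conj b m) e \<longleftrightarrow> (\<forall>j<m. sat I (from_nat j) e = b j)"
  by (induction m) (auto simp: less_Suc_eq)

text \<open>
  Countable saturation of the reduced power: at stage \<open>k\<close> we realise the largest initial piece
  of the type of \<open>s\<close> whose existential quantification is known to transfer at stage \<open>k\<close>.
\<close>

lemma matched_extend:
  fixes I :: "'p::countable \<Rightarrow> 's list \<Rightarrow> bool"
  assumes u: "ultra u" and v: "ultra v" and R: "countable R" "R \<noteq> {}" "matched I u v R"
  shows "\<exists>t. matched I u v (insert (s, t) R)"
proof -
  define p where "p = from_nat_into R"
  have p: "range p = R"
    unfolding p_def by (rule range_from_nat_into [OF R(2,1)])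
  \<comment> \<open>All patterns \<open>b\<close> are treated at once, since the pattern shown by
    \<open>s\<close> depends on \<open>k\<close>.\<close>
  define ok where "ok m k \<longleftrightarrow> (\<forall>b.
      (\<forall>\<^sub>F n in u. sat I (Exi (signed_conj b m)) (\<lambda>i. fst (p i) k n)) =
      (\<forall>\<^sub>F n in v. sat I (Exi (signed_conj b m)) (\<lambda>i. snd (p i) k n)))" for m k
  have ok_0: "ok 0 k" for k
    by (simp add: ok_def)
  have ok: "\<forall>\<^sub>F k in sequentially. ok m k" for m
  proof -
    have "\<forall>\<^sub>F k in sequentially. \<forall>\<psi> \<in> range (\<lambda>b. signed_conj b m).
        (\<forall>\<^sub>F n in u. sat I (Exi \<psi>) (\<lambda>i. fst (p i) k n)) =
        (\<forall>\<^sub>F n in v. sat I (Exi \<psi>) (\<lambda>i. snd (p i) k n))"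
      using p by (intro eventually_ball_finite finite_signed_conj ballI matchedD [OF R(3)]) auto
    then show ?thesis
      by (rule eventually_mono) (auto simp: ok_def)
  qed
  \<comment> \<open>The bound \<open>m \<le> k\<close> makes the maximum exist, and
    \<open>ok 0 k\<close> makes it meaningful for every \<open>k\<close>.\<close>
  define \<mu> where "\<mu> k = (GREATEST m. m \<le> k \<and> ok m k)" for k
  have \<mu>: "ok (\<mu> k) k" for k
    using GreatestI_nat [of "\<lambda>m. m \<le> k \<and> ok m k" 0 k] ok_0 by (auto simp: \<mu>_def)
  have \<mu>_ge: "\<forall>\<^sub>F k in sequentially. m \<le> \<mu> k" for m
    using ok [of m] eventually_ge_at_top [of m]
  proof eventually_elim
    case (elim k)
    then show ?case
      unfolding \<mu>_def by (intro Greatest_le_nat [of _ _ k]) auto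
  qed
  define b where "b k j \<longleftrightarrow> (\<forall>\<^sub>F n in u. sat I (from_nat j) (case_nat (s k n) (\<lambda>i. fst (p i) k n)))"
    for k j
  define t where "t k n = (SOME y. sat I (signed_conj (b k) (\<mu> k)) (case_nat y (\<lambda>i. snd (p i) k n)))"
    for k n
  have t: "\<forall>\<^sub>F n in v. \<forall>j < \<mu> k. sat I (from_nat j) (case_nat (t k n) (\<lambda>i. snd (p i) k n)) = b k j" for k
  proof -
    have "\<forall>\<^sub>F n in u. \<forall>j \<in> {..<\<mu> k}. sat I (from_nat j) (case_nat (s k n) (\<lambda>i. fst (p i) k n)) = b k j"
    proof (intro eventually_ball_finite ballI)
      fix j
      show "\<forall>\<^sub>F n in u. sat I (from_nat j) (case_nat (s k n) (\<lambda>i. fst (p i) k n)) = b k j"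
        using ultra_not [OF u, of "\<lambda>n. sat I (from_nat j) (case_nat (s k n) (\<lambda>i. fst (p i) k n))"]
        by (cases "b k j") (auto simp: b_def)
    qed simp
    then have "\<forall>\<^sub>F n in u. sat I (Exi (signed_conj (b k) (\<mu> k))) (\<lambda>i. fst (p i) k n)"
      by (rule eventually_mono) (auto simp: sat_signed_conj)
    then have "\<forall>\<^sub>F n in v. sat I (Exi (signed_conj (b k) (\<mu> k))) (\<lambda>i. snd (p i) k n)"
      using \<mu> [of k] by (simp add: ok_def)
    then show ?thesis
    proof (rule eventually_mono)
      fix n
      assume "sat I (Exi (signed_conj (b k) (\<mu> k))) (\<lambda>i. snd (p i) k n)"
      then have "\<exists>y. sat I (signed_conj (b k) (\<mu> k)) (case_nat y (\<lambda>i. snd (p i) k n))"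
        by simp
      then have "sat I (signed_conj (b k) (\<mu> k)) (case_nat (t k n) (\<lambda>i. snd (p i) k n))"
        unfolding t_def by (rule someI_ex)
      then show "\<forall>j < \<mu> k. sat I (from_nat j) (case_nat (t k n) (\<lambda>i. snd (p i) k n)) = b k j"
        by (simp add: sat_signed_conj)
    qed
  qed
  have transfer: "\<forall>\<^sub>F k in sequentially.
      (\<forall>\<^sub>F n in u. sat I \<phi> (case_nat (s k n) (\<lambda>i. fst (p i) k n))) =
      (\<forall>\<^sub>F n in v. sat I \<phi> (case_nat (t k n) (\<lambda>i. snd (p i) k n)))" for \<phi>
  proof -
    define j where "j = to_nat \<phi>"
    show ?thesis
      using \<mu>_ge [of "Suc j"]
    proof eventually_elim
      case (elim k)
      have "\<forall>\<^sub>F n in v. sat I \<phi> (case_nat (t k n) (\<lambda>i. snd (p i) k n)) = b k j"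
        using t [of k] by (rule eventually_mono) (use elim in \<open>fastforce simp: j_def Suc_le_eq\<close>)
      then have "(\<forall>\<^sub>F n in v. sat I \<phi> (case_nat (t k n) (\<lambda>i. snd (p i) k n)))
          \<longleftrightarrow> eventually (\<lambda>n. b k j) v"
        by (intro eventually_subst)
      then show ?case
        using ultra_nonbot [OF v] by (simp add: b_def j_def)
    qed
  qed
  show ?thesis
  proof (intro exI, unfold matched_def, intro allI impI)
    fix q :: "nat \<Rightarrow> _" and \<phi>
    assume q: "range q \<subseteq> insert (s, t) R"
    \<comment> \<open>With the new pair at position 0 and the old ones after it, every enumeration
      of pairs is a reindexing \<open>\<rho>\<close> of this one, so \<open>transfer\<close> can be
      applied to a renamed formula.\<close>
    have "\<exists>j. q i = case_nat (s, t) p j" for i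
    proof (cases "q i = (s, t)")
      case True
      then show ?thesis by (intro exI [of _ 0]) simp
    next
      case False
      then obtain j where "q i = p j"
        using q p by (metis (no_types, lifting) insertE image_iff rangeI subset_iff)
      then show ?thesis by (intro exI [of _ "Suc j"]) simp
    qed
    then obtain \<rho> where \<rho>: "\<And>i. q i = case_nat (s, t) p (\<rho> i)"
      by metis
    have "(\<lambda>i. fst (q i) k n) = case_nat (s k n) (\<lambda>i. fst (p i) k n) \<circ> \<rho>" for k n
      by (auto simp: fun_eq_iff \<rho> split: nat.split)
    moreover have "(\<lambda>i. snd (q i) k n) = case_nat (t k n) (\<lambda>i. snd (p i) k n) \<circ> \<rho>" for k n
      by (auto simp: fun_eq_iff \<rho> split: nat.split)
    ultimately show "\<forall>\<^sub>F k in sequentially.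
        (\<forall>\<^sub>F n in u. sat I \<phi> (\<lambda>i. fst (q i) k n)) = (\<forall>\<^sub>F n in v. sat I \<phi> (\<lambda>i. snd (q i) k n))"
      using transfer [of "rename \<phi> \<rho>"] by (simp add: sat_rename)
  qed
qed

section \<open>The transfinite recursion\<close>

text \<open>
  The pairs that have been chosen after all sequences in \<open>B\<close> were handled, once on either side.
\<close>

definition stage ::
  "'s \<Rightarrow> ((nat \<Rightarrow> nat \<Rightarrow> 's) \<Rightarrow> (nat \<Rightarrow> nat \<Rightarrow> 's) \<times> (nat \<Rightarrow> nat \<Rightarrow> 's)) \<Rightarrow>
   (nat \<Rightarrow> nat \<Rightarrow> 's) set \<Rightarrow> ((nat \<Rightarrow> nat \<Rightarrow> 's) \<times> (nat \<Rightarrow> nat \<Rightarrow> 's)) set"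
where
  "stage c f B = insert (\<lambda>k n. c, \<lambda>k n. c)
     ((\<lambda>b. (b, fst (f b))) ` B \<union> (\<lambda>b. (snd (f b), b)) ` B)"

lemma stage_mono: "B \<subseteq> C \<Longrightarrow> stage c f B \<subseteq> stage c f C"
  by (auto simp: stage_def)

lemma stage_insert:
  "stage c f (insert b B) = insert (b, fst (f b)) (insert (snd (f b), b) (stage c f B))"
  by (auto simp: stage_def)

lemma finite_subset_stage:
  assumes "finite X" "X \<subseteq> stage c f B"
  shows "\<exists>F. finite F \<and> F \<subseteq> B \<and> X \<subseteq> stage c f F"
  using assms
proof (induction X rule: finite_induct)
  case empty
  then show ?case by (intro exI [of _ "{}"]) auto
next
  case (insert x X)
  then obtain F where F: "finite F" "F \<subseteq> B" "X \<subseteq> stage c f F"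
    by auto
  from insert.prems have "\<exists>G. finite G \<and> G \<subseteq> B \<and> x \<in> stage c f G"
  proof -
    have "x \<in> stage c f B"
      using insert.prems by simp
    then consider "x = (\<lambda>k n. c, \<lambda>k n. c)"
      | b where "b \<in> B" "x = (b, fst (f b))" | b where "b \<in> B" "x = (snd (f b), b)"
      by (auto simp: stage_def)
    then show ?thesis
    proof cases
      case 1
      then show ?thesis by (intro exI [of _ "{}"]) (simp add: stage_def)
    next
      case (2 b)
      then show ?thesis by (intro exI [of _ "{b}"]) (simp add: stage_def)
    next
      case (3 b)
      then show ?thesis by (intro exI [of _ "{b}"]) (simp add: stage_def)
    qed
  qed
  then obtain G where G: "finite G" "G \<subseteq> B" "x \<in> stage c f G"
    by blast
  then have "insert x X \<subseteq> stage c f (F \<union> G)"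
    using F(3) stage_mono [of F "F \<union> G"] stage_mono [of G "F \<union> G"] by blast
  with F G show ?case
    by (intro exI [of _ "F \<union> G"]) auto
qed

text \<open>Nothing new happens at limits: being matched has finite character, and a finite set of
  indices lies below its greatest member \<open>b\<close>, so its pairs were already present once
  \<open>b\<close> had been handled.\<close>

lemma matched_stage:
  assumes r: "Well_order r" "Field r = UNIV" and u: "ultra u" and v: "ultra v"
    and B: "\<And>b. b \<in> B \<Longrightarrow> matched I u v (stage c f (insert b (underS r b)))"
  shows "matched I u v (stage c f B)"
proof (rule matched_finite_subsets)
  fix X
  assume "finite X" "X \<subseteq> stage c f B"
  then obtain F where F: "finite F" "F \<subseteq> B" "X \<subseteq> stage c f F"
    using finite_subset_stage by metis
  show "matched I u v X"
  proof (cases "F = {}")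
    case True
    with F(3) have "X \<subseteq> {(\<lambda>k n. c, \<lambda>k n. c)}"
      by (simp add: stage_def)
    then show ?thesis
      by (rule matched_mono [OF matched_const [OF u v]])
  next
    case False
    have "wo_rel r"
      using r by (simp add: wo_rel_def)
    have "\<exists>b\<in>F. \<forall>a\<in>F. (a, b) \<in> r"
      using F(1) False
    proof (induction F rule: finite_ne_induct)
      case (singleton x)
      then show ?case
        using wo_rel.REFL [OF \<open>wo_rel r\<close>] r(2) by (auto simp: refl_on_def)
    next
      case (insert x F)
      then obtain b where b: "b \<in> F" "\<forall>a\<in>F. (a, b) \<in> r"
        by blast
      have trans: "trans r" and total: "(x, b) \<in> r \<or> (b, x) \<in> r"
        using wo_rel.TRANS [OF \<open>wo_rel r\<close>] wo_rel.TOTALS [OF \<open>wo_rel r\<close>] r(2) by auto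
      have "(x, x) \<in> r"
        using wo_rel.REFL [OF \<open>wo_rel r\<close>] r(2) by (auto simp: refl_on_def)
      with b total show ?case
        by (metis insert_iff trans transD)
    qed
    then obtain b where b: "b \<in> F" "\<forall>a\<in>F. (a, b) \<in> r"
      by blast
    then have "F \<subseteq> insert b (underS r b)"
      by (auto simp: underS_def)
    then have X: "X \<subseteq> stage c f (insert b (underS r b))"
      by (rule order_trans [OF F(3) stage_mono])
    have "b \<in> B"
      using b(1) F(2) by blast
    then show ?thesis
      by (rule matched_mono [OF B X])
  qed
qed

text \<open>Before the turn of \<open>a\<close> only countably many pairs are present, so
  \<open>matched_extend\<close> applies twice: to the converse relation, which finds a left partner
  for \<open>a\<close>, and then directly, which finds a right partner.\<close>

theorem back_and_forth:
  fixes I :: "'p::countable \<Rightarrow> 's list \<Rightarrow> bool"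
    and r :: "(nat \<Rightarrow> nat \<Rightarrow> 's) rel" and u v :: "nat filter"
  assumes r: "Well_order r" "Field r = UNIV" "\<And>a. countable (underS r a)"
    and u: "ultra u" and v: "ultra v"
  obtains R where "matched I u v R" "\<And>s. \<exists>t. (s, t) \<in> R" "\<And>t. \<exists>s. (s, t) \<in> R"
proof -
  define c :: 's where "c = undefined"
  \<comment> \<open>\<open>fst x\<close> is the partner of \<open>a\<close> read as a left-hand
    sequence, \<open>snd x\<close> its partner as a right-hand one.\<close>
  define P where "P f a x \<longleftrightarrow>
    matched I u v (insert (a, fst x) (insert (snd x, a) (stage c f (underS r a))))" for f a x
  have "\<exists>f. \<forall>a. P f a (f a)"
  proof (rule dependent_wf_choice)
    show "wf (r - Id)"
      using r(1) by (simp add: well_order_on_def)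
  next
    fix f g :: "(nat \<Rightarrow> nat \<Rightarrow> 's) \<Rightarrow> (nat \<Rightarrow> nat \<Rightarrow> 's) \<times> (nat \<Rightarrow> nat \<Rightarrow> 's)" and a x
    assume *: "\<And>z. (z, a) \<in> r - Id \<Longrightarrow> f z = g z"
    have "f z = g z" if "z \<in> underS r a" for z
      using * [of z] that by (auto simp: underS_def)
    then have "stage c f (underS r a) = stage c g (underS r a)"
      by (simp add: stage_def cong: image_cong_simp)
    then show "P f a x = P g a x"
      by (simp add: P_def)
  next
    fix a and f :: "(nat \<Rightarrow> nat \<Rightarrow> 's) \<Rightarrow> (nat \<Rightarrow> nat \<Rightarrow> 's) \<times> (nat \<Rightarrow> nat \<Rightarrow> 's)"
    assume *: "\<And>b. (b, a) \<in> r - Id \<Longrightarrow> P f b (f b)"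
    let ?S = "stage c f (underS r a)"
    have S: "matched I u v ?S"
    proof (rule matched_stage [OF r(1,2) u v])
      fix b
      assume "b \<in> underS r a"
      then have "P f b (f b)"
        by (intro *) (auto simp: underS_def)
      then show "matched I u v (stage c f (insert b (underS r b)))"
        by (simp add: P_def stage_insert)
    qed
    have count: "countable ?S" "?S \<noteq> {}"
      using r(3) by (auto simp: stage_def)
    have "?S\<inverse> = prod.swap ` ?S"
      by force
    then have "countable (?S\<inverse>)" "?S\<inverse> \<noteq> {}"
      using count by auto
    then have "\<exists>t. matched I v u (insert (a, t) (?S\<inverse>))"
      by (intro matched_extend v u matched_converse S)
    then obtain t where "matched I v u (insert (a, t) (?S\<inverse>))"
      by blast
    then have "matched I u v ((insert (a, t) (?S\<inverse>))\<inverse>)"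
      by (rule matched_converse)
    also have "(insert (a, t) (?S\<inverse>))\<inverse> = insert (t, a) ?S"
      by auto
    finally have t: "matched I u v (insert (t, a) ?S)" .
    have "\<exists>t'. matched I u v (insert (a, t') (insert (t, a) ?S))"
      using count by (intro matched_extend u v t) auto
    then obtain t' where "matched I u v (insert (a, t') (insert (t, a) ?S))"
      by blast
    then show "\<exists>x. P f a x"
      unfolding P_def by (intro exI [of _ "(t', t)"]) simp
  qed
  then obtain f where f: "\<And>a. P f a (f a)"
    by blast
  show thesis
  proof
    show "matched I u v (stage c f UNIV)"
    proof (rule matched_stage [OF r(1,2) u v])
      show "matched I u v (stage c f (insert b (underS r b)))" for b
        using f [of b] by (simp only: P_def stage_insert)
    qed
    show "\<exists>t. (s, t) \<in> stage c f UNIV" for s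
      by (auto simp: stage_def)
    show "\<exists>s. (s, t) \<in> stage c f UNIV" for t
      by (auto simp: stage_def)
  qed
qed

text \<open>A proper initial segment of the cardinal order is smaller than the whole type. Were it
  uncountable, CH would give it the size of the reals, which is at least that of the type.\<close>

lemma continuum_hypothesis_well_order:
  assumes CH: "continuum_hypothesis" and A: "(UNIV :: 'a set) \<lesssim> (UNIV :: real set)"
  obtains r :: "'a rel" where "Well_order r" "Field r = UNIV" "\<And>a. countable (underS r a)"
proof
  show "Well_order (card_of (UNIV :: 'a set))" "Field (card_of (UNIV :: 'a set)) = UNIV"
    using card_of_Well_order by (blast, simp add: Field_card_of)
  fix a :: 'a
  let ?B = "underS (card_of (UNIV :: 'a set)) a"
  obtain j :: "'a \<Rightarrow> real" where j: "inj j"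
    using A by (auto simp: lepoll_def)
  have less: "(card_of ?B, card_of (UNIV :: 'a set)) \<in> ordLess"
    by (rule card_of_underS [OF card_of_Card_order]) (simp add: Field_card_of)
  have "countable (j ` ?B)"
  proof (rule ccontr)
    assume "\<not> countable (j ` ?B)"
    with CH have "(UNIV :: real set) \<approx> j ` ?B"
      unfolding continuum_hypothesis_def using eqpoll_sym by blast
    also have "j ` ?B \<approx> ?B"
      using j by (intro inj_on_image_eqpoll_self) (rule inj_on_subset, auto)
    finally have "(UNIV :: 'a set) \<lesssim> ?B"
      using A eqpoll_imp_lepoll lepoll_trans by blast
    then have "(card_of (UNIV :: 'a set), card_of ?B) \<in> ordLeq"
      by (simp add: lepoll_def card_of_ordLeq [symmetric])
    with less show False
      using not_ordLess_ordLeq by blast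
  qed
  then show "countable ?B"
    using countable_image_inj_on [OF _ inj_on_subset [OF j subset_UNIV]] by blast
qed

section \<open>Closures in the Stone-Cech compactification\<close>

definition scl :: "'a topology \<Rightarrow> 'a set \<Rightarrow> (('a \<Rightarrow> real) \<Rightarrow> real) set" where
  "scl Z A = stone_cech Z closure_of (stone_cech_embed Z ` A)"

lemma scl_subset: "scl Z A \<subseteq> topspace (stone_cech Z)"
  by (simp add: scl_def closure_of_subset_topspace)

lemma scl_mono: "A \<subseteq> B \<Longrightarrow> scl Z A \<subseteq> scl Z B"
  by (simp add: scl_def closure_of_mono image_mono)

lemma scl_Un: "scl Z (A \<union> B) = scl Z A \<union> scl Z B"
  by (simp add: scl_def image_Un)

lemma scl_UN: "finite I \<Longrightarrow> scl Z (\<Union>i\<in>I. A i) = (\<Union>i\<in>I. scl Z (A i))"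
  by (induction I rule: finite_induct) (simp_all add: scl_Un, simp add: scl_def)

lemma scl_topspace: "scl Z (topspace Z) = topspace (stone_cech Z)"
  by (simp add: scl_def stone_cech_embed_dense)

lemma closedin_scl: "closedin (stone_cech Z) (scl Z A)"
  by (simp add: scl_def)

lemma embed_in_scl:
  assumes "A \<subseteq> topspace Z" "z \<in> A"
  shows "stone_cech_embed Z z \<in> scl Z A"
proof -
  have "stone_cech_embed Z ` A \<subseteq> topspace (stone_cech Z)"
    using assms stone_cech_embed_subset [of Z] by blast
  then show ?thesis
    unfolding scl_def using closure_of_subset assms(2) by blast
qed

lemma continuous_coordinate:
  "f \<in> unit_functions Z \<Longrightarrow> continuous_map (stone_cech Z) euclideanreal (\<lambda>p. p f)"
  using stone_cech_coordinate(1) continuous_map_into_fulltopology by blast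

lemma unit_functions_range:
  assumes "f \<in> unit_functions Z" "z \<in> topspace Z"
  shows "0 \<le> f z" "f z \<le> 1"
  using assms by (auto simp: unit_functions_def continuous_map_in_subtopology)

lemma scl_closed:
  assumes p: "p \<in> scl Z A" and g: "continuous_map (stone_cech Z) euclideanreal g"
    and S: "closed S" and "\<And>z. z \<in> A \<Longrightarrow> g (stone_cech_embed Z z) \<in> S"
  shows "g p \<in> S"
proof (rule forall_in_closure_of [where P = "\<lambda>x. g x \<in> S"])
  show "p \<in> stone_cech Z closure_of (stone_cech_embed Z ` A)"
    using p by (simp add: scl_def)
  show "g x \<in> S" if "x \<in> stone_cech_embed Z ` A" for x
    using that assms(4) by blast
  show "closedin (stone_cech Z) {x \<in> topspace (stone_cech Z). g x \<in> S}"
    using S by (intro closedin_continuous_map_preimage [OF g]) simp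
qed

lemma scl_coordinate_closed:
  assumes "p \<in> scl Z A" "A \<subseteq> topspace Z" "f \<in> unit_functions Z" "closed S" "\<And>z. z \<in> A \<Longrightarrow> f z \<in> S"
  shows "p f \<in> S"
  using assms by (intro scl_closed [where g = "\<lambda>p. p f"] continuous_coordinate)
    (auto simp: stone_cech_coordinate(2) subset_iff)

text \<open>\<open>p\<close> lies in the closure of one of the two parts into which \<open>f\<close>
  cuts \<open>Z\<close>; the part where \<open>f\<close> avoids \<open>V\<close> is excluded because
  the complement of \<open>V\<close> is closed.\<close>

lemma scl_coordinate_open:
  assumes p: "p \<in> topspace (stone_cech Z)" and f: "f \<in> unit_functions Z" and "open V" "p f \<in> V"
  shows "p \<in> scl Z {z \<in> topspace Z. f z \<in> V}"
proof (rule ccontr)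
  assume "\<not> ?thesis"
  moreover have "p \<in> scl Z ({z \<in> topspace Z. f z \<in> V} \<union> {z \<in> topspace Z. f z \<notin> V})"
    using p unfolding scl_topspace [symmetric] by (rule subsetD [OF scl_mono, rotated]) auto
  ultimately have "p \<in> scl Z {z \<in> topspace Z. f z \<notin> V}"
    by (simp add: scl_Un)
  then have "p f \<in> - V"
    by (rule scl_coordinate_closed) (use assms in auto)
  with assms show False
    by simp
qed

lemma stone_cech_eqI:
  assumes "p \<in> topspace (stone_cech Z)" "q \<in> topspace (stone_cech Z)"
    and "\<And>f. f \<in> unit_functions Z \<Longrightarrow> p f = q f"
  shows "p = q"
proof -
  have "topspace (stone_cech Z) \<subseteq> extensional (unit_functions Z)"
    unfolding topspace_stone_cech
    by (rule order_trans [OF closure_of_subset_topspace])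
       (auto simp: topspace_product_topology PiE_def)
  with assms show ?thesis
    by (intro extensionalityI [of p "unit_functions Z"]) auto
qed

lemma directed_closed_nonempty:
  assumes X: "compact_space X" and closed: "\<And>C. C \<in> \<C> \<Longrightarrow> closedin X C \<and> C \<noteq> {}"
    and ne: "\<C> \<noteq> {}"
    and dir: "\<And>C D. C \<in> \<C> \<Longrightarrow> D \<in> \<C> \<Longrightarrow> \<exists>E\<in>\<C>. E \<subseteq> C \<inter> D"
  shows "\<Inter>\<C> \<noteq> {}"
proof -
  have "\<exists>E\<in>\<C>. E \<subseteq> \<Inter>\<F>" if "finite \<F>" "\<F> \<subseteq> \<C>" for \<F>
    using that
  proof (induction \<F> rule: finite_induct)
    case empty
    then show ?case using ne by auto
  next
    case (insert C \<F>)
    then obtain E where "E \<in> \<C>" "E \<subseteq> \<Inter>\<F>" "C \<in> \<C>"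
      by auto
    moreover from this obtain D where "D \<in> \<C>" "D \<subseteq> C \<inter> E"
      using dir [of C E] by blast
    ultimately show ?case
      by (intro bexI [of _ D]) auto
  qed
  then have "\<Inter>\<F> \<noteq> {}" if "finite \<F>" "\<F> \<subseteq> \<C>" for \<F>
    using closed that by (metis subset_empty)
  with X closed show ?thesis
    unfolding compact_space_fip by blast
qed

section \<open>Coding paths by sets of natural numbers\<close>

text \<open>Paths live on the whole line, so that their values at all rationals determine them and
  \<open>encode\<close> is injective. Paths coming from arcs are extended constantly beyond the unit
  interval.\<close>

definition unit_paths :: "(real \<Rightarrow> real) set" where
  "unit_paths = {f. continuous_on UNIV f \<and> range f \<subseteq> {0..1}}"

lemma unit_paths_range: "f \<in> unit_paths \<Longrightarrow> 0 \<le> f x \<and> f x \<le> 1"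
  by (auto simp: unit_paths_def image_subset_iff)

text \<open>Codes, unlike arbitrary functions on the line, keep the number of sequences at the
  continuum.\<close>

definition encode :: "(real \<Rightarrow> real) \<Rightarrow> nat set" where
  "encode f = {to_nat (q, r) | q r :: rat. f (of_rat q) < of_rat r}"

text \<open>The default path makes every set of numbers a code, so formulas may quantify over all
  sets.\<close>

definition decode :: "nat set \<Rightarrow> real \<Rightarrow> real" where
  "decode C = (if C \<in> encode ` unit_paths then inv_into unit_paths encode C else (\<lambda>_. 0))"

lemma inj_on_encode: "inj_on encode unit_paths"
proof (rule inj_onI)
  fix f g
  assume f: "f \<in> unit_paths" and g: "g \<in> unit_paths" and eq: "encode f = encode g"
  have iff: "f (of_rat q) < of_rat r \<longleftrightarrow> g (of_rat q) < of_rat r" for q r :: rat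
  proof -
    have "f (of_rat q) < of_rat r \<longleftrightarrow> to_nat (q, r) \<in> encode f" for f :: "real \<Rightarrow> real"
      by (auto simp: encode_def)
    with eq show ?thesis by simp
  qed
  have rat: "f (of_rat q) = g (of_rat q)" for q :: rat
  proof (rule linorder_cases)
    assume "f (of_rat q) < g (of_rat q)"
    then obtain r :: rat where "f (of_rat q) < of_rat r" "of_rat r < g (of_rat q)"
      using of_rat_dense by blast
    with iff [of q r] show ?thesis by simp
  next
    assume "g (of_rat q) < f (of_rat q)"
    then obtain r :: rat where "g (of_rat q) < of_rat r" "of_rat r < f (of_rat q)"
      using of_rat_dense by blast
    with iff [of q r] show ?thesis by simp
  qed
  have "f x - g x = 0" for x
  proof (rule continuous_constant_on_closure [where S = "\<rat>" and f = "\<lambda>x. f x - g x"])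
    show "continuous_on (closure \<rat>) (\<lambda>x. f x - g x)"
      using f g unfolding unit_paths_def
      by (intro continuous_intros) (auto intro: continuous_on_subset)
    show "x \<in> closure \<rat>"
      by (simp add: Rats_closure_real)
    show "f x - g x = 0" if "x \<in> \<rat>" for x
      using that rat by (auto elim: Rats_cases)
  qed
  then show "f = g"
    by (simp add: fun_eq_iff)
qed

lemma decode_encode: "f \<in> unit_paths \<Longrightarrow> decode (encode f) = f"
  by (simp add: decode_def inj_on_encode)

lemma decode_unit_path: "decode C \<in> unit_paths"
  by (auto simp: decode_def inv_into_into) (simp add: unit_paths_def)

lemma decode_range: "0 \<le> decode C x" "decode C x \<le> 1"
  using unit_paths_range [OF decode_unit_path] by auto

section \<open>The relational structure on codes\<close>

type_synonym box_symbol = "(rat \<times> rat) \<times> (rat \<times> rat) list"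

text \<open>
  The first component of a symbol is the interval in which the point is sought; besides the whole
  unit interval we need its two end points, to express how consecutive paths fit together.
\<close>

definition box_interp :: "box_symbol \<Rightarrow> nat set list \<Rightarrow> bool" where
  "box_interp \<beta> Cs \<longleftrightarrow>
     (\<exists>y \<in> {of_rat (fst (fst \<beta>))..of_rat (snd (fst \<beta>))}.
        list_all2 (\<lambda>b C. decode C y \<in> {of_rat (fst b)..of_rat (snd b)}) (snd \<beta>) Cs)"

definition meets_box ::
  "'j set \<Rightarrow> ('j \<Rightarrow> rat) \<Rightarrow> ('j \<Rightarrow> rat) \<Rightarrow> ('j \<Rightarrow> nat set) \<Rightarrow> rat \<Rightarrow> rat \<Rightarrow> bool"
where
  "meets_box S lo hi C a b \<longleftrightarrow>
     (\<exists>y \<in> {of_rat a..of_rat b}. \<forall>j\<in>S. decode (C j) y \<in> {of_rat (lo j)..of_rat (hi j)})"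

lemma matched_meets_box:
  fixes R :: "((nat \<Rightarrow> nat \<Rightarrow> nat set) \<times> (nat \<Rightarrow> nat \<Rightarrow> nat set)) set"
  assumes R: "matched box_interp u v R" "R \<noteq> {}" and S: "finite S" "S \<subseteq> R"
  shows "\<forall>\<^sub>F k in sequentially.
           (\<forall>\<^sub>F n in u. meets_box S lo hi (\<lambda>q. fst q k n) a b) =
           (\<forall>\<^sub>F n in v. meets_box S lo hi (\<lambda>q. snd q k n) a b)"
proof -
  obtain js where js: "set js = S"
    using finite_list [OF S(1)] by blast
  obtain r where r: "r \<in> R"
    using R(2) by blast
  \<comment> \<open>Assignments are total, so the positions beyond the list receive an arbitrary
    pair of \<open>R\<close>.\<close>
  define p where "p i = (if i < length js then js ! i else r)" for i
  have p: "p i \<in> R" for i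
    using js S(2) r nth_mem by (fastforce simp: p_def)
  define \<phi> where "\<phi> = Atom ((a, b), map (\<lambda>q. (lo q, hi q)) js) [0..<length js]"
  have map_p: "map (\<lambda>i. h (p i)) [0..<length js] = map h js" for h :: "_ \<Rightarrow> nat set"
    by (rule nth_equalityI) (simp_all add: p_def)
  have sat: "sat box_interp \<phi> (\<lambda>i. h (p i)) \<longleftrightarrow> meets_box S lo hi h a b" for h
  proof -
    have "sat box_interp \<phi> (\<lambda>i. h (p i)) = box_interp ((a, b), map (\<lambda>q. (lo q, hi q)) js) (map h js)"
      by (simp only: \<phi>_def sat.simps map_p)
    then show ?thesis
      by (simp add: box_interp_def meets_box_def list.rel_map list_all2_same js)
  qed
  show ?thesis
    using matchedD [OF R(1), of p \<phi>, OF p]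
    by (simp only: sat [of "\<lambda>q. fst q k n" for k n] sat [of "\<lambda>q. snd q k n" for k n])
qed

section \<open>Tails\<close>

text \<open>The Fubini product of the cofinite filter with \<open>u\<close>: the exceptional set of
  \<open>n\<close> may depend on \<open>k\<close>.\<close>

definition tails :: "'i filter \<Rightarrow> (nat \<times> 'i) filter" where
  "tails u = Abs_filter (\<lambda>P. \<forall>\<^sub>F k in sequentially. \<forall>\<^sub>F n in u. P (k, n))"

lemma eventually_tails: "eventually P (tails u) \<longleftrightarrow> (\<forall>\<^sub>F k in sequentially. \<forall>\<^sub>F n in u. P (k, n))"
  unfolding tails_def
proof (rule eventually_Abs_filter, rule is_filter.intro)
  fix P Q :: "nat \<times> 'a \<Rightarrow> bool"
  assume "\<forall>\<^sub>F k in sequentially. \<forall>\<^sub>F n in u. P (k, n)" "\<forall>\<^sub>F k in sequentially. \<forall>\<^sub>F n in u. Q (k, n)"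
  then show "\<forall>\<^sub>F k in sequentially. \<forall>\<^sub>F n in u. P (k, n) \<and> Q (k, n)"
    by eventually_elim (rule eventually_conj)
next
  fix P Q :: "nat \<times> 'a \<Rightarrow> bool"
  assume PQ: "\<forall>x. P x \<longrightarrow> Q x" and P: "\<forall>\<^sub>F k in sequentially. \<forall>\<^sub>F n in u. P (k, n)"
  show "\<forall>\<^sub>F k in sequentially. \<forall>\<^sub>F n in u. Q (k, n)"
    using P by eventually_elim (erule eventually_mono, use PQ in blast)
qed simp

text \<open>
  Matching pairs compare equal stages \<open>k\<close>, so the values at the end of stage \<open>k\<close> and at the
  beginning of stage \<open>Suc k\<close> are compared separately; hence only asymptotic agreement transfers.
\<close>

definition asymp_compatible :: "nat filter \<Rightarrow> (nat \<Rightarrow> nat \<Rightarrow> real \<Rightarrow> real) \<Rightarrow> bool" where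
  "asymp_compatible u s \<longleftrightarrow>
     (\<forall>\<epsilon>>0. \<forall>\<^sub>F x in tails u. \<bar>s (fst x) (snd x) 1 - s (Suc (fst x)) (snd x) 0\<bar> < \<epsilon>)"

lemma ultra_finite_disj:
  assumes u: "ultra u" and "finite J" "\<forall>\<^sub>F n in u. \<exists>j\<in>J. P j n"
  shows "\<exists>j\<in>J. \<forall>\<^sub>F n in u. P j n"
proof (rule ccontr)
  assume "\<not> ?thesis"
  then have "\<forall>\<^sub>F n in u. \<forall>j\<in>J. \<not> P j n"
    using ultra_not [OF u] by (intro eventually_ball_finite assms(2)) auto
  with assms(3) have "\<forall>\<^sub>F n in u. False"
    by eventually_elim blast
  with ultra_nonbot [OF u] show False
    by simp
qed

text \<open>At each stage the ultrafilter puts almost all end values into one cell of width 1/N, and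
  lying in a given cell is a box condition over a degenerate interval. So the cells transfer,
  separately for stage \<open>k\<close> at 1 and stage \<open>Suc k\<close> at 0, and they determine
  the distance up to two cell widths.\<close>

lemma matched_asymp_compatible:
  fixes s t :: "nat \<Rightarrow> nat \<Rightarrow> nat set"
  assumes R: "matched box_interp u v R" "(s, t) \<in> R" and u: "ultra u"
    and s: "asymp_compatible u (\<lambda>k n. decode (s k n))"
  shows "asymp_compatible v (\<lambda>k n. decode (t k n))"
  unfolding asymp_compatible_def
proof (intro allI impI)
  fix \<epsilon> :: real
  assume "\<epsilon> > 0"
  \<comment> \<open>1/N is spent three times: on the distance known for \<open>s\<close> and on one
    cell width at either end.\<close>
  then obtain N :: nat where "N > 0" "inverse N < \<epsilon> / 3"
    using ex_inverse_of_nat_less [of "\<epsilon> / 3"] by auto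
  then have N: "N > 0" "3 * inverse (real N) < \<epsilon>"
    by auto
  define B where "B j = {of_rat (of_nat j / of_nat N)..real_of_rat (of_nat (Suc j) / of_nat N)}" for j
  have B: "\<exists>j \<in> {..N}. x \<in> B j" if "0 \<le> x" "x \<le> 1" for x :: real
  proof (intro bexI)
    have "real (nat \<lfloor>real N * x\<rfloor>) = of_int \<lfloor>real N * x\<rfloor>"
      using that by simp
    then show "x \<in> B (nat \<lfloor>real N * x\<rfloor>)"
      using N(1) by (simp add: B_def of_rat_divide of_rat_add field_simps) linarith
    have "real N * x \<le> real N"
      using that by (simp add: mult_left_le)
    then have "\<lfloor>real N * x\<rfloor> \<le> int N"
      by (metis floor_mono floor_of_nat)
    then show "nat \<lfloor>real N * x\<rfloor> \<in> {..N}"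
      by simp
  qed
  have B_close: "\<bar>x - y\<bar> \<le> inverse (real N)" if "x \<in> B j" "y \<in> B j" for x y j
  proof -
    have "real_of_rat (of_nat (Suc j) / of_nat N) = real_of_rat (of_nat j / of_nat N) + inverse (real N)"
      using N(1) by (simp add: of_rat_divide field_simps of_rat_add)
    with that show ?thesis
      by (auto simp: B_def)
  qed
  have transfer: "\<forall>\<^sub>F k in sequentially. \<forall>j\<in>{..N}.
      (\<forall>\<^sub>F n in u. decode (s k n) (of_rat a) \<in> B j) = (\<forall>\<^sub>F n in v. decode (t k n) (of_rat a) \<in> B j)"
    for a
  proof (intro eventually_ball_finite ballI)
    fix j
    show "\<forall>\<^sub>F k in sequentially.
        (\<forall>\<^sub>F n in u. decode (s k n) (of_rat a) \<in> B j) = (\<forall>\<^sub>F n in v. decode (t k n) (of_rat a) \<in> B j)"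
      using matched_meets_box [OF R(1) _, of "{(s, t)}" "\<lambda>_. of_nat j / of_nat N"
          "\<lambda>_. of_nat (Suc j) / of_nat N" a a] R(2)
      by (auto simp: meets_box_def B_def)
  qed simp
  have "\<forall>\<^sub>F k in sequentially. \<forall>\<^sub>F n in u. \<bar>decode (s k n) 1 - decode (s (Suc k) n) 0\<bar> < inverse N"
    using s N(1) unfolding asymp_compatible_def eventually_tails by simp
  moreover have "\<forall>\<^sub>F k in sequentially. \<forall>j\<in>{..N}.
      (\<forall>\<^sub>F n in u. decode (s k n) 1 \<in> B j) = (\<forall>\<^sub>F n in v. decode (t k n) 1 \<in> B j)"
    using transfer [of 1] by simp
  moreover have "\<forall>\<^sub>F k in sequentially. \<forall>j\<in>{..N}.
      (\<forall>\<^sub>F n in u. decode (s (Suc k) n) 0 \<in> B j) = (\<forall>\<^sub>F n in v. decode (t (Suc k) n) 0 \<in> B j)"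
    using transfer [of 0] by (subst eventually_sequentially_Suc) simp
  ultimately have "\<forall>\<^sub>F k in sequentially. \<forall>\<^sub>F n in v. \<bar>decode (t k n) 1 - decode (t (Suc k) n) 0\<bar> < \<epsilon>"
  proof eventually_elim
    case (elim k)
    obtain i where i: "i \<in> {..N}" "\<forall>\<^sub>F n in u. decode (s k n) 1 \<in> B i"
      using ultra_finite_disj [OF u, of "{..N}" "\<lambda>j n. decode (s k n) 1 \<in> B j"] B decode_range by auto
    obtain j where j: "j \<in> {..N}" "\<forall>\<^sub>F n in u. decode (s (Suc k) n) 0 \<in> B j"
      using ultra_finite_disj [OF u, of "{..N}" "\<lambda>j n. decode (s (Suc k) n) 0 \<in> B j"] B decode_range by auto
    have "\<forall>\<^sub>F n in u. \<exists>x y. x \<in> B i \<and> y \<in> B j \<and> \<bar>x - y\<bar> < inverse N"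
      using elim(1) i(2) j(2) by eventually_elim blast
    then obtain x y where xy: "x \<in> B i" "y \<in> B j" "\<bar>x - y\<bar> < inverse N"
      using ultra_nonbot [OF u] by auto
    have "\<forall>\<^sub>F n in v. decode (t k n) 1 \<in> B i" "\<forall>\<^sub>F n in v. decode (t (Suc k) n) 0 \<in> B j"
      using elim i j by auto
    then show ?case
    proof eventually_elim
      case (elim n)
      have "\<bar>decode (t k n) 1 - x\<bar> \<le> inverse N" "\<bar>y - decode (t (Suc k) n) 0\<bar> \<le> inverse N"
        using B_close elim xy by auto
      with xy(3) N(2) show ?case
        by linarith
    qed
  qed
  then show "\<forall>\<^sub>F x in tails v.
      \<bar>decode (t (fst x) (snd x)) 1 - decode (t (Suc (fst x)) (snd x)) 0\<bar> < \<epsilon>"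
    by (simp add: eventually_tails)
qed

section \<open>Spaces swept out by sequences of arcs\<close>

text \<open>\<open>glue\<close> makes every function on \<open>Z\<close> a compatible sequence of
  paths, and \<open>interpolate\<close> is the converse up to asymptotic equality. Together they let
  the compatible sequences serve as coordinates on the core.\<close>

locale chart_system =
  fixes Z :: "'z topology" and u :: "nat filter" and c :: "nat \<Rightarrow> nat \<Rightarrow> real \<Rightarrow> 'z"
  assumes ultra: "ultra u"
    and chart: "\<And>k n. continuous_map (top_of_set {0..1}) Z (c k n)"
    and glue: "\<And>k n. c k n 1 = c (Suc k) n 0"
    and interpolate: "\<And>s. (\<And>k n. s k n \<in> unit_paths) \<Longrightarrow> asymp_compatible u s \<Longrightarrow>
      \<exists>f\<in>unit_functions Z. \<forall>\<epsilon>>0. \<forall>\<^sub>F x in tails u.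
        \<forall>y\<in>{0..1}. \<bar>f (c (fst x) (snd x) y) - s (fst x) (snd x) y\<bar> < \<epsilon>"
begin

lemma chart_in_space: "y \<in> {0..1} \<Longrightarrow> c k n y \<in> topspace Z"
  using chart [of k n] by (auto simp: continuous_map_def)

definition tail_set :: "'z set \<Rightarrow> bool" where
  "tail_set A \<longleftrightarrow> A \<subseteq> topspace Z \<and> (\<forall>\<^sub>F x in tails u. c (fst x) (snd x) ` {0..1} \<subseteq> A)"

definition core :: "(('z \<Rightarrow> real) \<Rightarrow> real) set" where
  "core = {p \<in> topspace (stone_cech Z). \<forall>A. tail_set A \<longrightarrow> p \<in> scl Z A}"

definition realizes :: "('z \<Rightarrow> real) \<Rightarrow> (nat \<Rightarrow> nat \<Rightarrow> real \<Rightarrow> real) \<Rightarrow> bool" where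
  "realizes f s \<longleftrightarrow> f \<in> unit_functions Z \<and>
     (\<forall>\<epsilon>>0. \<forall>\<^sub>F x in tails u.
        \<forall>y\<in>{0..1}. \<bar>f (c (fst x) (snd x) y) - s (fst x) (snd x) y\<bar> < \<epsilon>)"

lemma realizes_close:
  "realizes f s \<Longrightarrow> \<epsilon> > 0 \<Longrightarrow> \<forall>\<^sub>F x in tails u.
     \<forall>y\<in>{0..1}. \<bar>f (c (fst x) (snd x) y) - s (fst x) (snd x) y\<bar> < \<epsilon>"
  by (simp add: realizes_def)

lemma tail_setI:
  assumes "\<forall>\<^sub>F x in tails u. \<forall>y\<in>{0..1}. P (c (fst x) (snd x) y)"
  shows "tail_set {z \<in> topspace Z. P z}"
  using assms unfolding tail_set_def
  by (intro conjI; (elim eventually_mono)?) (auto intro: chart_in_space)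

lemma tail_set_Int: "tail_set A \<Longrightarrow> tail_set B \<Longrightarrow> tail_set (A \<inter> B)"
  unfolding tail_set_def by (auto elim: eventually_elim2)

lemma core_closed: "closedin (stone_cech Z) core"
proof -
  have "core = topspace (stone_cech Z) \<inter> \<Inter> (scl Z ` {A. tail_set A})"
    by (auto simp: core_def)
  moreover have "closedin (stone_cech Z) (topspace (stone_cech Z) \<inter> \<Inter> (scl Z ` {A. tail_set A}))"
  proof (cases "{A. tail_set A} = {}")
    case False
    then show ?thesis
      by (intro closedin_Int closedin_topspace closedin_Inter) (auto intro: closedin_scl)
  qed auto
  ultimately show ?thesis by simp
qed

text \<open>Functions that realize the same sequence differ by at most \<open>\<epsilon>\<close> on
  a tail set, and a core point lies in the closure of that set. Hence the choice made in
  \<open>val\<close> does not matter.\<close>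

lemma core_coordinate_unique:
  assumes p: "p \<in> core" and f: "realizes f s" and g: "realizes g s"
  shows "p f = p g"
proof -
  have "\<bar>p f - p g\<bar> \<le> \<epsilon>" if "\<epsilon> > 0" for \<epsilon>
  proof -
    let ?A = "{z \<in> topspace Z. \<bar>f z - g z\<bar> \<le> \<epsilon>}"
    have fg: "f \<in> unit_functions Z" "g \<in> unit_functions Z"
      using f g by (auto simp: realizes_def)
    have "\<forall>\<^sub>F x in tails u. \<forall>y\<in>{0..1}. \<bar>f (c (fst x) (snd x) y) - s (fst x) (snd x) y\<bar> < \<epsilon> / 2"
      "\<forall>\<^sub>F x in tails u. \<forall>y\<in>{0..1}. \<bar>g (c (fst x) (snd x) y) - s (fst x) (snd x) y\<bar> < \<epsilon> / 2"
      using \<open>\<epsilon> > 0\<close> by (auto intro!: realizes_close f g simp del: less_divide_eq_numeral1)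
    then have "\<forall>\<^sub>F x in tails u. \<forall>y\<in>{0..1}. \<bar>f (c (fst x) (snd x) y) - g (c (fst x) (snd x) y)\<bar> \<le> \<epsilon>"
      by eventually_elim (smt (verit) field_sum_of_halves)
    then have "tail_set ?A"
      by (rule tail_setI)
    with p have pA: "p \<in> scl Z ?A"
      by (simp add: core_def)
    have "p f - p g \<in> {-\<epsilon>..\<epsilon>}"
    proof (rule scl_closed [OF pA, where g = "\<lambda>p. p f - p g"])
      show "continuous_map (stone_cech Z) euclideanreal (\<lambda>p. p f - p g)"
        using fg by (intro continuous_map_diff continuous_coordinate)
    qed (use fg in \<open>auto simp: stone_cech_coordinate(2)\<close>)
    then show ?thesis by auto
  qed
  then show ?thesis
    by (metis abs_le_zero_iff dense_ge eq_iff_diff_eq_0)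
qed

section \<open>Coordinates on the core\<close>

definition val :: "(('z \<Rightarrow> real) \<Rightarrow> real) \<Rightarrow> (nat \<Rightarrow> nat \<Rightarrow> real \<Rightarrow> real) \<Rightarrow> real" where
  "val p s = p (SOME f. realizes f s)"

lemma val_eq:
  assumes "p \<in> core" "realizes f s"
  shows "val p s = p f"
  unfolding val_def
  using core_coordinate_unique [OF assms(1) someI [of "\<lambda>f. realizes f s", OF assms(2)] assms(2)] .

lemma ex_realizes:
  "(\<And>k n. s k n \<in> unit_paths) \<Longrightarrow> asymp_compatible u s \<Longrightarrow> \<exists>f. realizes f s"
  using interpolate [of s] unfolding realizes_def by blast

lemma realizes_pullback:
  assumes f: "f \<in> unit_functions Z"
  obtains s where "\<And>k n. s k n \<in> unit_paths" "asymp_compatible u s" "realizes f s"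
proof
  define s where "s k n y = f (c k n (max 0 (min 1 y)))" for k n y
  show "s k n \<in> unit_paths" for k n
  proof -
    have "continuous_map Z euclideanreal f"
      using f continuous_map_into_fulltopology by (auto simp: unit_functions_def)
    then have "continuous_on {0..1} (f \<circ> c k n)"
      using continuous_map_compose [OF chart] by fastforce
    moreover have "continuous_on UNIV (\<lambda>y::real. max 0 (min 1 y))"
      by (intro continuous_intros)
    ultimately have "continuous_on UNIV ((f \<circ> c k n) \<circ> (\<lambda>y. max 0 (min 1 y)))"
      by (intro continuous_on_compose) (auto elim: continuous_on_subset)
    moreover have "0 \<le> s k n y" "s k n y \<le> 1" for y
      unfolding s_def by (intro unit_functions_range [OF f] chart_in_space; simp)+
    ultimately show ?thesis
      by (auto simp: unit_paths_def s_def [abs_def] o_def)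
  qed
  show "asymp_compatible u s"
    by (simp add: asymp_compatible_def s_def glue)
  show "realizes f s"
    using f by (simp add: realizes_def s_def)
qed

text \<open>The right-hand side does not mention \<open>Z\<close>, only box conditions, so matched
  families have equal images. If almost all arcs miss a box, then a tail set is covered by finitely
  many sets on each of which one coordinate avoids a slightly smaller box, and a core point lies in
  the closure of one of them. Conversely, compactness yields a core point with coordinates
  \<open>x\<close>.\<close>

lemma core_image:
  fixes J :: "'j set" and \<sigma> :: "'j \<Rightarrow> nat \<Rightarrow> nat \<Rightarrow> nat set"
  assumes \<sigma>: "\<And>j. j \<in> J \<Longrightarrow> asymp_compatible u (\<lambda>k n. decode (\<sigma> j k n))"
  shows "(\<lambda>p. \<lambda>j\<in>J. val p (\<lambda>k n. decode (\<sigma> j k n))) ` core =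
    {x \<in> extensional J. \<forall>S lo hi. finite S \<longrightarrow> S \<subseteq> J \<longrightarrow>
       (\<forall>j\<in>S. of_rat (lo j) < x j \<and> x j < of_rat (hi j)) \<longrightarrow>
       \<not> (\<forall>\<^sub>F k in sequentially. \<not> (\<forall>\<^sub>F n in u. meets_box S lo hi (\<lambda>j. \<sigma> j k n) 0 1))}"
  (is "?V ` core = ?X")
proof -
  define F where "F j = (SOME f. realizes f (\<lambda>k n. decode (\<sigma> j k n)))" for j
  have F: "realizes (F j) (\<lambda>k n. decode (\<sigma> j k n))" if "j \<in> J" for j
    unfolding F_def using ex_realizes [OF decode_unit_path \<sigma> [OF that]] by (rule someI_ex)
  then have F_unit: "F j \<in> unit_functions Z" if "j \<in> J" for j
    using that by (simp add: realizes_def)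
  have F_close: "\<forall>\<^sub>F x in tails u. \<forall>j\<in>S. \<forall>y\<in>{0..1}.
      \<bar>F j (c (fst x) (snd x) y) - decode (\<sigma> j (fst x) (snd x)) y\<bar> < \<epsilon>"
    if "finite S" "S \<subseteq> J" "\<epsilon> > 0" for S \<epsilon>
  proof (rule eventually_ball_finite [OF that(1)], rule ballI)
    fix j
    assume "j \<in> S"
    with that show "\<forall>\<^sub>F x in tails u. \<forall>y\<in>{0..1}.
        \<bar>F j (c (fst x) (snd x) y) - decode (\<sigma> j (fst x) (snd x)) y\<bar> < \<epsilon>"
      using realizes_close [OF F] by blast
  qed
  have V: "?V p = (\<lambda>j\<in>J. p (F j))" if "p \<in> core" for p
    using val_eq [OF that F] by (auto simp: restrict_def)
  \<comment> \<open>Negation passes through the ultrafilter \<open>u\<close> but not through the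
    cofinite filter in \<open>k\<close>, so the condition on a box is that it is met at infinitely
    many stages.\<close>
  have never: "(\<forall>\<^sub>F k in sequentially. \<not> (\<forall>\<^sub>F n in u. meets_box S lo hi (\<lambda>j. \<sigma> j k n) 0 1))
      \<longleftrightarrow> (\<forall>\<^sub>F x in tails u. \<not> meets_box S lo hi (\<lambda>j. \<sigma> j (fst x) (snd x)) 0 1)" for S lo hi
    by (simp add: eventually_tails ultra_not [OF ultra])
  show ?thesis
  proof (intro subset_antisym subsetI)
    fix x
    assume "x \<in> ?V ` core"
    then obtain p where p: "p \<in> core" "x = (\<lambda>j\<in>J. p (F j))"
      using V by auto
    show "x \<in> ?X"
      unfolding mem_Collect_eq never
    proof (intro conjI allI impI notI)
      show "x \<in> extensional J"
        by (simp add: p(2))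
      fix S lo hi
      assume S: "finite S" "S \<subseteq> J" and box: "\<forall>j\<in>S. real_of_rat (lo j) < x j \<and> x j < of_rat (hi j)"
        and miss: "\<forall>\<^sub>F x in tails u. \<not> meets_box S lo hi (\<lambda>j. \<sigma> j (fst x) (snd x)) 0 1"
      have "\<forall>\<^sub>F \<epsilon> in at_right 0. \<forall>j\<in>S. \<epsilon> < x j - of_rat (lo j) \<and> \<epsilon> < of_rat (hi j) - x j"
      proof (intro eventually_ball_finite ballI S(1))
        fix j
        assume "j \<in> S"
        with box have "0 < x j - of_rat (lo j)" "0 < of_rat (hi j) - x j"
          by auto
        then show "\<forall>\<^sub>F \<epsilon> in at_right 0. \<epsilon> < x j - of_rat (lo j) \<and> \<epsilon> < of_rat (hi j) - x j"
          by (intro eventually_conj eventually_at_right_real [THEN eventually_mono]) auto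
      qed
      moreover have "\<forall>\<^sub>F \<epsilon> in at_right 0. (0::real) < \<epsilon>"
        by (simp add: eventually_at_right_less)
      ultimately have "\<forall>\<^sub>F \<epsilon> in at_right 0. 0 < \<epsilon> \<and>
          (\<forall>j\<in>S. \<epsilon> < x j - of_rat (lo j) \<and> \<epsilon> < of_rat (hi j) - x j)"
        by eventually_elim auto
      \<comment> \<open>Room for the error with which \<open>F j\<close> follows the coded paths:
        the box shrunk by \<open>\<epsilon>\<close> still contains \<open>x\<close>.\<close>
      then obtain \<epsilon> where \<epsilon>: "\<epsilon> > 0"
        "\<And>j. j \<in> S \<Longrightarrow> \<epsilon> < x j - of_rat (lo j) \<and> \<epsilon> < of_rat (hi j) - x j"
        using eventually_happens by force
      define A where "A j = {z \<in> topspace Z. F j z \<notin> {of_rat (lo j) + \<epsilon><..<of_rat (hi j) - \<epsilon>}}" for j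
      have "tail_set {z \<in> topspace Z. \<exists>j\<in>S. F j z \<notin> {of_rat (lo j) + \<epsilon><..<of_rat (hi j) - \<epsilon>}}"
      proof (rule tail_setI)
        show "\<forall>\<^sub>F x in tails u. \<forall>y\<in>{0..1}. \<exists>j\<in>S.
            F j (c (fst x) (snd x) y) \<notin> {of_rat (lo j) + \<epsilon><..<of_rat (hi j) - \<epsilon>}"
          using F_close [OF S \<epsilon>(1)] miss
        proof eventually_elim
          case (elim x)
          show ?case
          proof
            fix y :: real
            assume y: "y \<in> {0..1}"
            then have "y \<in> {real_of_rat 0..of_rat 1}"
              by simp
            then obtain j where j: "j \<in> S"
              "decode (\<sigma> j (fst x) (snd x)) y \<notin> {of_rat (lo j)..of_rat (hi j)}"
              using elim(2) unfolding meets_box_def by blast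
            have "\<bar>F j (c (fst x) (snd x) y) - decode (\<sigma> j (fst x) (snd x)) y\<bar> < \<epsilon>"
              using elim(1) j(1) y by blast
            with j show "\<exists>j\<in>S. F j (c (fst x) (snd x) y) \<notin> {of_rat (lo j) + \<epsilon><..<of_rat (hi j) - \<epsilon>}"
              by (intro bexI [of _ j]) auto
          qed
        qed
      qed
      also have "{z \<in> topspace Z. \<exists>j\<in>S. F j z \<notin> {of_rat (lo j) + \<epsilon><..<of_rat (hi j) - \<epsilon>}} = (\<Union>j\<in>S. A j)"
        by (auto simp: A_def)
      finally have "p \<in> scl Z (\<Union>j\<in>S. A j)"
        using p(1) by (simp add: core_def)
      then obtain j where j: "j \<in> S" "p \<in> scl Z (A j)"
        by (auto simp: scl_UN [OF S(1)])
      have "p (F j) \<in> - {of_rat (lo j) + \<epsilon><..<of_rat (hi j) - \<epsilon>}"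
        using j(2) by (rule scl_coordinate_closed) (use j(1) S F_unit in \<open>auto simp: A_def\<close>)
      moreover have "p (F j) = x j"
        using p(2) j(1) S(2) by auto
      ultimately show False
        using \<epsilon>(2) [OF j(1)] by auto
    qed
  next
    fix x
    assume x: "x \<in> ?X"
    \<comment> \<open>A point common to all these closed sets, for tail sets \<open>A\<close>,
      finite \<open>S\<close> and positive \<open>\<delta>\<close>, is a core point with coordinates
      \<open>x\<close>.\<close>
    define D where "D A S \<delta> = scl Z A \<inter> {p \<in> topspace (stone_cech Z). \<forall>j\<in>S. p (F j) \<in> {x j - \<delta>..x j + \<delta>}}"
      for A S \<delta>
    define \<C> where "\<C> = {D A S \<delta> | A S \<delta>. tail_set A \<and> finite S \<and> S \<subseteq> J \<and> \<delta> > 0}"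
    have tail_top: "tail_set (topspace Z)"
      using tail_setI [of "\<lambda>_. True"] by simp
    have D_in: "D A S \<delta> \<in> \<C>" if "tail_set A" "finite S" "S \<subseteq> J" "\<delta> > 0" for A S \<delta>
      using that unfolding \<C>_def by blast
    have D_mono: "D A S \<delta> \<subseteq> D A' S' \<delta>'" if "A \<subseteq> A'" "S' \<subseteq> S" "\<delta> \<le> \<delta>'" for A A' S S' \<delta> \<delta>'
    proof
      fix p
      assume p: "p \<in> D A S \<delta>"
      then have "p (F j) \<in> {x j - \<delta>'..x j + \<delta>'}" if "j \<in> S'" for j
        using that \<open>S' \<subseteq> S\<close> \<open>\<delta> \<le> \<delta>'\<close> unfolding D_def by fastforce
      with p scl_mono [OF that(1)] show "p \<in> D A' S' \<delta>'"
        unfolding D_def by blast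
    qed
    have "\<Inter>\<C> \<noteq> {}"
    proof (rule directed_closed_nonempty [OF compact_space_stone_cech [of Z]])
      have "D (topspace Z) {} 1 \<in> \<C>"
        by (rule D_in) (use tail_top in auto)
      then show "\<C> \<noteq> {}"
        by blast
    next
      fix C E
      assume "C \<in> \<C>" "E \<in> \<C>"
      then obtain A S \<delta> A' S' \<delta>' where *: "C = D A S \<delta>" "E = D A' S' \<delta>'" "tail_set A" "tail_set A'"
        "finite S" "finite S'" "S \<subseteq> J" "S' \<subseteq> J" "\<delta> > 0" "\<delta>' > 0"
        unfolding \<C>_def by blast
      have "D (A \<inter> A') (S \<union> S') (min \<delta> \<delta>') \<subseteq> D A S \<delta>"
        "D (A \<inter> A') (S \<union> S') (min \<delta> \<delta>') \<subseteq> D A' S' \<delta>'"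
        by (intro D_mono; simp)+
      then have "D (A \<inter> A') (S \<union> S') (min \<delta> \<delta>') \<subseteq> C \<inter> E"
        unfolding *(1,2) by (rule Int_greatest)
      moreover have "D (A \<inter> A') (S \<union> S') (min \<delta> \<delta>') \<in> \<C>"
        by (rule D_in) (use * tail_set_Int in auto)
      ultimately show "\<exists>G\<in>\<C>. G \<subseteq> C \<inter> E"
        by blast
    next
      fix C
      assume "C \<in> \<C>"
      then obtain A S \<delta> where C: "C = D A S \<delta>" and A: "tail_set A" and S: "finite S" "S \<subseteq> J"
        and \<delta>: "\<delta> > 0"
        unfolding \<C>_def by blast
      have closed_j: "closedin (stone_cech Z) {p \<in> topspace (stone_cech Z). p (F j) \<in> {x j - \<delta>..x j + \<delta>}}"
        if "j \<in> S" for j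
        using that S(2) F_unit by (intro closedin_continuous_map_preimage [OF continuous_coordinate]) auto
      have "C = scl Z A \<inter> (\<Inter>j\<in>S. {p \<in> topspace (stone_cech Z). p (F j) \<in> {x j - \<delta>..x j + \<delta>}})"
        using scl_subset [of Z A] by (auto simp: C D_def)
      moreover have "closedin (stone_cech Z) \<dots>"
      proof (cases "S = {}")
        case True
        then show ?thesis by (simp add: closedin_scl)
      next
        case False
        then show ?thesis
          by (intro closedin_Int closedin_scl closedin_INT closed_j)
      qed
      ultimately have "closedin (stone_cech Z) C" by simp
      \<comment> \<open>One half of \<open>\<delta>\<close> is for the box around
        \<open>x j\<close>, the other for the error with which \<open>F j\<close> follows the coded
        path.\<close>
      have "\<exists>q::rat. x j - \<delta> / 2 < of_rat q \<and> of_rat q < x j" for j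
        using \<delta> by (intro of_rat_dense) simp
      then obtain lo :: "'j \<Rightarrow> rat" where lo: "\<And>j. x j - \<delta> / 2 < of_rat (lo j) \<and> of_rat (lo j) < x j"
        by metis
      have "\<exists>q::rat. x j < of_rat q \<and> of_rat q < x j + \<delta> / 2" for j
        using \<delta> by (intro of_rat_dense) simp
      then obtain hi :: "'j \<Rightarrow> rat" where hi: "\<And>j. x j < of_rat (hi j) \<and> of_rat (hi j) < x j + \<delta> / 2"
        by metis
      have not_never: "\<not> (\<forall>\<^sub>F x in tails u. \<not> meets_box S lo hi (\<lambda>j. \<sigma> j (fst x) (snd x)) 0 1)"
        using x S lo hi unfolding mem_Collect_eq never by blast
      \<comment> \<open>The first two demands hold on almost all arcs, and the third does not fail
        on almost all, so some arc meets all three.\<close>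
      have "\<exists>a. c (fst a) (snd a) ` {0..1} \<subseteq> A \<and>
          (\<forall>j\<in>S. \<forall>y\<in>{0..1}. \<bar>F j (c (fst a) (snd a) y) - decode (\<sigma> j (fst a) (snd a)) y\<bar> < \<delta> / 2) \<and>
          meets_box S lo hi (\<lambda>j. \<sigma> j (fst a) (snd a)) 0 1"
      proof (rule ccontr)
        assume none: "\<not> ?thesis"
        have "\<forall>\<^sub>F x in tails u. c (fst x) (snd x) ` {0..1} \<subseteq> A"
          using A by (simp add: tail_set_def)
        moreover have "\<forall>\<^sub>F x in tails u. \<forall>j\<in>S. \<forall>y\<in>{0..1}.
            \<bar>F j (c (fst x) (snd x) y) - decode (\<sigma> j (fst x) (snd x)) y\<bar> < \<delta> / 2"
          using \<delta> by (intro F_close S) simp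
        ultimately have "\<forall>\<^sub>F x in tails u. \<not> meets_box S lo hi (\<lambda>j. \<sigma> j (fst x) (snd x)) 0 1"
          by eventually_elim (use none in blast)
        with not_never show False by blast
      qed
      then obtain k n where kn: "c k n ` {0..1} \<subseteq> A"
        "\<And>j y. j \<in> S \<Longrightarrow> y \<in> {0..1} \<Longrightarrow> \<bar>F j (c k n y) - decode (\<sigma> j k n) y\<bar> < \<delta> / 2"
        "meets_box S lo hi (\<lambda>j. \<sigma> j k n) 0 1"
        by auto
      from kn(3) obtain y where y: "y \<in> {0..1}"
        "\<And>j. j \<in> S \<Longrightarrow> decode (\<sigma> j k n) y \<in> {of_rat (lo j)..of_rat (hi j)}"
        unfolding meets_box_def by auto
      have AZ: "A \<subseteq> topspace Z"
        using A by (simp add: tail_set_def)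
      have z: "c k n y \<in> A" "c k n y \<in> topspace Z"
        using kn(1) y(1) chart_in_space by blast+
      have "stone_cech_embed Z (c k n y) (F j) \<in> {x j - \<delta>..x j + \<delta>}" if "j \<in> S" for j
      proof -
        have "stone_cech_embed Z (c k n y) (F j) = F j (c k n y)"
          using that S(2) F_unit z by (intro stone_cech_coordinate(2)) auto
        moreover have "\<bar>decode (\<sigma> j k n) y - x j\<bar> < \<delta> / 2"
          using y(2) [OF that] lo [of j] hi [of j] unfolding atLeastAtMost_iff by linarith
        ultimately show ?thesis
          using kn(2) [OF that y(1)] unfolding atLeastAtMost_iff by linarith
      qed
      then have "stone_cech_embed Z (c k n y) \<in> C"
        using embed_in_scl [OF AZ z(1)] scl_subset [of Z A] by (auto simp: C D_def)
      with \<open>closedin (stone_cech Z) C\<close> show "closedin (stone_cech Z) C \<and> C \<noteq> {}"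
        by blast
    qed
    then obtain p where p: "\<And>A S \<delta>. tail_set A \<Longrightarrow> finite S \<Longrightarrow> S \<subseteq> J \<Longrightarrow> \<delta> > 0 \<Longrightarrow> p \<in> D A S \<delta>"
      unfolding \<C>_def by blast
    have core: "p \<in> core"
      using p [of _ "{}" 1] p [OF tail_top, of "{}" 1] by (auto simp: core_def D_def)
    have "p (F j) = x j" if "j \<in> J" for j
    proof -
      have "\<bar>p (F j) - x j\<bar> \<le> \<delta>" if "\<delta> > 0" for \<delta>
        using p [OF tail_top, of "{j}" \<delta>] \<open>j \<in> J\<close> that by (auto simp: D_def)
      then show ?thesis
        by (metis abs_le_zero_iff dense_ge eq_iff_diff_eq_0)
    qed
    then have "x = ?V p"
      using x V [OF core] by (auto simp: fun_eq_iff extensional_def)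
    with core show "x \<in> ?V ` core"
      by blast
  qed
qed

text \<open>By \<open>surj\<close> the restriction of each unit function of \<open>Z\<close> to the
  arcs occurs among the coordinates, so they separate points; a continuous injection from a compact
  into a Hausdorff space is a homeomorphism onto its image.\<close>

lemma core_homeomorphic_image:
  fixes J :: "'j set" and \<sigma> :: "'j \<Rightarrow> nat \<Rightarrow> nat \<Rightarrow> nat set"
  assumes \<sigma>: "\<And>j. j \<in> J \<Longrightarrow> asymp_compatible u (\<lambda>k n. decode (\<sigma> j k n))"
    and surj: "\<And>s. asymp_compatible u (\<lambda>k n. decode (s k n)) \<Longrightarrow> s \<in> \<sigma> ` J"
  defines "\<Phi> \<equiv> \<lambda>p. \<lambda>j\<in>J. val p (\<lambda>k n. decode (\<sigma> j k n))"
  shows "subtopology (stone_cech Z) core homeomorphic_space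
    subtopology (product_topology (\<lambda>_. euclideanreal) J) (\<Phi> ` core)"
proof -
  let ?X = "subtopology (stone_cech Z) core"
  let ?Y = "subtopology (product_topology (\<lambda>_. euclideanreal) J) (\<Phi> ` core)"
  have core_sub: "core \<subseteq> topspace (stone_cech Z)"
    by (auto simp: core_def)
  then have topX: "topspace ?X = core"
    by auto
  have topY: "topspace ?Y = \<Phi> ` core"
    by (auto simp: \<Phi>_def)
  have cont: "continuous_map ?X ?Y \<Phi>"
  proof (rule continuous_map_into_subtopology)
    show "continuous_map ?X (product_topology (\<lambda>_. euclideanreal) J) \<Phi>"
      unfolding continuous_map_componentwise
    proof (intro conjI ballI)
      show "\<Phi> ` topspace ?X \<subseteq> extensional J"
        by (auto simp: \<Phi>_def)
      fix j
      assume j: "j \<in> J"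
      obtain f where f: "realizes f (\<lambda>k n. decode (\<sigma> j k n))"
        using ex_realizes [OF decode_unit_path \<sigma> [OF j]] by blast
      have "continuous_map ?X euclideanreal (\<lambda>p. p f)"
        using f by (intro continuous_map_from_subtopology continuous_coordinate) (simp add: realizes_def)
      then show "continuous_map ?X euclideanreal (\<lambda>p. \<Phi> p j)"
        by (rule continuous_map_eq) (use j f val_eq topX in \<open>auto simp: \<Phi>_def\<close>)
    qed
    show "\<Phi> \<in> topspace ?X \<rightarrow> \<Phi> ` core"
      using topX by auto
  qed
  have inj: "inj_on \<Phi> core"
  proof (rule inj_onI)
    fix p q
    assume pq: "p \<in> core" "q \<in> core" "\<Phi> p = \<Phi> q"
    show "p = q"
    proof (rule stone_cech_eqI)
      fix f
      assume "f \<in> unit_functions Z"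
      then obtain s where s: "\<And>k n. s k n \<in> unit_paths" "asymp_compatible u s" "realizes f s"
        using realizes_pullback by metis
      have dec: "decode (encode (s k n)) = s k n" for k n
        by (rule decode_encode [OF s(1)])
      have "(\<lambda>k n. encode (s k n)) \<in> \<sigma> ` J"
        using s(2) by (intro surj) (simp add: dec)
      then obtain j where j: "j \<in> J" "\<sigma> j = (\<lambda>k n. encode (s k n))"
        by auto
      have "\<Phi> p j = \<Phi> q j"
        using pq(3) by simp
      then have "val p s = val q s"
        using j by (simp add: \<Phi>_def dec)
      then show "p f = q f"
        using val_eq pq s(3) by simp
    qed (use pq core_sub in auto)
  qed
  have "homeomorphic_map ?X ?Y \<Phi>"
  proof (rule continuous_imp_homeomorphic_map [OF cont])
    show "compact_space ?X"
      using compact_space_stone_cech closedin_compact_space core_closed compact_space_subtopology by blast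
    have "Hausdorff_space (product_topology (\<lambda>_::'j. euclideanreal) J)"
      by (simp add: Hausdorff_space_product_topology Hausdorff_space_euclidean)
    then show "Hausdorff_space ?Y"
      by (rule Hausdorff_space_subtopology)
    show "\<Phi> ` topspace ?X = topspace ?Y" "inj_on \<Phi> (topspace ?X)"
      using topX topY inj by simp_all
  qed
  then show ?thesis
    using homeomorphic_map_imp_homeomorphic_space by blast
qed

end

lemma nat_set_sequences_lepoll_reals:
  "(UNIV :: (nat \<Rightarrow> nat \<Rightarrow> nat set) set) \<lesssim> (UNIV :: real set)"
proof -
  define h :: "(nat \<Rightarrow> nat \<Rightarrow> nat set) \<Rightarrow> nat set" where
    "h s = {to_nat (k, n, m) | k n m. m \<in> s k n}" for s
  have mem: "m \<in> s k n \<longleftrightarrow> to_nat (k, n, m) \<in> h s" for s k n m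
    by (auto simp: h_def)
  have "inj h"
  proof (rule injI)
    fix s t
    assume "h s = h t"
    then show "s = t"
      using mem by (auto simp: fun_eq_iff set_eq_iff)
  qed
  then have "(UNIV :: (nat \<Rightarrow> nat \<Rightarrow> nat set) set) \<lesssim> (UNIV :: nat set set)"
    unfolding lepoll_def by blast
  then show ?thesis
    using nat_sets_eqpoll_reals eqpoll_imp_lepoll lepoll_trans by blast
qed

theorem cores_homeomorphic:
  assumes CH: "continuum_hypothesis" and Z: "chart_system Z u c" and W: "chart_system W v d"
  shows "subtopology (stone_cech Z) (chart_system.core Z u c) homeomorphic_space
         subtopology (stone_cech W) (chart_system.core W v d)"
proof -
  interpret Z: chart_system Z u c by (rule Z)
  interpret W: chart_system W v d by (rule W)
  obtain r :: "(nat \<Rightarrow> nat \<Rightarrow> nat set) rel"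
    where r: "Well_order r" "Field r = UNIV" "\<And>a. countable (underS r a)"
    using continuum_hypothesis_well_order [OF CH nat_set_sequences_lepoll_reals] by metis
  obtain R where R: "matched box_interp u v R" and left: "\<And>s. \<exists>t. (s, t) \<in> R"
    and right: "\<And>t. \<exists>s. (s, t) \<in> R"
    using back_and_forth [OF r Z.ultra W.ultra, of box_interp] by metis
  have ne: "R \<noteq> {}"
    using left by blast
  have compat: "asymp_compatible u (\<lambda>k n. decode (s k n)) \<longleftrightarrow> asymp_compatible v (\<lambda>k n. decode (t k n))"
    if "(s, t) \<in> R" for s t
    using matched_asymp_compatible [OF R that Z.ultra]
      matched_asymp_compatible [OF matched_converse [OF R] _ W.ultra] that by blast
  \<comment> \<open>Pairs serve as indices because \<open>R\<close> need not be a function in either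
    direction.\<close>
  define J where "J = {q \<in> R. asymp_compatible u (\<lambda>k n. decode (fst q k n))}"
  have fst: "asymp_compatible u (\<lambda>k n. decode (fst j k n))" if "j \<in> J" for j
    using that by (simp add: J_def)
  have snd: "asymp_compatible v (\<lambda>k n. decode (snd j k n))" if "j \<in> J" for j
    using that compat [of "fst j" "snd j"] by (simp add: J_def)
  have fst_surj: "s \<in> fst ` J" if "asymp_compatible u (\<lambda>k n. decode (s k n))" for s
    using that left [of s] by (force simp: J_def)
  have snd_surj: "t \<in> snd ` J" if "asymp_compatible v (\<lambda>k n. decode (t k n))" for t
    using that right [of t] compat by (force simp: J_def)
  have same: "(\<forall>\<^sub>F k in sequentially. \<not> (\<forall>\<^sub>F n in u. meets_box S lo hi (\<lambda>j. fst j k n) 0 1)) \<longleftrightarrow>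
      (\<forall>\<^sub>F k in sequentially. \<not> (\<forall>\<^sub>F n in v. meets_box S lo hi (\<lambda>j. snd j k n) 0 1))"
    if "finite S" "S \<subseteq> J" for S lo hi
  proof (rule eventually_subst)
    have "S \<subseteq> R"
      using that by (auto simp: J_def)
    from matched_meets_box [OF R ne that(1) this, of lo hi 0 1]
    show "\<forall>\<^sub>F k in sequentially. (\<not> (\<forall>\<^sub>F n in u. meets_box S lo hi (\<lambda>j. fst j k n) 0 1)) =
        (\<not> (\<forall>\<^sub>F n in v. meets_box S lo hi (\<lambda>j. snd j k n) 0 1))"
      by (rule eventually_mono) simp
  qed
  have images: "(\<lambda>p. \<lambda>j\<in>J. Z.val p (\<lambda>k n. decode (fst j k n))) ` Z.core =
      (\<lambda>p. \<lambda>j\<in>J. W.val p (\<lambda>k n. decode (snd j k n))) ` W.core"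
    by (rule trans [OF Z.core_image [of J fst, OF fst] trans [OF _ W.core_image [of J snd, OF snd, symmetric]]])
      (assumption, intro Collect_cong conj_cong refl all_cong1 imp_cong, simp add: same, assumption)
  have "subtopology (stone_cech W) W.core homeomorphic_space
      subtopology (product_topology (\<lambda>_. euclideanreal) J)
        ((\<lambda>p. \<lambda>j\<in>J. Z.val p (\<lambda>k n. decode (fst j k n))) ` Z.core)"
    unfolding images by (rule W.core_homeomorphic_image [OF snd snd_surj])
  then show ?thesis
    using Z.core_homeomorphic_image [OF fst fst_surj] homeomorphic_space_sym homeomorphic_space_trans
    by blast
qed

section \<open>Interpolation\<close>

definition clip :: "real \<Rightarrow> real" where
  "clip x = max 0 (min 1 x)"

lemma clip_range [simp]: "0 \<le> clip x" "clip x \<le> 1"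
  by (simp_all add: clip_def)

lemma clip_eq: "0 \<le> x \<Longrightarrow> x \<le> 1 \<Longrightarrow> clip x = x"
  by (simp add: clip_def)

lemma clip_0: "x \<le> 0 \<Longrightarrow> clip x = 0"
  by (simp add: clip_def)

lemma clip_1: "1 \<le> x \<Longrightarrow> clip x = 1"
  by (simp add: clip_def)

lemma clip_close: "0 \<le> y \<Longrightarrow> y \<le> 1 \<Longrightarrow> \<bar>clip x - y\<bar> \<le> \<bar>x - y\<bar>"
  by (auto simp: clip_def)

lemma continuous_on_clip [continuous_intros]:
  "continuous_on S f \<Longrightarrow> continuous_on S (\<lambda>x. clip (f x))"
  unfolding clip_def by (intro continuous_intros)

text \<open>The \<open>i\<close>-th path, tilted so that it ends where the next one starts.\<close>

definition tilted :: "(nat \<Rightarrow> real \<Rightarrow> real) \<Rightarrow> nat \<Rightarrow> real \<Rightarrow> real" where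
  "tilted s i y = s i y + y * (s (Suc i) 0 - s i 1)"

text \<open>
  A telescoping sum: on \<open>{\<alpha> i..\<alpha> (Suc i)}\<close> only the \<open>i\<close>-th summand varies.
\<close>

definition glued :: "(nat \<Rightarrow> real) \<Rightarrow> (nat \<Rightarrow> real \<Rightarrow> real) \<Rightarrow> nat \<Rightarrow> real \<Rightarrow> real" where
  "glued \<alpha> s K x =
     s 0 0 + (\<Sum>i<K. tilted s i (clip ((x - \<alpha> i) * inverse (\<alpha> (Suc i) - \<alpha> i))) - s i 0)"

text \<open>Multiplication by a fixed \<open>inverse\<close> is continuous even where consecutive
  \<open>\<alpha> i\<close> coincide or decrease, as may happen on a fibre for large
  \<open>i\<close>.\<close>

lemma continuous_on_glued:
  assumes "\<And>i. s i \<in> unit_paths"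
  shows "continuous_on UNIV (glued \<alpha> s K)"
proof -
  have "continuous_on UNIV (\<lambda>x. s i (clip ((x - \<alpha> i) * inverse (\<alpha> (Suc i) - \<alpha> i))))" for i
  proof (rule continuous_on_compose2 [of UNIV "s i"])
    show "continuous_on UNIV (s i)"
      using assms [of i] by (simp add: unit_paths_def)
    show "continuous_on UNIV (\<lambda>x. clip ((x - \<alpha> i) * inverse (\<alpha> (Suc i) - \<alpha> i)))"
      by (intro continuous_intros)
  qed simp
  then show ?thesis
    unfolding glued_def tilted_def by (intro continuous_intros)
qed

text \<open>For \<open>x \<le> \<alpha> K\<close> the argument of each later summand is clipped to
  0, where \<open>tilted s i\<close> and \<open>s i\<close> agree.\<close>

lemma glued_stable:
  assumes \<alpha>: "\<And>i. K \<le> i \<Longrightarrow> i < L \<Longrightarrow> \<alpha> i < \<alpha> (Suc i)" and "K \<le> L" "x \<le> \<alpha> K"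
  shows "glued \<alpha> s L x = glued \<alpha> s K x"
  using \<open>K \<le> L\<close> \<alpha>
proof (induction L rule: dec_induct)
  case (step m)
  have "\<alpha> K \<le> \<alpha> m"
    using step.hyps(1) step.prems
  proof (induction m rule: dec_induct)
    case (step l)
    then show ?case
      using step.prems [of l] by fastforce
  qed simp
  moreover have "\<alpha> m < \<alpha> (Suc m)"
    using step by simp
  ultimately have "clip ((x - \<alpha> m) * inverse (\<alpha> (Suc m) - \<alpha> m)) = 0"
    using assms(3) by (intro clip_0) (simp add: mult_nonpos_nonneg)
  then have "glued \<alpha> s (Suc m) x = glued \<alpha> s m x"
    by (simp add: glued_def tilted_def)
  with step show ?case by simp
qed simp

text \<open>All summands are complete, and the sum telescopes because
  \<open>tilted s i 1 = s (Suc i) 0\<close>.\<close>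

lemma glued_beyond:
  assumes "\<And>i. i < K \<Longrightarrow> \<alpha> i < \<alpha> (Suc i)" "\<alpha> K \<le> x"
  shows "glued \<alpha> s K x = s K 0"
  using assms
proof (induction K)
  case (Suc K)
  have less: "\<alpha> K < \<alpha> (Suc K)"
    using Suc.prems by simp
  then have "\<alpha> K \<le> x"
    using Suc.prems(2) by simp
  then have "glued \<alpha> s K x = s K 0"
    using Suc.prems(1) by (intro Suc.IH) auto
  moreover have "clip ((x - \<alpha> K) * inverse (\<alpha> (Suc K) - \<alpha> K)) = 1"
    using less Suc.prems(2) by (intro clip_1) (simp add: field_simps)
  ultimately show ?case
    by (simp add: glued_def tilted_def)
qed (simp add: glued_def)

lemma glued_value:
  assumes \<alpha>: "\<And>i. i < K \<Longrightarrow> \<alpha> i < \<alpha> (Suc i)" and "j < K" "0 \<le> y" "y \<le> 1"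
  shows "glued \<alpha> s K (\<alpha> j + y * (\<alpha> (Suc j) - \<alpha> j)) = tilted s j y"
proof -
  let ?x = "\<alpha> j + y * (\<alpha> (Suc j) - \<alpha> j)"
  have less: "\<alpha> j < \<alpha> (Suc j)"
    using \<alpha> assms(2) by simp
  have "y * (\<alpha> (Suc j) - \<alpha> j) \<le> \<alpha> (Suc j) - \<alpha> j"
    using less assms(4) by (simp add: mult_le_cancel_right1)
  then have "glued \<alpha> s K ?x = glued \<alpha> s (Suc j) ?x"
    using assms(2) by (intro glued_stable \<alpha>) auto
  also have "\<dots> = glued \<alpha> s j ?x + (tilted s j (clip y) - s j 0)"
    using less by (simp add: glued_def mult.assoc)
  also have "glued \<alpha> s j ?x = s j 0"
    using less assms by (intro glued_beyond) (auto simp: \<alpha> less_imp_le)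
  finally show ?thesis
    using assms by (simp add: clip_eq)
qed

lemma clip_tilted_close:
  assumes "s i \<in> unit_paths" "0 \<le> y" "y \<le> 1"
  shows "\<bar>clip (tilted s i y) - s i y\<bar> \<le> \<bar>s i 1 - s (Suc i) 0\<bar>"
proof -
  have "\<bar>clip (tilted s i y) - s i y\<bar> \<le> \<bar>tilted s i y - s i y\<bar>"
    using unit_paths_range [OF assms(1)] by (intro clip_close) auto
  also have "\<dots> = y * \<bar>s i 1 - s (Suc i) 0\<bar>"
    using assms(2) by (simp add: tilted_def abs_mult abs_minus_commute)
  also have "\<dots> \<le> \<bar>s i 1 - s (Suc i) 0\<bar>"
    using assms by (simp add: mult_left_le_one_le)
  finally show ?thesis .
qed

section \<open>The half-line\<close>

abbreviation half_line :: "real topology" where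
  "half_line \<equiv> top_of_set {0..}"

lemma half_line_unit_function:
  assumes "continuous_on {0..} f" "\<And>x. 0 \<le> x \<Longrightarrow> 0 \<le> f x \<and> f x \<le> 1"
  shows "restrict f {0..} \<in> unit_functions half_line"
proof -
  have "continuous_on {0..} (restrict f {0..})"
    using assms(1) by (rule continuous_on_eq) simp
  then show ?thesis
    using assms(2) by (auto simp: unit_functions_def continuous_map_in_subtopology)
qed

lemma ultra_principal_0: "ultra (principal {0::nat})"
  by (auto simp: ultra_def eventually_principal principal_eq_bot_iff)

lemma chart_system_half_line:
  "chart_system half_line (principal {0}) (\<lambda>k n y. real k + y)"
proof
  show "ultra (principal {0::nat})"
    by (rule ultra_principal_0)
  show "continuous_map (top_of_set {0..1}) half_line (\<lambda>y. real k + y)" for k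
    by (auto simp: continuous_map_in_subtopology intro!: continuous_intros)
  show "real k + 1 = real (Suc k) + 0" for k
    by simp
next
  fix s :: "nat \<Rightarrow> nat \<Rightarrow> real \<Rightarrow> real"
  assume s: "\<And>k n. s k n \<in> unit_paths" and compat: "asymp_compatible (principal {0}) s"
  define t where "t k = s k 0" for k
  \<comment> \<open>The number of summands depends on \<open>x\<close>; by
    \<open>glued_stable\<close> every larger number gives the same value.\<close>
  define g where "g x = glued real t (nat \<lceil>x\<rceil>) x" for x
  have g: "g x = glued real t K x" if "0 \<le> x" "x \<le> real K" for x K
  proof -
    have "nat \<lceil>x\<rceil> \<le> K" "x \<le> real (nat \<lceil>x\<rceil>)"
      using that by linarith+
    then show ?thesis
      unfolding g_def by (intro glued_stable [symmetric]) auto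
  qed
  have t: "t i \<in> unit_paths" for i
    using s by (simp add: t_def)
  have cont: "continuous_on {0..} g"
    unfolding continuous_on_eq_continuous_within
  proof
    fix x :: real
    assume x: "x \<in> {0..}"
    \<comment> \<open>The extra \<open>Suc\<close> makes \<open>x\<close> strictly less than
      \<open>K\<close>, so that one finite sum represents \<open>g\<close> around
      \<open>x\<close>.\<close>
    define K where "K = Suc (nat \<lceil>x\<rceil>)"
    have K: "x < real K"
      using x unfolding K_def by (simp add: less_Suc_eq_le) linarith
    have "continuous (at x within {0..}) (glued real t K)"
      using continuous_on_glued [OF t] by (simp add: continuous_on_eq_continuous_at continuous_at_imp_continuous_within)
    moreover have "\<forall>\<^sub>F z in at x within {0..}. z < real K"
      using K by (intro order_tendstoD(2) [OF tendsto_ident_at])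
    then have "\<forall>\<^sub>F z in at x within {0..}. glued real t K z = g z"
      unfolding eventually_at_filter
      by (rule eventually_mono) (use g [of _ K] in \<open>auto simp: less_imp_le\<close>)
    ultimately show "continuous (at x within {0..}) g"
      unfolding continuous_within using g [of x K] x K
      by (auto intro: Lim_transform_eventually)
  qed
  let ?f = "restrict (\<lambda>x. clip (g x)) {0..}"
  show "\<exists>f\<in>unit_functions half_line. \<forall>\<epsilon>>0. \<forall>\<^sub>F x in tails (principal {0}).
      \<forall>y\<in>{0..1}. \<bar>f (real (fst x) + y) - s (fst x) (snd x) y\<bar> < \<epsilon>"
  proof (intro bexI allI impI)
    show "?f \<in> unit_functions half_line"
      by (intro half_line_unit_function continuous_on_clip cont) simp
    fix \<epsilon> :: real
    assume "\<epsilon> > 0"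
    with compat have "\<forall>\<^sub>F k in sequentially. \<bar>t k 1 - t (Suc k) 0\<bar> < \<epsilon>"
      by (simp add: asymp_compatible_def eventually_tails eventually_principal t_def)
    then have "\<forall>\<^sub>F k in sequentially. \<forall>y\<in>{0..1}. \<bar>?f (real k + y) - t k y\<bar> < \<epsilon>"
    proof eventually_elim
      case (elim k)
      show ?case
      proof
        fix y :: real
        assume y: "y \<in> {0..1}"
        then have "g (real k + y) = tilted t k y"
          using g [of "real k + y" "Suc k"] glued_value [of "Suc k" real k y t] by simp
        then show "\<bar>?f (real k + y) - t k y\<bar> < \<epsilon>"
          using clip_tilted_close [of t k y] t elim y by auto
      qed
    qed
    then show "\<forall>\<^sub>F x in tails (principal {0}).
        \<forall>y\<in>{0..1}. \<bar>?f (real (fst x) + y) - s (fst x) (snd x) y\<bar> < \<epsilon>"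
      by (simp add: eventually_tails eventually_principal t_def)
  qed
qed

interpretation half_line: chart_system half_line "principal {0}" "\<lambda>k n y. real k + y"
  by (rule chart_system_half_line)

lemma half_line_tail_set: "half_line.tail_set A \<longleftrightarrow> A \<subseteq> {0..} \<and> (\<exists>m. {real m..} \<subseteq> A)"
proof -
  have "(\<exists>m. \<forall>k\<ge>m. (\<lambda>y. real k + y) ` {0..1} \<subseteq> A) \<longleftrightarrow> (\<exists>m. {real m..} \<subseteq> A)"
  proof (intro iffI; elim exE)
    fix m
    assume m: "\<forall>k\<ge>m. (\<lambda>y. real k + y) ` {0..1} \<subseteq> A"
    have "x \<in> A" if "real m \<le> x" for x
    proof -
      have "m \<le> nat \<lfloor>x\<rfloor>"
        using that by linarith
      with m have "(\<lambda>y. real (nat \<lfloor>x\<rfloor>) + y) ` {0..1} \<subseteq> A"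
        by blast
      moreover have "x = real (nat \<lfloor>x\<rfloor>) + frac x" "frac x \<in> {0..1}"
        using that by (auto simp: frac_def frac_lt_1 less_imp_le) linarith+
      ultimately show ?thesis
        by blast
    qed
    then show "\<exists>m. {real m..} \<subseteq> A"
      by (intro exI [of _ m]) auto
  next
    fix m
    assume "{real m..} \<subseteq> A"
    then show "\<exists>m. \<forall>k\<ge>m. (\<lambda>y. real k + y) ` {0..1} \<subseteq> A"
      by (intro exI [of _ m]) auto
  qed
  then show ?thesis
    by (simp add: half_line.tail_set_def eventually_tails eventually_principal eventually_sequentially)
qed

text \<open>A point of the half-line is kept away from the closure of a far tail by a function that
  rises from 0 to 1 behind it. Conversely \<open>{0..m}\<close> is compact, so its image is already
  closed, and a point of the remainder must lie in the closure of the tail from \<open>m\<close>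
  on.\<close>

lemma half_line_remainder:
  "stone_cech_remainder half_line = subtopology (stone_cech half_line) half_line.core"
proof -
  let ?e = "stone_cech_embed half_line"
  have "half_line.core = topspace (stone_cech half_line) - ?e ` {0..}"
  proof (intro subset_antisym subsetI DiffI notI)
    fix p
    assume p: "p \<in> half_line.core"
    then show "p \<in> topspace (stone_cech half_line)"
      by (simp add: half_line.core_def)
    assume "p \<in> ?e ` {0..}"
    then obtain z where z: "0 \<le> z" "p = ?e z"
      by auto
    define f where "f = restrict (\<lambda>x. clip (x - z)) {0..}"
    have f: "f \<in> unit_functions half_line"
      unfolding f_def by (intro half_line_unit_function continuous_intros) simp
    have "half_line.tail_set {z + 1..}"
      using z(1) real_nat_ceiling_ge [of "z + 1"] by (auto simp: half_line_tail_set intro!: exI [of _ "nat \<lceil>z + 1\<rceil>"])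
    with p have "p \<in> scl half_line {z + 1..}"
      by (simp add: half_line.core_def)
    then have "p f \<in> {1}"
      by (rule scl_coordinate_closed) (use z(1) f in \<open>auto simp: f_def clip_1\<close>)
    moreover have "p f = 0"
      using z f by (simp add: stone_cech_coordinate(2) f_def clip_0)
    ultimately show False
      by simp
  next
    fix p
    assume p: "p \<in> topspace (stone_cech half_line) - ?e ` {0..}"
    have "p \<in> scl half_line A" if "half_line.tail_set A" for A
    proof -
      obtain m where m: "{real m..} \<subseteq> A"
        using \<open>half_line.tail_set A\<close> half_line_tail_set by blast
      have "{0..} = {0..real m} \<union> {real m..}"
        by auto
      then have "p \<in> scl half_line ({0..real m} \<union> {real m..})"
        using p scl_topspace [of half_line] by simp
      then have "p \<in> scl half_line {0..real m} \<or> p \<in> scl half_line {real m..}"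
        by (simp add: scl_Un)
      moreover have "scl half_line {0..real m} = ?e ` {0..real m}"
      proof -
        have "embedding_map half_line (stone_cech half_line) ?e"
          by (intro embedding_map_stone_cech
              metrizable_imp_completely_regular_space metrizable_imp_Hausdorff_space
              metrizable_space_subtopology metrizable_space_euclidean)
        then have "continuous_map half_line (stone_cech half_line) ?e"
          using homeomorphic_imp_continuous_map continuous_map_into_fulltopology
          unfolding embedding_map_def by blast
        then have "compactin (stone_cech half_line) (?e ` {0..real m})"
          by (rule image_compactin [rotated]) (auto simp: compactin_subtopology)
        then have "closedin (stone_cech half_line) (?e ` {0..real m})"
          by (rule compactin_imp_closedin [OF Hausdorff_space_stone_cech])
        then show ?thesis
          unfolding scl_def by (rule closure_of_closedin)
      qed
      moreover have "?e ` {0..real m} \<subseteq> ?e ` {0..}"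
        by (intro image_mono) auto
      ultimately show ?thesis
        using p scl_mono [OF m, of half_line] by blast
    qed
    with p show "p \<in> half_line.core"
      by (simp add: half_line.core_def)
  qed
  then show ?thesis
    by (simp add: stone_cech_remainder_def)
qed

section \<open>Arcs in the sum of the intervals\<close>

text \<open>Continuity is checked fibre by fibre, since each \<open>{n}\<close> is open in the
  discrete factor.\<close>

lemma M_unit_function:
  assumes "\<And>n. continuous_on {0..1} (g n)" "\<And>n x. 0 \<le> x \<Longrightarrow> x \<le> 1 \<Longrightarrow> 0 \<le> g n x \<and> g n x \<le> 1"
  shows "restrict (\<lambda>z. g (fst z) (snd z)) (UNIV \<times> {0..1}) \<in> unit_functions M_space"
proof -
  have "continuous_map M_space euclideanreal (\<lambda>z. g (fst z) (snd z))"
    unfolding continuous_map_def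
  proof (intro conjI allI impI)
    fix U :: "real set"
    assume "openin euclideanreal U"
    have "{z \<in> topspace M_space. g (fst z) (snd z) \<in> U} = (\<Union>n. {n} \<times> {x \<in> {0..1}. g n x \<in> U})"
      by auto
    moreover have "openin M_space ({n} \<times> {x \<in> {0..1}. g n x \<in> U})" for n
    proof -
      have "openin (top_of_set {0..1}) {x \<in> {0..1}. g n x \<in> U}"
        using continuous_openin_preimage_gen [OF assms(1), of U n] \<open>openin euclideanreal U\<close>
        by (simp add: vimage_def Int_def)
      then show ?thesis
        by (simp add: openin_prod_Times_iff)
    qed
    ultimately show "openin M_space {z \<in> topspace M_space. g (fst z) (snd z) \<in> U}"
      by (simp only:) (rule openin_Union, blast)
  qed auto
  then have "continuous_map M_space euclideanreal (restrict (\<lambda>z. g (fst z) (snd z)) (UNIV \<times> {0..1}))"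
    by (rule continuous_map_eq) auto
  then show ?thesis
    using assms(2) by (auto simp: unit_functions_def continuous_map_in_subtopology)
qed

lemma nonprincipal_ultra: "nonprincipal_ultrafilter u \<Longrightarrow> ultra u"
  by (simp add: nonprincipal_ultrafilter_def ultra_def)

lemma nonprincipal_eventually_ge:
  assumes u: "nonprincipal_ultrafilter u"
  shows "\<forall>\<^sub>F n in u. m \<le> n"
proof -
  have "\<forall>\<^sub>F n in u. n \<noteq> i" for i
    using u by (auto simp: nonprincipal_ultrafilter_def)
  then have "\<forall>\<^sub>F n in u. \<forall>i\<in>{..<m}. n \<noteq> i"
    by (intro eventually_ball_finite) auto
  then show ?thesis
    by (rule eventually_mono) (use not_less in blast)
qed

text \<open>A diagonal device: infinitely many conditions, each true for almost all
  \<open>n\<close>, need not hold together at any \<open>n\<close>, but the first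
  \<open>initial_length P n\<close> of them hold at \<open>n\<close>, and this number exceeds any
  bound for almost all \<open>n\<close>. The restriction \<open>K \<le> n\<close> makes the maximum
  exist.\<close>

definition initial_length :: "(nat \<Rightarrow> nat \<Rightarrow> bool) \<Rightarrow> nat \<Rightarrow> nat" where
  "initial_length P n = (GREATEST K. K \<le> n \<and> (\<forall>i<K. P i n))"

lemma initial_length:
  assumes "i < initial_length P n"
  shows "P i n"
proof -
  have "initial_length P n \<le> n \<and> (\<forall>i<initial_length P n. P i n)"
    unfolding initial_length_def
    by (rule GreatestI_nat [where P = "\<lambda>K. K \<le> n \<and> (\<forall>i<K. P i n)" and k = 0 and b = n]) simp_all
  with assms show ?thesis
    by blast
qed

lemma initial_length_unbounded:
  assumes u: "nonprincipal_ultrafilter u" and P: "\<And>i. \<forall>\<^sub>F n in u. P i n"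
  shows "\<forall>\<^sub>F n in u. k \<le> initial_length P n"
proof -
  have "\<forall>\<^sub>F n in u. \<forall>i\<in>{..<k}. P i n"
    by (intro eventually_ball_finite) (auto intro: P)
  with nonprincipal_eventually_ge [OF u, of k] show ?thesis
  proof eventually_elim
    case (elim n)
    then show ?case
      unfolding initial_length_def by (intro Greatest_le_nat [of _ _ n]) auto
  qed
qed

definition arcs :: "(nat \<Rightarrow> nat \<Rightarrow> real) \<Rightarrow> nat \<Rightarrow> nat \<Rightarrow> real \<Rightarrow> nat \<times> real" where
  "arcs \<alpha> k n y = (n, \<alpha> k n + y * (\<alpha> (Suc k) n - \<alpha> k n))"

lemma arcs_range:
  assumes "\<alpha> k n \<in> {0..1}" "\<alpha> (Suc k) n \<in> {0..1}" "y \<in> {0..1}"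
  shows "snd (arcs \<alpha> k n y) \<in> {0..1}"
proof -
  have "snd (arcs \<alpha> k n y) = (1 - y) *\<^sub>R \<alpha> k n + y *\<^sub>R \<alpha> (Suc k) n"
    by (simp add: arcs_def algebra_simps)
  also have "\<dots> \<in> {0..1}"
    using assms by (intro convexD_alt) auto
  finally show ?thesis .
qed

text \<open>At a single \<open>n\<close> the inequality may hold for few \<open>k\<close> only. So
  on the fibre over \<open>n\<close> just the first \<open>K n\<close> paths are glued, and each
  fixed \<open>k\<close> is below \<open>K n\<close> for almost all \<open>n\<close>.\<close>

lemma chart_system_arcs:
  assumes u: "nonprincipal_ultrafilter u" and \<alpha>: "\<And>k n. \<alpha> k n \<in> {0..1}"
    and less: "\<And>k. \<forall>\<^sub>F n in u. \<alpha> k n < \<alpha> (Suc k) n"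
  shows "chart_system M_space u (arcs \<alpha>)"
proof
  show "ultra u"
    by (rule nonprincipal_ultra [OF u])
  show "continuous_map (top_of_set {0..1}) M_space (arcs \<alpha> k n)" for k n
  proof (subst continuous_map_pairwise, intro conjI)
    show "continuous_map (top_of_set {0..1}) omega_space (fst \<circ> arcs \<alpha> k n)"
      by (simp add: arcs_def o_def)
    show "continuous_map (top_of_set {0..1}) (top_of_set {0..1}) (snd \<circ> arcs \<alpha> k n)"
    proof (rule continuous_map_into_subtopology)
      show "continuous_map (top_of_set {0..1}) euclideanreal (snd \<circ> arcs \<alpha> k n)"
        by (simp add: arcs_def o_def) (intro continuous_intros)
      show "snd \<circ> arcs \<alpha> k n \<in> topspace (top_of_set {0..1}) \<rightarrow> {0..1}"
        using arcs_range [of \<alpha> k n] \<alpha> [of k n] \<alpha> [of "Suc k" n] by (simp add: Pi_def)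
    qed
  qed
  show "arcs \<alpha> k n 1 = arcs \<alpha> (Suc k) n 0" for k n
    by (simp add: arcs_def)
next
  fix s :: "nat \<Rightarrow> nat \<Rightarrow> real \<Rightarrow> real"
  assume s: "\<And>k n. s k n \<in> unit_paths" and compat: "asymp_compatible u s"
  define K where "K = initial_length (\<lambda>i n. \<alpha> i n < \<alpha> (Suc i) n)"
  define g where "g n x = clip (glued (\<lambda>k. \<alpha> k n) (\<lambda>k. s k n) (K n) x)" for n x
  define f where "f = restrict (\<lambda>z. g (fst z) (snd z)) (UNIV \<times> {0..1})"
  have f: "f \<in> unit_functions M_space"
    unfolding f_def
  proof (rule M_unit_function)
    show "continuous_on {0..1} (g n)" for n
      unfolding g_def
      by (intro continuous_on_clip continuous_on_subset [OF continuous_on_glued subset_UNIV] s)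
  qed (simp add: g_def)
  have K: "\<forall>\<^sub>F n in u. k < K n" for k
    using initial_length_unbounded [OF u less, of "Suc k"] by (simp add: K_def Suc_le_eq)
  have near: "\<bar>f (arcs \<alpha> k n y) - s k n y\<bar> \<le> \<bar>s k n 1 - s (Suc k) n 0\<bar>"
    if "k < K n" "y \<in> {0..1}" for k n y
  proof -
    have "f (arcs \<alpha> k n y) = g n (\<alpha> k n + y * (\<alpha> (Suc k) n - \<alpha> k n))"
      using arcs_range [of \<alpha> k n y] \<alpha> that(2) by (simp add: f_def arcs_def)
    also have "\<dots> = clip (tilted (\<lambda>k. s k n) k y)"
      unfolding g_def using that initial_length [of _ "\<lambda>i n. \<alpha> i n < \<alpha> (Suc i) n" n]
      by (subst glued_value) (auto simp: K_def)
    finally show ?thesis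
      using clip_tilted_close [of "\<lambda>k. s k n" k y] s that(2) by auto
  qed
  show "\<exists>f\<in>unit_functions M_space. \<forall>\<epsilon>>0. \<forall>\<^sub>F x in tails u.
      \<forall>y\<in>{0..1}. \<bar>f (arcs \<alpha> (fst x) (snd x) y) - s (fst x) (snd x) y\<bar> < \<epsilon>"
  proof (intro bexI [OF _ f] allI impI)
    fix \<epsilon> :: real
    assume "\<epsilon> > 0"
    with compat have "\<forall>\<^sub>F x in tails u. \<bar>s (fst x) (snd x) 1 - s (Suc (fst x)) (snd x) 0\<bar> < \<epsilon>"
      by (simp add: asymp_compatible_def)
    moreover have "\<forall>\<^sub>F x in tails u. fst x < K (snd x)"
      using K by (simp add: eventually_tails)
    ultimately show "\<forall>\<^sub>F x in tails u.
        \<forall>y\<in>{0..1}. \<bar>f (arcs \<alpha> (fst x) (snd x) y) - s (fst x) (snd x) y\<bar> < \<epsilon>"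
      by eventually_elim (use near in fastforce)
  qed
qed

section \<open>The order of the standard subcontinuum\<close>

text \<open>Urysohn's function on the compactification is the coordinate that belongs to its own
  restriction to \<open>Z\<close>, as the two agree on a dense set.\<close>

lemma stone_cech_separation:
  assumes P: "closedin (stone_cech Z) P" and Q: "closedin (stone_cech Z) Q" and "disjnt P Q"
  obtains f where "f \<in> unit_functions Z" "\<And>p. p \<in> P \<Longrightarrow> p f = 0" "\<And>p. p \<in> Q \<Longrightarrow> p f = 1"
proof -
  have "normal_space (stone_cech Z)"
    by (intro compact_Hausdorff_or_regular_imp_normal_space compact_space_stone_cech disjI1
        Hausdorff_space_stone_cech)
  then obtain g where g: "continuous_map (stone_cech Z) (top_of_set {0..1::real}) g"
    "g ` P \<subseteq> {0}" "g ` Q \<subseteq> {1}"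
    using Urysohn_lemma [OF _ P Q \<open>disjnt P Q\<close>, of 0 1] by auto
  define f where "f = restrict (g \<circ> stone_cech_embed Z) (topspace Z)"
  have embed: "continuous_map Z (stone_cech Z) (stone_cech_embed Z)"
    unfolding stone_cech_def
  proof (rule continuous_map_into_subtopology)
    show "continuous_map Z (stone_cech_cube Z) (stone_cech_embed Z)"
      unfolding continuous_map_componentwise
    proof (intro conjI ballI)
      show "stone_cech_embed Z ` topspace Z \<subseteq> extensional (unit_functions Z)"
        by (auto simp: stone_cech_embed_def)
      show "continuous_map Z (top_of_set {0..1}) (\<lambda>z. stone_cech_embed Z z f)"
        if "f \<in> unit_functions Z" for f
        using that by (simp add: stone_cech_embed_def unit_functions_def)
    qed
    show "stone_cech_embed Z \<in> topspace Z \<rightarrow> stone_cech_cube Z closure_of stone_cech_embed Z ` topspace Z"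
      using stone_cech_embed_subset [of Z] by (auto simp: topspace_stone_cech)
  qed
  have f: "f \<in> unit_functions Z"
  proof -
    have "continuous_map Z (top_of_set {0..1}) f"
      unfolding f_def by (rule continuous_map_eq [OF continuous_map_compose [OF embed g(1)]]) simp
    then show ?thesis
      by (simp add: unit_functions_def f_def)
  qed
  have eq: "p f = g p" if "p \<in> topspace (stone_cech Z)" for p
  proof (rule forall_in_closure_of_eq [where f = "\<lambda>p. p f" and g = g])
    show "p \<in> stone_cech Z closure_of (stone_cech_embed Z ` topspace Z)"
      using that by (simp add: stone_cech_embed_dense)
    show "Hausdorff_space euclideanreal"
      by (rule Hausdorff_space_euclidean)
    show "continuous_map (stone_cech Z) euclideanreal (\<lambda>p. p f)"
      by (rule continuous_coordinate [OF f])
    show "continuous_map (stone_cech Z) euclideanreal g"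
      using g(1) by (rule continuous_map_into_fulltopology)
    show "q f = g q" if "q \<in> stone_cech_embed Z ` topspace Z" for q
      using that f by (auto simp: stone_cech_coordinate(2)) (simp add: f_def)
  qed
  show thesis
  proof
    show "f \<in> unit_functions Z"
      by (rule f)
    show "p f = 0" if "p \<in> P" for p
      using eq closedin_subset [OF P] g(2) that by auto
    show "p f = 1" if "p \<in> Q" for p
      using eq closedin_subset [OF Q] g(3) that by auto
  qed
qed

lemma unit_function_slice:
  assumes "h \<in> unit_functions M_space"
  shows "continuous_on {0..1} (\<lambda>x. h (n, x))"
proof -
  have "continuous_map (top_of_set {0..1}) M_space (Pair n)"
    by (subst continuous_map_pairwise) (auto simp: o_def)
  moreover have "continuous_map M_space euclideanreal h"
    using assms continuous_map_into_fulltopology by (auto simp: unit_functions_def)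
  ultimately have "continuous_map (top_of_set {0..1}) euclideanreal (h \<circ> Pair n)"
    by (rule continuous_map_compose)
  then show ?thesis
    by (simp add: o_def)
qed

section \<open>Closures of sets given fibre by fibre\<close>

definition mcl :: "(nat \<Rightarrow> real \<Rightarrow> bool) \<Rightarrow> ((nat \<times> real \<Rightarrow> real) \<Rightarrow> real) set" where
  "mcl P = scl M_space {z. snd z \<in> {0..1} \<and> P (fst z) (snd z)}"

lemma mcl_subset: "mcl P \<subseteq> topspace (stone_cech M_space)"
  unfolding mcl_def by (rule scl_subset)

lemma closedin_mcl: "closedin (stone_cech M_space) (mcl P)"
  unfolding mcl_def by (rule closedin_scl)

lemma mcl_mono:
  assumes "p \<in> mcl P" "\<And>n x. x \<in> {0..1} \<Longrightarrow> P n x \<Longrightarrow> Q n x"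
  shows "p \<in> mcl Q"
  using assms(1) unfolding mcl_def by (rule subsetD [OF scl_mono, rotated]) (use assms(2) in auto)

lemma mcl_disj: "p \<in> mcl (\<lambda>n x. P n x \<or> Q n x) \<longleftrightarrow> p \<in> mcl P \<or> p \<in> mcl Q"
proof -
  have "{z. snd z \<in> {0..1::real} \<and> (P (fst z) (snd z) \<or> Q (fst z) (snd z))} =
      {z. snd z \<in> {0..1} \<and> P (fst z) (snd z)} \<union> {z. snd z \<in> {0..1} \<and> Q (fst z) (snd z)}"
    by auto
  then show ?thesis
    by (simp add: mcl_def scl_Un)
qed

lemma mcl_closed:
  assumes "p \<in> mcl P" "f \<in> unit_functions M_space" "closed S"
    and "\<And>n x. x \<in> {0..1} \<Longrightarrow> P n x \<Longrightarrow> f (n, x) \<in> S"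
  shows "p f \<in> S"
  using assms(1) unfolding mcl_def
  by (rule scl_coordinate_closed) (use assms(2-4) in auto)

lemma mcl_open:
  assumes "p \<in> topspace (stone_cech M_space)" "f \<in> unit_functions M_space" "open V" "p f \<in> V"
  shows "p \<in> mcl (\<lambda>n x. f (n, x) \<in> V)"
proof -
  have "p \<in> scl M_space {z \<in> topspace M_space. f z \<in> V}"
    by (rule scl_coordinate_open [OF assms])
  moreover have "{z \<in> topspace M_space. f z \<in> V} = {z. snd z \<in> {0..1} \<and> f (fst z, snd z) \<in> V}"
    by auto
  ultimately show ?thesis
    by (simp only: mcl_def)
qed

lemma ex_unit_indicator:
  obtains f where "f \<in> unit_functions M_space"
    "\<And>n x. x \<in> {0..1} \<Longrightarrow> f (n, x) = (if U n then 1 else 0)"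
proof
  show "restrict (\<lambda>z. (\<lambda>n x. if U n then 1 else 0 :: real) (fst z) (snd z)) (UNIV \<times> {0..1})
      \<in> unit_functions M_space"
    by (rule M_unit_function) auto
qed auto

text \<open>The union of the fibres over \<open>U\<close> is clopen, so its indicator is a unit
  function.\<close>

lemma mcl_contradictory:
  assumes "p \<in> mcl (\<lambda>n x. U n)" "p \<in> mcl (\<lambda>n x. \<not> U n)"
  shows False
proof -
  obtain f where f: "f \<in> unit_functions M_space"
    "\<And>n x. x \<in> {0..1} \<Longrightarrow> f (n, x) = (if U n then 1 else 0)"
    using ex_unit_indicator by blast
  have "p f \<in> {1}"
    using assms(1) f(1) by (rule mcl_closed) (simp_all add: f(2))
  moreover have "p f \<in> {0}"
    using assms(2) f(1) by (rule mcl_closed) (simp_all add: f(2))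
  ultimately show False
    by simp
qed

context
  fixes u :: "nat filter"
  assumes u: "nonprincipal_ultrafilter u"
begin

lemma nonbot: "u \<noteq> bot"
  using u by (simp add: nonprincipal_ultrafilter_def)

text \<open>Replaces the fibre of the extended projection by closures in the sum of the intervals.
  One direction tests the projected point on indicators; for the other, each coordinate
  \<open>f\<close> of the projection is squeezed by the convergence of \<open>f\<close> along
  \<open>u\<close>.\<close>

lemma I_space_iff:
  "p \<in> topspace (I_space u) \<longleftrightarrow>
     p \<in> topspace (stone_cech M_space) \<and> (\<forall>U. eventually U u \<longrightarrow> p \<in> mcl (\<lambda>n x. U n))"
proof (intro iffI conjI allI impI)
  have fst: "continuous_map M_space omega_space fst"
    by (rule continuous_map_fst)
  {
    assume p: "p \<in> topspace (I_space u)"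
    then show p': "p \<in> topspace (stone_cech M_space)"
      by (simp add: I_space_def)
    fix U
    assume U: "eventually U u"
    let ?\<chi> = "indicator (Collect U) :: nat \<Rightarrow> real"
    let ?f = "restrict (?\<chi> \<circ> fst) (topspace M_space)"
    have "stone_cech_map M_space omega_space fst p ?\<chi> = p ?f"
      unfolding stone_cech_map_def using indicator_unit_function by simp
    moreover have "stone_cech_map M_space omega_space fst p = omega_point u"
      using p by (simp add: I_space_def)
    ultimately have "p ?f = 1"
      using omega_point_indicator [OF u, of "Collect U"] U by simp
    then have half: "p ?f \<in> {1/2<..}"
      by (simp only: greaterThan_iff)
    have "p \<in> mcl (\<lambda>n x. ?f (n, x) \<in> {1/2<..})"
      by (rule mcl_open [OF p' unit_functions_compose [OF fst indicator_unit_function] open_greaterThan half])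
    then show "p \<in> mcl (\<lambda>n x. U n)"
      by (rule mcl_mono) (auto simp: indicator_def of_bool_def split: if_splits)
  }
  {
    assume p: "p \<in> topspace (stone_cech M_space) \<and> (\<forall>U. eventually U u \<longrightarrow> p \<in> mcl (\<lambda>n x. U n))"
    have "stone_cech_map M_space omega_space fst p = omega_point u"
    proof (rule stone_cech_eqI)
      show "stone_cech_map M_space omega_space fst p \<in> topspace (stone_cech omega_space)"
        using continuous_map_stone_cech_map [OF fst] p by (auto simp: continuous_map_def)
      have lim_u: "limitin (stone_cech omega_space) (stone_cech_embed omega_space) (omega_point u) u"
        using limitin_omega_point [OF u] by simp
      then show "omega_point u \<in> topspace (stone_cech omega_space)"
        by (rule limitin_topspace)
      fix f
      assume f: "f \<in> unit_functions omega_space"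
      have "limitin euclideanreal ((\<lambda>p. p f) \<circ> stone_cech_embed omega_space) (omega_point u f) u"
        by (rule continuous_map_limit [OF continuous_coordinate [OF f] lim_u])
      then have lim: "(f \<longlongrightarrow> omega_point u f) u"
        using f by (simp add: o_def stone_cech_coordinate(2))
      let ?g = "restrict (f \<circ> fst) (topspace M_space)"
      have "\<bar>p ?g - omega_point u f\<bar> \<le> \<epsilon>" if "\<epsilon> > 0" for \<epsilon>
      proof -
        have "\<forall>\<^sub>F n in u. \<bar>f n - omega_point u f\<bar> < \<epsilon>"
          using tendstoD [OF lim that] by (simp add: dist_real_def)
        with p have "p \<in> mcl (\<lambda>n x. \<bar>f n - omega_point u f\<bar> < \<epsilon>)"
          by blast
        then have "p ?g \<in> {omega_point u f - \<epsilon>..omega_point u f + \<epsilon>}"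
          by (rule mcl_closed) (use unit_functions_compose [OF fst f] in auto)
        then show ?thesis by auto
      qed
      then have "p ?g = omega_point u f"
        by (metis abs_le_zero_iff dense_ge eq_iff_diff_eq_0)
      then show "stone_cech_map M_space omega_space fst p f = omega_point u f"
        unfolding stone_cech_map_def using f by simp
    qed
    with p show "p \<in> topspace (I_space u)"
      by (simp add: I_space_def)
  }
qed

lemma I_space_subset: "p \<in> topspace (I_space u) \<Longrightarrow> p \<in> topspace (stone_cech M_space)"
  by (simp add: I_space_iff)

lemma closedin_I_space: "closedin (stone_cech M_space) (topspace (I_space u))"
proof -
  have "topspace (I_space u) = \<Inter> ((\<lambda>U. mcl (\<lambda>n x. U n)) ` {U. eventually U u})"
  proof (intro subset_antisym subsetI)
    fix p
    assume p: "p \<in> \<Inter> ((\<lambda>U. mcl (\<lambda>n x. U n)) ` {U. eventually U u})"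
    then have "p \<in> mcl (\<lambda>n x. True)"
      by auto
    with p show "p \<in> topspace (I_space u)"
      unfolding I_space_iff using mcl_subset by blast
  qed (auto simp: I_space_iff)
  moreover have "{U. eventually U u} \<noteq> {}"
    using eventually_True by blast
  ultimately show ?thesis
    by (auto intro!: closedin_Inter closedin_mcl)
qed

text \<open>Only fibres over a set in \<open>u\<close> matter: a point over \<open>u\<close> is in
  the closure of their union and therefore not in the closure of the remaining fibres.\<close>

lemma mcl_ae:
  assumes p: "p \<in> topspace (I_space u)" "p \<in> mcl P"
    and ae: "\<forall>\<^sub>F n in u. \<forall>x\<in>{0..1}. P n x \<longrightarrow> Q n x"
  shows "p \<in> mcl Q"
proof -
  define U where "U n \<longleftrightarrow> (\<forall>x\<in>{0..1}. P n x \<longrightarrow> Q n x)" for n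
  have "p \<in> mcl (\<lambda>n x. Q n x \<or> \<not> U n)"
    using p(2) by (rule mcl_mono) (auto simp: U_def)
  then have "p \<in> mcl Q \<or> p \<in> mcl (\<lambda>n x. \<not> U n)"
    by (simp only: mcl_disj)
  moreover have "p \<in> mcl (\<lambda>n x. U n)"
    using p(1) ae by (simp add: I_space_iff U_def)
  ultimately show ?thesis
    using mcl_contradictory [of p U] by blast
qed

lemma mcl_closed_ae:
  assumes "p \<in> topspace (I_space u)" "p \<in> mcl P" "f \<in> unit_functions M_space" "closed S"
    and "\<forall>\<^sub>F n in u. \<forall>x\<in>{0..1}. P n x \<longrightarrow> f (n, x) \<in> S"
  shows "p f \<in> S"
proof -
  have "p \<in> mcl (\<lambda>n x. f (n, x) \<in> S)"
    by (rule mcl_ae [OF assms(1,2,5)])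
  then show ?thesis
    by (rule mcl_closed) (use assms in auto)
qed

text \<open>The two closures below are disjoint since a piecewise linear function separates them.\<close>

lemma mcl_le_ge_False:
  assumes p: "p \<in> topspace (I_space u)" and le: "p \<in> mcl (\<lambda>n x. x \<le> f n)"
    and ge: "p \<in> mcl (\<lambda>n x. g n \<le> x)" and less: "\<forall>\<^sub>F n in u. f n < g n"
  shows False
proof -
  define h where "h n x = clip ((x - f n) * inverse (g n - f n))" for n x
  define H where "H = restrict (\<lambda>z. h (fst z) (snd z)) (UNIV \<times> {0..1})"
  have H: "H \<in> unit_functions M_space"
    unfolding H_def by (rule M_unit_function) (auto simp: h_def intro!: continuous_intros)
  have "p H \<in> {0}"
  proof (rule mcl_closed_ae [OF p le H])
    show "\<forall>\<^sub>F n in u. \<forall>x\<in>{0..1}. x \<le> f n \<longrightarrow> H (n, x) \<in> {0}"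
      using less by eventually_elim
        (auto simp: H_def h_def mult_nonpos_nonneg intro!: clip_0)
  qed simp
  moreover have "p H \<in> {1}"
  proof (rule mcl_closed_ae [OF p ge H])
    show "\<forall>\<^sub>F n in u. \<forall>x\<in>{0..1}. g n \<le> x \<longrightarrow> H (n, x) \<in> {1}"
      using less by eventually_elim (auto simp: H_def h_def field_simps intro!: clip_1)
  qed simp
  ultimately show False
    by simp
qed

section \<open>Limits along the ultrafilter and initial segments\<close>

definition limit_point :: "(nat \<Rightarrow> real) \<Rightarrow> (nat \<times> real \<Rightarrow> real) \<Rightarrow> real" where
  "limit_point f = ultrafilter_limit (stone_cech M_space) u (\<lambda>n. stone_cech_embed M_space (n, f n))"

lemma limit_point:
  assumes f: "\<And>n. f n \<in> {0..1}"
  shows "limit_point f \<in> topspace (I_space u)" "limit_point f \<in> mcl (\<lambda>n x. x = f n)"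
proof -
  let ?s = "\<lambda>n. stone_cech_embed M_space (n, f n)"
  have s: "?s n \<in> topspace (stone_cech M_space)" for n
    using stone_cech_embed_subset [of M_space] f by auto
  have lim: "limitin (stone_cech M_space) ?s (limit_point f) u"
    unfolding limit_point_def
    using ultrafilter_limit [OF u compact_space_stone_cech Hausdorff_space_stone_cech, of ?s] s
    by blast
  have *: "limit_point f \<in> mcl P" if "\<forall>\<^sub>F n in u. P n (f n)" for P
  proof (rule limitin_closedin [OF lim closedin_mcl _ nonbot])
    show "\<forall>\<^sub>F n in u. ?s n \<in> mcl P"
      using that
    proof eventually_elim
      case (elim n)
      then show ?case
        unfolding mcl_def using f by (intro embed_in_scl) auto
    qed
  qed
  show "limit_point f \<in> topspace (I_space u)"
    unfolding I_space_iff by (intro conjI allI impI limitin_topspace [OF lim] *)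
  show "limit_point f \<in> mcl (\<lambda>n x. x = f n)"
    by (rule *) simp
qed

lemma bottom_point_eq: "bottom_point u = limit_point (\<lambda>_. 0)"
  by (simp add: bottom_point_def limit_point_def)

lemma bottom_point:
  "bottom_point u \<in> topspace (I_space u)" "bottom_point u \<in> mcl (\<lambda>n x. x = 0)"
  unfolding bottom_point_eq by (rule limit_point; simp)+

definition segment :: "(nat \<Rightarrow> real) \<Rightarrow> ((nat \<times> real \<Rightarrow> real) \<Rightarrow> real) set" where
  "segment f = {p \<in> topspace (I_space u). p \<in> mcl (\<lambda>n x. x \<le> f n)}"

lemma segment_mono: "\<forall>\<^sub>F n in u. f n \<le> g n \<Longrightarrow> segment f \<subseteq> segment g"
  unfolding segment_def by (auto elim!: mcl_ae elim: eventually_mono)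

lemma closedin_segment: "closedin (stone_cech M_space) (segment f)"
proof -
  have "segment f = topspace (I_space u) \<inter> mcl (\<lambda>n x. x \<le> f n)"
    by (auto simp: segment_def)
  then show ?thesis
    by (simp add: closedin_Int closedin_I_space closedin_mcl)
qed

text \<open>Take \<open>h\<close> equal to 0 on \<open>P\<close> and 1 on \<open>Q\<close>. By
  compactness \<open>h\<close> omits the middle third below \<open>f n\<close> on almost all fibres.
  As it starts below 1/3 there, the intermediate value theorem keeps it at most 1/3 up to
  \<open>f n\<close>, which leaves nothing for \<open>Q\<close>.\<close>

lemma segment_connected_aux:
  assumes f: "\<And>n. f n \<in> {0..1}"
    and P: "closedin (stone_cech M_space) P" and Q: "closedin (stone_cech M_space) Q"
    and PQ: "segment f = P \<union> Q" "P \<inter> Q = {}" and bot: "bottom_point u \<in> P"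
  shows "Q = {}"
proof -
  obtain h where h: "h \<in> unit_functions M_space" "\<And>p. p \<in> P \<Longrightarrow> p h = 0" "\<And>p. p \<in> Q \<Longrightarrow> p h = 1"
    using stone_cech_separation [OF P Q] PQ(2) by (auto simp: disjnt_def)
  define D where "D U = mcl (\<lambda>n x. U n \<and> x \<le> f n \<and> h (n, x) \<in> {1/3..2/3})" for U
  have "\<exists>U. eventually U u \<and> D U = {}"
  proof (rule ccontr)
    assume none: "\<not> ?thesis"
    have "\<Inter> (D ` {U. eventually U u}) \<noteq> {}"
    proof (rule directed_closed_nonempty [OF compact_space_stone_cech [of M_space]])
      show "D ` {U. eventually U u} \<noteq> {}"
        using eventually_True by blast
      show "closedin (stone_cech M_space) C \<and> C \<noteq> {}" if "C \<in> D ` {U. eventually U u}" for C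
        using that none closedin_mcl by (auto simp: D_def)
      show "\<exists>E\<in>D ` {U. eventually U u}. E \<subseteq> C \<inter> C'"
        if CC': "C \<in> D ` {U. eventually U u}" "C' \<in> D ` {U. eventually U u}" for C C'
      proof -
        obtain U U' where U: "eventually U u" "eventually U' u" "C = D U" "C' = D U'"
          using CC' by blast
        have "D (\<lambda>n. U n \<and> U' n) \<subseteq> C \<inter> C'"
          unfolding U(3,4) D_def by (intro subsetI IntI; erule mcl_mono; blast)
        moreover have "eventually (\<lambda>n. U n \<and> U' n) u"
          using U(1,2) by (rule eventually_conj)
        ultimately show ?thesis
          by blast
      qed
    qed
    then obtain p where p: "\<And>U. eventually U u \<Longrightarrow> p \<in> D U"
      by auto
    have "p \<in> D (\<lambda>_. True)"
      by (rule p) simp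
    then have top: "p \<in> topspace (stone_cech M_space)"
      using mcl_subset by (auto simp: D_def)
    have "p \<in> mcl (\<lambda>n x. U n)" if "eventually U u" for U
      using p [OF that] unfolding D_def by (rule mcl_mono) simp
    then have "p \<in> topspace (I_space u)"
      using top by (simp add: I_space_iff)
    moreover have "p \<in> mcl (\<lambda>n x. x \<le> f n)"
      using \<open>p \<in> D (\<lambda>_. True)\<close> unfolding D_def by (rule mcl_mono) simp
    ultimately have "p \<in> P \<union> Q"
      using PQ(1) by (auto simp: segment_def)
    then have "p h = 0 \<or> p h = 1"
      using h by blast
    moreover have "p h \<in> {1/3..2/3}"
      using \<open>p \<in> D (\<lambda>_. True)\<close> h(1) unfolding D_def by (rule mcl_closed) auto
    ultimately show False
      by auto
  qed
  then obtain U where U: "eventually U u" "D U = {}"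
    by blast
  have gap: "h (n, x) \<notin> {1/3..2/3}" if "U n" "x \<in> {0..1}" "x \<le> f n" for n x
  proof
    assume "h (n, x) \<in> {1/3..2/3}"
    with that have "stone_cech_embed M_space (n, x) \<in> D U"
      unfolding D_def mcl_def by (intro embed_in_scl) auto
    with U(2) show False
      by simp
  qed
  have "\<forall>\<^sub>F n in u. h (n, 0) < 1/3"
  proof (rule ccontr)
    assume "\<not> ?thesis"
    then have "\<forall>\<^sub>F n in u. 1/3 \<le> h (n, 0)"
      using ultra_not [OF nonprincipal_ultra [OF u]] by (simp add: not_less [symmetric])
    then have "bottom_point u h \<in> {1/3..}"
      by (intro mcl_closed_ae [OF bottom_point h(1)]) (auto elim: eventually_mono)
    with h(2) [OF bot] show False
      by simp
  qed
  with U(1) have small: "\<forall>\<^sub>F n in u. \<forall>x\<in>{0..1}. x \<le> f n \<longrightarrow> h (n, x) \<in> {..1/3}"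
  proof eventually_elim
    case (elim n)
    show ?case
    proof (intro ballI impI, rule ccontr)
      fix x :: real
      assume x: "x \<in> {0..1}" "x \<le> f n" "h (n, x) \<notin> {..1/3}"
      have "continuous_on {0..1} (\<lambda>x. h (n, x))"
        by (rule unit_function_slice [OF h(1)])
      then have "continuous_on {0..x} (\<lambda>x. h (n, x))"
        by (rule continuous_on_subset) (use x in auto)
      then obtain y where "0 \<le> y" "y \<le> x" "h (n, y) = 1/3"
        using IVT' [of "\<lambda>x. h (n, x)" 0 "1/3" x] elim(2) x by auto
      with gap [of n y] elim(1) x show False
        by auto
    qed
  qed
  have "p h \<le> 1/3" if "p \<in> segment f" for p
    using mcl_closed_ae [OF _ _ h(1) closed_atMost small] that by (simp add: segment_def)
  with PQ(1) h(3) show ?thesis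
    by fastforce
qed

lemma subcontinuum_segment:
  assumes f: "\<And>n. f n \<in> {0..1}"
  shows "subcontinuum (I_space u) (segment f)" "bottom_point u \<in> segment f"
proof -
  show bot: "bottom_point u \<in> segment f"
    using bottom_point f unfolding segment_def by (auto elim!: mcl_mono)
  have sub: "segment f \<subseteq> topspace (I_space u)"
    by (auto simp: segment_def)
  have "connectedin (stone_cech M_space) (segment f)"
    unfolding connectedin_closedin
  proof (intro conjI notI)
    show "segment f \<subseteq> topspace (stone_cech M_space)"
      by (rule closedin_subset [OF closedin_segment])
    assume "\<exists>E1 E2. closedin (stone_cech M_space) E1 \<and> closedin (stone_cech M_space) E2 \<and>
        segment f \<subseteq> E1 \<union> E2 \<and> E1 \<inter> E2 \<inter> segment f = {} \<and> E1 \<inter> segment f \<noteq> {} \<and> E2 \<inter> segment f \<noteq> {}"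
    then obtain E1 E2 where E: "closedin (stone_cech M_space) E1" "closedin (stone_cech M_space) E2"
      "segment f \<subseteq> E1 \<union> E2" "E1 \<inter> E2 \<inter> segment f = {}" "E1 \<inter> segment f \<noteq> {}" "E2 \<inter> segment f \<noteq> {}"
      by blast
    have closed: "closedin (stone_cech M_space) (E1 \<inter> segment f)"
      "closedin (stone_cech M_space) (E2 \<inter> segment f)"
      by (intro closedin_Int E closedin_segment)+
    have "bottom_point u \<in> E1 \<inter> segment f \<or> bottom_point u \<in> E2 \<inter> segment f"
      using bot E(3) by blast
    then show False
    proof
      assume "bottom_point u \<in> E1 \<inter> segment f"
      then have "E2 \<inter> segment f = {}"
        by (rule segment_connected_aux [OF f closed, rotated 2]) (use E in auto)
      with E show False by simp
    next
      assume "bottom_point u \<in> E2 \<inter> segment f"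
      then have "E1 \<inter> segment f = {}"
        by (rule segment_connected_aux [OF f closed(2,1), rotated 2]) (use E in auto)
      with E show False by simp
    qed
  qed
  moreover have "compactin (stone_cech M_space) (segment f)"
    by (rule closedin_compact_space [OF compact_space_stone_cech closedin_segment])
  moreover have "segment f \<subseteq> {p \<in> topspace (stone_cech M_space).
      stone_cech_map M_space omega_space fst p = omega_point u}"
    using sub by (auto simp: I_space_def)
  ultimately show "subcontinuum (I_space u) (segment f)"
    using bot unfolding subcontinuum_def I_space_def
    by (auto simp: connectedin_subtopology compactin_subtopology)
qed

end

text \<open>\<open>f\<close> is the first place where \<open>g\<close> equals 1/2, or 1 if there is
  none; hence the guard \<open>f < 1\<close>.\<close>

lemma first_half_crossing:
  fixes g :: "real \<Rightarrow> real"
  assumes g: "continuous_on {0..1} g" and "g 0 < 1/2"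
  obtains f where "f \<in> {0..1}" "\<And>t. 0 \<le> t \<Longrightarrow> t \<le> f \<Longrightarrow> g t \<le> 1/2" "f < 1 \<Longrightarrow> g f = 1/2"
proof (cases "\<exists>t\<in>{0..1}. g t = 1/2")
  case True
  have "closed ({0..1} \<inter> g -` {1/2})"
    by (intro continuous_closed_preimage g) auto
  then have "compact ({0..1} \<inter> g -` {1/2})"
    by (simp add: compact_eq_bounded_closed bounded_Int)
  then obtain f where f: "f \<in> {0..1} \<inter> g -` {1/2}" "\<And>t. t \<in> {0..1} \<inter> g -` {1/2} \<Longrightarrow> f \<le> t"
    using True compact_attains_inf [of "{0..1} \<inter> g -` {1/2}"] by blast
  show thesis
  proof
    show "g t \<le> 1/2" if t: "0 \<le> t" "t \<le> f" for t
    proof (rule ccontr)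
      assume "\<not> g t \<le> 1/2"
      moreover have "continuous_on {0..t} g"
        by (rule continuous_on_subset [OF g]) (use f(1) t in auto)
      ultimately obtain y where "0 \<le> y" "y \<le> t" "g y = 1/2"
        using IVT' [of g 0 "1/2" t] assms(2) t by auto
      with f(2) [of y] f(1) t have "t = y"
        by auto
      with \<open>g y = 1/2\<close> \<open>\<not> g t \<le> 1/2\<close> show False
        by simp
    qed
  qed (use f in auto)
next
  case False
  show thesis
  proof
    show "g t \<le> 1/2" if t: "0 \<le> t" "t \<le> 1" for t
    proof (rule ccontr)
      assume "\<not> g t \<le> 1/2"
      moreover have "continuous_on {0..t} g"
        by (rule continuous_on_subset [OF g]) (use t in auto)
      ultimately obtain y where "0 \<le> y" "y \<le> t" "g y = 1/2"
        using IVT' [of g 0 "1/2" t] assms(2) t by auto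
      with False t show False
        by auto
    qed
  qed auto
qed

text \<open>
  A subcontinuum \<open>K\<close> through the bottom point cannot jump: if \<open>g\<close> vanishes on \<open>K\<close> and \<open>f n\<close> is
  the first place where \<open>g (n, \<sqdot>)\<close> reaches \<open>1/2\<close>, then reflecting \<open>g\<close> in the value \<open>1/2\<close> beyond
  \<open>f\<close> gives a function that omits the values between \<open>1/4\<close> and \<open>3/4\<close> on \<open>K\<close>.
\<close>

lemma subcontinuum_segment_separation:
  assumes u: "nonprincipal_ultrafilter u"
    and K: "subcontinuum (I_space u) K" "bottom_point u \<in> K"
    and x: "x \<in> topspace (I_space u)" "x \<notin> K"
  obtains f where "\<And>n. f n \<in> {0..1}" "K \<subseteq> segment u f" "x \<notin> segment u f"
proof -
  have K_sub: "K \<subseteq> topspace (I_space u)"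
    using K(1) by (auto simp: subcontinuum_def compactin_def)
  have K_top: "compactin (stone_cech M_space) K" "connectedin (stone_cech M_space) K"
    using K(1) unfolding subcontinuum_def I_space_def
    by (auto simp: connectedin_subtopology compactin_subtopology)
  have x_top: "x \<in> topspace (stone_cech M_space)"
    by (rule I_space_subset [OF u x(1)])
  have "closedin (stone_cech M_space) {x}"
    using x_top by (intro closedin_t1_singleton Hausdorff_imp_t1_space Hausdorff_space_stone_cech)
  then obtain g where g: "g \<in> unit_functions M_space" "\<And>p. p \<in> K \<Longrightarrow> p g = 0" "x g = 1"
    using stone_cech_separation [OF compactin_imp_closedin [OF Hausdorff_space_stone_cech K_top(1)], of "{x}"]
      x(2) by auto
  have g_cont: "continuous_on {0..1} (\<lambda>t. g (n, t))" for n
    by (rule unit_function_slice [OF g(1)])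
  have g_range: "0 \<le> g (n, t)" "g (n, t) \<le> 1" if "0 \<le> t" "t \<le> 1" for n t
    using unit_functions_range [OF g(1), of "(n, t)"] that by auto
  have "\<exists>f. f \<in> {0..1} \<and> (g (n, 0) < 1/2 \<longrightarrow>
      (\<forall>t. 0 \<le> t \<longrightarrow> t \<le> f \<longrightarrow> g (n, t) \<le> 1/2) \<and> (f < 1 \<longrightarrow> g (n, f) = 1/2))" for n
  proof (cases "g (n, 0) < 1/2")
    case True
    with first_half_crossing [OF g_cont [of n]] show ?thesis
      by metis
  next
    \<comment> \<open>By \<open>small\<close> below this happens only for a \<open>u\<close>-small
      set of \<open>n\<close>, so any value will do.\<close>
    case False
    then show ?thesis
      by (intro exI [of _ 0]) simp
  qed
  then obtain f where f: "\<And>n. f n \<in> {0..1}"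
    "\<And>n t. g (n, 0) < 1/2 \<Longrightarrow> 0 \<le> t \<Longrightarrow> t \<le> f n \<Longrightarrow> g (n, t) \<le> 1/2"
    "\<And>n. g (n, 0) < 1/2 \<Longrightarrow> f n < 1 \<Longrightarrow> g (n, f n) = 1/2"
    by metis
  have bot: "bottom_point u \<in> mcl (\<lambda>n t. t = 0)" "bottom_point u \<in> topspace (I_space u)"
    by (rule bottom_point [OF u])+
  have small: "\<forall>\<^sub>F n in u. g (n, 0) < 1/4"
  proof (rule ccontr)
    assume "\<not> ?thesis"
    then have "\<forall>\<^sub>F n in u. 1/4 \<le> g (n, 0)"
      using ultra_not [OF nonprincipal_ultra [OF u]] by (simp add: not_less [symmetric])
    then have "bottom_point u g \<in> {1/4..}"
      by (intro mcl_closed_ae [OF u bot(2,1) g(1)]) (auto elim: eventually_mono)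
    with g(2) [OF K(2)] show False
      by simp
  qed
  \<comment> \<open>Up to \<open>f n\<close> this is \<open>g\<close> cut off at 1/2, and the last
    term adds the reflected part beyond. The use of \<open>min\<close> and \<open>max\<close> with
    \<open>f n\<close> makes it continuous for every \<open>n\<close>. If \<open>g\<close> starts
    below 1/2 and never reaches it, then \<open>f n = 1\<close>, nothing lies beyond, and the last
    term is dropped.\<close>
  define h where "h n t = 1/2 - max 0 (1/2 - g (n, min t (f n)))
      + (if g (n, f n) \<ge> 1/2 then max 0 (1/2 - g (n, max t (f n))) else 0)" for n t
  define H where "H = restrict (\<lambda>z. h (fst z) (snd z)) (UNIV \<times> {0..1})"
  have H: "H \<in> unit_functions M_space"
    unfolding H_def
  proof (rule M_unit_function)
    fix n
    have min: "continuous_on {0..1} (\<lambda>t. g (n, min t (f n)))"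
      by (rule continuous_on_compose2 [OF g_cont, where f = "\<lambda>t. min t (f n)"])
         (use f(1) [of n] in \<open>auto intro!: continuous_intros\<close>)
    have max: "continuous_on {0..1} (\<lambda>t. g (n, max t (f n)))"
      by (rule continuous_on_compose2 [OF g_cont, where f = "\<lambda>t. max t (f n)"])
         (use f(1) [of n] in \<open>auto intro!: continuous_intros\<close>)
    show "continuous_on {0..1} (h n)"
      unfolding h_def using min max by (cases "g (n, f n) \<ge> 1/2") (auto intro!: continuous_intros)
    show "0 \<le> h n t \<and> h n t \<le> 1" if "0 \<le> t" "t \<le> 1" for t
    proof -
      have half: "0 \<le> max 0 (1/2 - z) \<and> max 0 (1/2 - z) \<le> 1/2" if "0 \<le> z" for z :: real
        using that by (simp add: max_def)
      have "0 \<le> g (n, min t (f n))" "0 \<le> g (n, max t (f n))"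
        using that f(1) [of n] by (auto intro!: g_range)
      then show ?thesis
        using half [of "g (n, min t (f n))"] half [of "g (n, max t (f n))"] unfolding h_def
        by (intro conjI; split if_split; intro conjI impI; linarith)
    qed
  qed
  have h_below: "h n t = min (g (n, t)) (1/2)" if "t \<le> f n" for n t
    using that by (auto simp: h_def min_def max_def)
  have h_above: "h n t = max (1 - g (n, t)) (1/2)" if "g (n, 0) < 1/2" "f n < t" "t \<le> 1" for n t
    using f(3) [OF that(1)] that by (auto simp: h_def min_def max_def)
  have range: "p H \<in> {..1/4} \<union> {3/4..}" if "p \<in> K" for p
  proof (rule mcl_closed_ae [OF u _ _ H])
    show p: "p \<in> topspace (I_space u)"
      using that K_sub by blast
    show "p \<in> mcl (\<lambda>n t. g (n, t) \<in> {..<1/4})"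
      by (rule mcl_open [OF I_space_subset [OF u p] g(1) open_lessThan]) (simp add: g(2) [OF that])
    show "\<forall>\<^sub>F n in u. \<forall>t\<in>{0..1}. g (n, t) \<in> {..<1/4} \<longrightarrow> H (n, t) \<in> {..1/4} \<union> {3/4..}"
      using small
    proof eventually_elim
      case (elim n)
      show ?case
      proof (intro ballI impI)
        fix t :: real
        assume t: "t \<in> {0..1}" "g (n, t) \<in> {..<1/4}"
        have "h n t \<in> {..1/4} \<union> {3/4..}"
        proof (cases "t \<le> f n")
          case True
          with t show ?thesis
            by (simp add: h_below)
        next
          case False
          then have "h n t = max (1 - g (n, t)) (1/2)"
            using elim t(1) by (intro h_above) auto
          with t(2) show ?thesis
            by simp
        qed
        with t(1) show "H (n, t) \<in> {..1/4} \<union> {3/4..}"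
          by (simp add: H_def)
      qed
    qed
  qed (intro closed_Un closed_atMost closed_atLeast)
  have "bottom_point u H \<in> {..1/4}"
  proof (rule mcl_closed_ae [OF u bot(2,1) H])
    show "\<forall>\<^sub>F n in u. \<forall>t\<in>{0..1}. t = 0 \<longrightarrow> H (n, t) \<in> {..1/4}"
      using small by eventually_elim (use f(1) h_below in \<open>auto simp: H_def\<close>)
  qed simp
  have "connectedin euclideanreal ((\<lambda>p. p H) ` K)"
    by (rule connectedin_continuous_map_image [OF continuous_coordinate [OF H] K_top(2)])
  then have conn: "connected ((\<lambda>p. p H) ` K)"
    by simp
  have low: "p H \<le> 1/4" if "p \<in> K" for p
  proof (rule ccontr)
    assume "\<not> p H \<le> 1/4"
    with range [OF that] have "1/2 \<le> p H"
      by auto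
    moreover have "bottom_point u H \<le> 1/2"
      using \<open>bottom_point u H \<in> {..1/4}\<close> by simp
    ultimately have "1/2 \<in> (\<lambda>p. p H) ` K"
      by (rule connectedD_interval [OF conn imageI [OF K(2)] imageI [OF that], rotated])
    then obtain q where "q \<in> K" "q H = 1/2"
      by auto
    with range [of q] show False
      by simp
  qed
  show thesis
  proof
    show "f n \<in> {0..1}" for n
      by (rule f(1))
    show "K \<subseteq> segment u f"
    proof
      fix p
      assume p: "p \<in> K"
      then have I: "p \<in> topspace (I_space u)"
        using K_sub by blast
      have "p \<in> mcl (\<lambda>n t. H (n, t) \<in> {..<1/2})"
        by (rule mcl_open [OF I_space_subset [OF u I] H open_lessThan]) (use low [OF p] in simp)
      then have "p \<in> mcl (\<lambda>n t. t \<le> f n)"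
      proof (rule mcl_ae [OF u I])
        show "\<forall>\<^sub>F n in u. \<forall>t\<in>{0..1}. H (n, t) \<in> {..<1/2} \<longrightarrow> t \<le> f n"
          using small
        proof eventually_elim
          case (elim n)
          show ?case
          proof (intro ballI impI, rule ccontr)
            fix t :: real
            assume t: "t \<in> {0..1}" "H (n, t) \<in> {..<1/2}" "\<not> t \<le> f n"
            then have "h n t = max (1 - g (n, t)) (1/2)"
              using elim by (intro h_above) auto
            then have "1/2 \<le> h n t"
              by simp
            with t(1,2) show False
              by (simp add: H_def)
          qed
        qed
      qed
      with I show "p \<in> segment u f"
        by (simp add: segment_def [OF u])
    qed
    show "x \<notin> segment u f"
    proof
      assume "x \<in> segment u f"
      then have "x \<in> mcl (\<lambda>n t. t \<le> f n)"
        by (simp add: segment_def [OF u])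
      then have "x g \<in> {..1/2}"
      proof (rule mcl_closed_ae [OF u x(1) _ g(1)])
        show "\<forall>\<^sub>F n in u. \<forall>t\<in>{0..1}. t \<le> f n \<longrightarrow> g (n, t) \<in> {..1/2}"
          using small by eventually_elim (use f(2) in auto)
      qed simp
      with g(3) show False
        by simp
    qed
  qed
qed

text \<open>Segments are subcontinua through the bottom point, and by
  \<open>subcontinuum_segment_separation\<close> one fits between any such subcontinuum and a point
  outside it.\<close>

lemma le_u_iff_segments:
  assumes u: "nonprincipal_ultrafilter u"
  shows "le_u u x y \<longleftrightarrow> x \<in> topspace (I_space u) \<and> y \<in> topspace (I_space u) \<and>
    (\<forall>f. (\<forall>n. f n \<in> {0..1}) \<longrightarrow> y \<in> segment u f \<longrightarrow> x \<in> segment u f)"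
proof (intro iffI conjI allI impI)
  assume le: "le_u u x y"
  then show "x \<in> topspace (I_space u)" "y \<in> topspace (I_space u)"
    by (simp_all add: le_u_def)
  fix f :: "nat \<Rightarrow> real"
  assume "\<forall>n. f n \<in> {0..1}" and y: "y \<in> segment u f"
  then have "subcontinuum (I_space u) (segment u f)" "bottom_point u \<in> segment u f"
    by (intro subcontinuum_segment [OF u]; blast)+
  with le y show "x \<in> segment u f"
    by (simp add: le_u_def)
next
  assume *: "x \<in> topspace (I_space u) \<and> y \<in> topspace (I_space u) \<and>
    (\<forall>f. (\<forall>n. f n \<in> {0..1}) \<longrightarrow> y \<in> segment u f \<longrightarrow> x \<in> segment u f)"
  have "x \<in> K" if K: "subcontinuum (I_space u) K" "bottom_point u \<in> K" "y \<in> K" for K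
  proof (rule ccontr)
    assume "x \<notin> K"
    with * obtain f where "\<And>n. f n \<in> {0..1}" "K \<subseteq> segment u f" "x \<notin> segment u f"
      using subcontinuum_segment_separation [OF u K(1,2), of x] by metis
    with * K(3) show False
      by blast
  qed
  with * show "le_u u x y"
    by (simp add: le_u_def)
qed

section \<open>The supremum layer\<close>

text \<open>The failure of \<open>le_u u (a (Suc k)) (a k)\<close> is witnessed by a segment, whose
  end \<open>\<alpha> k\<close> separates the two points. If \<open>\<alpha> (Suc k)\<close> were at
  most \<open>\<alpha> k\<close> almost everywhere, \<open>a (Suc k)\<close> would fall into the
  segment that avoids it.\<close>

lemma increasing_sequence_separators:
  assumes u: "nonprincipal_ultrafilter u" and a: "\<And>k. less_u u (a k) (a (Suc k))"
  obtains \<alpha> where "\<And>k n. \<alpha> k n \<in> {0..1}" "\<And>k. a k \<in> segment u (\<alpha> k)"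
    "\<And>k. a (Suc k) \<notin> segment u (\<alpha> k)" "\<And>k. \<forall>\<^sub>F n in u. \<alpha> k n < \<alpha> (Suc k) n"
proof -
  have "\<exists>f. (\<forall>n. f n \<in> {0..1}) \<and> a k \<in> segment u f \<and> a (Suc k) \<notin> segment u f" for k
    using a [of k] unfolding less_u_def le_u_iff_segments [OF u] by blast
  then obtain \<alpha> where \<alpha>: "\<And>k n. \<alpha> k n \<in> {0..1}" "\<And>k. a k \<in> segment u (\<alpha> k)"
    "\<And>k. a (Suc k) \<notin> segment u (\<alpha> k)"
    by metis
  have "\<forall>\<^sub>F n in u. \<alpha> k n < \<alpha> (Suc k) n" for k
  proof (rule ccontr)
    assume "\<not> ?thesis"
    then have "\<forall>\<^sub>F n in u. \<alpha> (Suc k) n \<le> \<alpha> k n"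
      using ultra_not [OF nonprincipal_ultra [OF u]] by (simp add: not_less [symmetric])
    then have "segment u (\<alpha> (Suc k)) \<subseteq> segment u (\<alpha> k)"
      by (rule segment_mono [OF u])
    with \<alpha>(2,3) show False
      by blast
  qed
  with \<alpha> that show thesis
    by blast
qed

lemma arcs_fst_snd [simp]:
  "fst (arcs \<alpha> k n y) = n" "snd (arcs \<alpha> k n y) = \<alpha> k n + y * (\<alpha> (Suc k) n - \<alpha> k n)"
  by (simp_all add: arcs_def)

lemma arcs_between:
  assumes "\<alpha> k n \<le> \<alpha> (Suc k) n" "y \<in> {0..1}"
  shows "\<alpha> k n \<le> snd (arcs \<alpha> k n y)" "snd (arcs \<alpha> k n y) \<le> \<alpha> (Suc k) n"
proof -
  show "\<alpha> k n \<le> snd (arcs \<alpha> k n y)"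
    using assms by simp
  have "y * (\<alpha> (Suc k) n - \<alpha> k n) \<le> \<alpha> (Suc k) n - \<alpha> k n"
    using assms by (simp add: mult_left_le_one_le)
  then show "snd (arcs \<alpha> k n y) \<le> \<alpha> (Suc k) n"
    by simp
qed

lemma ex_step_between:
  fixes b :: "nat \<Rightarrow> real"
  assumes "b m \<le> x" "x \<le> b N" "m < N"
  shows "\<exists>j. m \<le> j \<and> j < N \<and> b j \<le> x \<and> x \<le> b (Suc j)"
  using assms(2,3)
proof (induction N)
  case (Suc N)
  show ?case
  proof (cases "m < N \<and> x \<le> b N")
    case True
    with Suc.IH show ?thesis
      using less_Suc_eq by blast
  next
    case False
    with Suc.prems assms(1) show ?thesis
      by (intro exI [of _ N]) (auto simp: less_Suc_eq)
  qed
qed simp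

text \<open>
  Every neighbourhood of the supremum layer contains, almost everywhere, the arcs between \<open>\<alpha> m\<close>
  and a diagonal function that eventually exceeds all \<open>\<alpha> k\<close>.
\<close>

lemma supremum_layer_eq_core:
  assumes u: "nonprincipal_ultrafilter u"
    and \<alpha>: "\<And>k n. \<alpha> k n \<in> {0..1}" "\<And>k. a k \<in> segment u (\<alpha> k)" "\<And>k. a (Suc k) \<notin> segment u (\<alpha> k)"
      "\<And>k. \<forall>\<^sub>F n in u. \<alpha> k n < \<alpha> (Suc k) n"
  shows "supremum_layer u a = chart_system.core M_space u (arcs \<alpha>)"
proof -
  interpret chart_system M_space u "arcs \<alpha>"
    by (rule chart_system_arcs [of u \<alpha>, OF u \<alpha>(1,4)])
  note not_ev = ultra_not [OF ultra]
  have a_I: "a k \<in> topspace (I_space u)" for k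
    using \<alpha>(2) [of k] by (simp add: segment_def [OF u])
  have trans: "\<forall>\<^sub>F n in u. \<alpha> i n \<le> \<alpha> j n" if "i \<le> j" for i j
    using that
  proof (induction j rule: dec_induct)
    case (step j)
    from step.IH \<alpha>(4) [of j] show ?case
      by eventually_elim simp
  qed simp
  \<comment> \<open>Almost all arcs stay within the intervals between consecutive
    \<open>\<alpha> k n\<close>, so statements about these intervals yield tail sets.\<close>
  have tail_mcl: "p \<in> mcl P" if p: "p \<in> core"
    and P: "\<forall>\<^sub>F k in sequentially. \<forall>\<^sub>F n in u. \<forall>x\<in>{\<alpha> k n..\<alpha> (Suc k) n}. P n x" for p P
  proof -
    have "\<forall>\<^sub>F x in tails u. \<forall>y\<in>{0..1}.
        P (fst (arcs \<alpha> (fst x) (snd x) y)) (snd (arcs \<alpha> (fst x) (snd x) y))"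
      unfolding eventually_tails
      using P
    proof eventually_elim
      case (elim k)
      from elim \<alpha>(4) [of k] show ?case
      proof eventually_elim
        case (elim n)
        then show ?case
          using arcs_between [of \<alpha> k n] by (simp add: less_imp_le)
      qed
    qed
    then have "tail_set {z \<in> topspace M_space. P (fst z) (snd z)}"
      by (rule tail_setI)
    then have "p \<in> scl M_space {z \<in> topspace M_space. P (fst z) (snd z)}"
      using p by (simp add: core_def)
    also have "{z \<in> topspace M_space. P (fst z) (snd z)} = {z. snd z \<in> {0..1} \<and> P (fst z) (snd z)}"
      by auto
    finally show ?thesis
      by (simp add: mcl_def)
  qed
  have above: "p \<in> mcl (\<lambda>n x. \<alpha> k n \<le> x)" if "p \<in> core" for p k
  proof (rule tail_mcl [OF that])
    show "\<forall>\<^sub>F j in sequentially. \<forall>\<^sub>F n in u. \<forall>x\<in>{\<alpha> j n..\<alpha> (Suc j) n}. \<alpha> k n \<le> x"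
      using eventually_ge_at_top [of k]
    proof eventually_elim
      case (elim j)
      from trans [OF this] show ?case
        by eventually_elim auto
    qed
  qed
  have exceeds: "\<forall>\<^sub>F n in u. \<alpha> k n < f n" if "a (Suc k) \<in> segment u f" for k f
  proof (rule ccontr)
    assume "\<not> ?thesis"
    then have "\<forall>\<^sub>F n in u. f n \<le> \<alpha> k n"
      by (simp add: not_ev [symmetric] not_less)
    from segment_mono [OF u this] that \<alpha>(3) show False
      by blast
  qed
  show ?thesis
  proof (intro subset_antisym subsetI)
    fix p
    assume p: "p \<in> core"
    have pI: "p \<in> topspace (I_space u)"
      unfolding I_space_iff [OF u]
    proof (intro conjI allI impI)
      show "p \<in> topspace (stone_cech M_space)"
        using p by (simp add: core_def)
      show "p \<in> mcl (\<lambda>n x. U n)" if "eventually U u" for U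
        by (rule tail_mcl [OF p], rule always_eventually) (use that in \<open>auto elim: eventually_mono\<close>)
    qed
    have "le_u u (a k) p" for k
      unfolding le_u_iff_segments [OF u]
    proof (intro conjI allI impI a_I pI)
      fix f :: "nat \<Rightarrow> real"
      assume "p \<in> segment u f"
      then have f: "p \<in> mcl (\<lambda>n x. x \<le> f n)"
        by (simp add: segment_def [OF u])
      have "\<not> (\<forall>\<^sub>F n in u. f n < \<alpha> k n)"
        using mcl_le_ge_False [OF u pI f above [OF p]] by blast
      then have "\<forall>\<^sub>F n in u. \<alpha> k n \<le> f n"
        by (simp add: not_ev [symmetric] not_less)
      from segment_mono [OF u this] \<alpha>(2) show "a k \<in> segment u f"
        by blast
    qed
    moreover have "le_u u p y" if y: "y \<in> topspace (I_space u)" "\<forall>k. le_u u (a k) y" for y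
      unfolding le_u_iff_segments [OF u]
    proof (intro conjI allI impI y(1) pI)
      fix f :: "nat \<Rightarrow> real"
      assume "\<forall>n. f n \<in> {0..1}" "y \<in> segment u f"
      then have a_f: "a k \<in> segment u f" for k
        using y(2) unfolding le_u_iff_segments [OF u] by blast
      have "p \<in> mcl (\<lambda>n x. x \<le> f n)"
      proof (rule tail_mcl [OF p], rule always_eventually, rule allI)
        show "\<forall>\<^sub>F n in u. \<forall>x\<in>{\<alpha> k n..\<alpha> (Suc k) n}. x \<le> f n" for k
          \<comment> \<open>The \<open>k\<close>-th arc ends at \<open>\<alpha> (Suc k)\<close>, so
            it takes \<open>a (Suc (Suc k))\<close> to see that \<open>f\<close> is above the whole
            arc.\<close>
          using exceeds [OF a_f, of "Suc k"] by eventually_elim auto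
      qed
      with pI show "p \<in> segment u f"
        by (simp add: segment_def [OF u])
    qed
    ultimately show "p \<in> supremum_layer u a"
      using pI by (simp add: supremum_layer_def)
  next
    fix p
    assume p: "p \<in> supremum_layer u a"
    then have pI: "p \<in> topspace (I_space u)" and upper: "\<And>k. le_u u (a k) p"
      and least: "\<And>y. y \<in> topspace (I_space u) \<Longrightarrow> (\<And>k. le_u u (a k) y) \<Longrightarrow> le_u u p y"
      by (auto simp: supremum_layer_def)
    have p_top: "p \<in> topspace (stone_cech M_space)"
      by (rule I_space_subset [OF u pI])
    have "p \<in> scl M_space A" if A: "tail_set A" for A
    proof -
      obtain m where m: "\<And>k. m \<le> k \<Longrightarrow> \<forall>\<^sub>F n in u. arcs \<alpha> k n ` {0..1} \<subseteq> A"
        using A by (auto simp: tail_set_def eventually_tails eventually_sequentially)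
      \<comment> \<open>One condition per arc: if the first \<open>N n\<close> of them hold at
        \<open>n\<close>, all arcs from \<open>\<alpha> m n\<close> up to \<open>f n\<close> run
        upwards and inside \<open>A\<close>.\<close>
      define P where "P k n \<longleftrightarrow> \<alpha> k n < \<alpha> (Suc k) n \<and> (m \<le> k \<longrightarrow> arcs \<alpha> k n ` {0..1} \<subseteq> A)" for k n
      have P: "\<forall>\<^sub>F n in u. P k n" for k
      proof (cases "m \<le> k")
        case True
        from \<alpha>(4) [of k] m [OF True] show ?thesis
          by eventually_elim (simp add: P_def)
      next
        case False
        from \<alpha>(4) [of k] show ?thesis
          by eventually_elim (simp add: P_def False)
      qed
      define N where "N = initial_length P"
      define f where "f n = \<alpha> (N n) n" for n
      have mono_n: "\<alpha> i n \<le> \<alpha> j n" if "i \<le> j" "j \<le> N n" for i j n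
        using that
      proof (induction j rule: dec_induct)
        case (step j)
        then have "j < N n"
          by simp
        then have "P j n"
          unfolding N_def by (rule initial_length)
        then have "\<alpha> j n \<le> \<alpha> (Suc j) n"
          by (simp add: P_def)
        with step.IH \<open>j < N n\<close> show ?case
          by simp
      qed simp
      have f_ge: "\<forall>\<^sub>F n in u. \<alpha> k n \<le> f n" for k
        using initial_length_unbounded [of u P k, OF u P] by eventually_elim (simp add: f_def N_def mono_n)
      have f_unit: "f n \<in> {0..1}" for n
        unfolding f_def by (rule \<alpha>(1))
      \<comment> \<open>\<open>f\<close> dominates every \<open>\<alpha> k\<close>, so
        \<open>y\<close> is an upper bound of the sequence, and minimality puts \<open>p\<close>
        below it.\<close>
      define y where "y = limit_point u f"
      have y: "y \<in> topspace (I_space u)" "y \<in> mcl (\<lambda>n x. x = f n)"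
        unfolding y_def by (intro limit_point [OF u] f_unit)+
      have "le_u u (a k) y" for k
        unfolding le_u_iff_segments [OF u]
      proof (intro conjI allI impI a_I y)
        fix h :: "nat \<Rightarrow> real"
        assume "y \<in> segment u h"
        then have le: "y \<in> mcl (\<lambda>n x. x \<le> h n)"
          by (simp add: segment_def [OF u])
        have ge: "y \<in> mcl (\<lambda>n x. f n \<le> x)"
          by (rule mcl_mono [OF y(2)]) simp
        have "\<not> (\<forall>\<^sub>F n in u. h n < f n)"
          using mcl_le_ge_False [OF u y(1) le ge] by blast
        then have "\<forall>\<^sub>F n in u. f n \<le> h n"
          by (simp add: not_ev [symmetric] not_less)
        with f_ge [of k] have "\<forall>\<^sub>F n in u. \<alpha> k n \<le> h n"
          by eventually_elim simp
        from segment_mono [OF u this] \<alpha>(2) show "a k \<in> segment u h"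
          by blast
      qed
      then have "le_u u p y"
        using y(1) least by blast
      moreover have "y \<in> segment u f"
        using y by (auto simp: segment_def [OF u] elim: mcl_mono)
      ultimately have "p \<in> segment u f"
        using f_unit unfolding le_u_iff_segments [OF u] by blast
      then have p_f: "p \<in> mcl (\<lambda>n x. x \<le> f n)"
        by (simp add: segment_def [OF u])
      \<comment> \<open>Being above \<open>a (Suc m)\<close>, \<open>p\<close> is not below
        \<open>\<alpha> m\<close>. This discards the arcs before the \<open>m\<close>-th, which need
        not lie in \<open>A\<close>.\<close>
      have "p \<notin> segment u (\<alpha> m)"
        using upper [of "Suc m"] \<alpha>(1,3) unfolding le_u_iff_segments [OF u] by blast
      then have not_m: "p \<notin> mcl (\<lambda>n x. x \<le> \<alpha> m n)"
        using pI by (simp add: segment_def [OF u])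
      have "p \<in> mcl (\<lambda>n x. x \<le> \<alpha> m n \<or> (\<alpha> m n \<le> x \<and> x \<le> f n))"
        using p_f by (rule mcl_mono) auto
      then have "p \<in> mcl (\<lambda>n x. \<alpha> m n \<le> x \<and> x \<le> f n)"
        using not_m by (simp add: mcl_disj)
      then have "p \<in> mcl (\<lambda>n x. (n, x) \<in> A)"
      proof (rule mcl_ae [OF u pI])
        show "\<forall>\<^sub>F n in u. \<forall>x\<in>{0..1}. \<alpha> m n \<le> x \<and> x \<le> f n \<longrightarrow> (n, x) \<in> A"
          using initial_length_unbounded [of u P "Suc m", OF u P]
        proof eventually_elim
          case (elim n)
          show ?case
          proof (intro ballI impI)
            fix x :: real
            assume "\<alpha> m n \<le> x \<and> x \<le> f n"
            then obtain j where j: "m \<le> j" "j < N n" "\<alpha> j n \<le> x" "x \<le> \<alpha> (Suc j) n"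
              using ex_step_between [of "\<lambda>i. \<alpha> i n" m x "N n"] elim by (auto simp: f_def N_def)
            have "P j n"
              using j(2) unfolding N_def by (rule initial_length)
            then have Pj: "\<alpha> j n < \<alpha> (Suc j) n" "arcs \<alpha> j n ` {0..1} \<subseteq> A"
              using j(1) by (auto simp: P_def)
            define y where "y = (x - \<alpha> j n) / (\<alpha> (Suc j) n - \<alpha> j n)"
            have "y \<in> {0..1}"
              using j Pj(1) by (simp add: y_def field_simps)
            moreover have "arcs \<alpha> j n y = (n, x)"
              using Pj(1) by (simp add: arcs_def y_def)
            ultimately show "(n, x) \<in> A"
              using Pj(2) by (metis image_eqI subsetD)
          qed
        qed
      qed
      moreover have "{z. snd z \<in> {0..1} \<and> (fst z, snd z) \<in> A} = A"
        using A by (auto simp: tail_set_def)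
      ultimately show ?thesis
        by (simp add: mcl_def)
    qed
    with p_top show "p \<in> core"
      by (simp add: core_def)
  qed
qed

theorem theorem3p2:
  fixes u :: "nat filter" and a :: "nat \<Rightarrow> (nat \<times> real \<Rightarrow> real) \<Rightarrow> real"
  assumes "continuum_hypothesis"
    and "nonprincipal_ultrafilter u"
    and "\<And>n. cut_point (I_space u) (a n)"
    and "\<And>n. less_u u (a n) (a (Suc n))"
  shows "subtopology (I_space u) (supremum_layer u a) homeomorphic_space
           stone_cech_remainder (top_of_set {0 :: real ..})"
proof -
  obtain \<alpha> where \<alpha>: "\<And>k n. \<alpha> k n \<in> {0..1}" "\<And>k. a k \<in> segment u (\<alpha> k)"
    "\<And>k. a (Suc k) \<notin> segment u (\<alpha> k)" "\<And>k. \<forall>\<^sub>F n in u. \<alpha> k n < \<alpha> (Suc k) n"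
    using increasing_sequence_separators [of u a, OF assms(2,4)] by blast
  have "supremum_layer u a \<subseteq> {p \<in> topspace (stone_cech M_space).
      stone_cech_map M_space omega_space fst p = omega_point u}"
    by (auto simp: supremum_layer_def I_space_def)
  then have "subtopology (I_space u) (supremum_layer u a) =
      subtopology (stone_cech M_space) (supremum_layer u a)"
    by (simp add: I_space_def subtopology_subtopology inf_absorb2)
  also have "\<dots> = subtopology (stone_cech M_space) (chart_system.core M_space u (arcs \<alpha>))"
    by (simp add: supremum_layer_eq_core [of u \<alpha> a, OF assms(2) \<alpha>])
  also have "\<dots> homeomorphic_space subtopology (stone_cech half_line) half_line.core"
    by (rule cores_homeomorphic [OF assms(1) chart_system_arcs [of u \<alpha>, OF assms(2) \<alpha>(1,4)] chart_system_half_line])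
  finally show ?thesis
    by (simp add: half_line_remainder)
qed

end
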